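(* Let $\Omega\subset\mathbb{R}^2$ be a bounded domain with $C^2$-boundary and let $\varphi\in C^2(\overline{\Omega})$. Let $\mathcal{M}:=\{v\in H^2(\Omega): v-\varphi\in H^2_0(\Omega)\}$ and let $\overline{W}$ be the $L^1(\Omega)$-lower semicontinuous relaxation of the Willmore functional $W_0$ on $\mathcal{M}$. Then for every $u\in\mathcal{M}$ one has $\overline{W}(u)=W_0(u)$.
   Context: For $v\in H^2(\Omega)$ the Willmore energy of its graph is $$W_0(v)=\frac14\int_\Omega\Bigl(\nabla\cdot\frac{\nabla v}{\sqrt{1+|\nabla v|^2}}\Bigr)^2\sqrt{1+|\nabla v|^2}\,dx .$$ The relaxation is $$\overline{W}:L^1(\Omega)\to[0,\infty],\quad \overline{W}(u):=\inf\Bigl\{\liminf_{k\to\infty}W_0(u_k):\ u_k\in\mathcal{M},\ u_k\to u\text{ in }L^1(\Omega)\Bigr\}.$$ *)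

theory Defs
  imports "HOL-Analysis.Analysis"
begin

section \<open>Classical differentiability\<close>

definition partial_deriv :: "'a::euclidean_space \<Rightarrow> ('a \<Rightarrow> real) \<Rightarrow> 'a \<Rightarrow> real" where
  "partial_deriv i f x = frechet_derivative f (at x) i"

fun iter_partial :: "'a::euclidean_space list \<Rightarrow> ('a \<Rightarrow> real) \<Rightarrow> 'a \<Rightarrow> real" where
  "iter_partial [] f = f"
| "iter_partial (i # is) f = iter_partial is (partial_deriv i f)"

text \<open>Intended for open \<open>S\<close>, where \<open>differentiable_on\<close> agrees with differentiability \<open>at x\<close>.\<close>

definition Ck_on :: "nat \<Rightarrow> 'a::euclidean_space set \<Rightarrow> ('a \<Rightarrow> real) set" where
  "Ck_on k S = {f. \<forall>is \<in> lists Basis. length is \<le> k \<longrightarrow>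
      continuous_on S (iter_partial is f) \<and>
      (length is < k \<longrightarrow> iter_partial is f differentiable_on S)}"

text \<open>The space \<open>C\<^sup>k\<close> of the closure of an open set \<open>S\<close>: all derivatives of order at most \<open>k\<close>
  exist in \<open>S\<close> and extend continuously to the closure.\<close>

definition Ck_closure :: "nat \<Rightarrow> 'a::euclidean_space set \<Rightarrow> ('a \<Rightarrow> real) set" where
  "Ck_closure k S = {f \<in> Ck_on k S. \<forall>is \<in> lists Basis. length is \<le> k \<longrightarrow>
      (\<exists>g. continuous_on (closure S) g \<and> (\<forall>x\<in>S. g x = iter_partial is f x))}"

text \<open>Near each boundary point, in suitable orthonormal coordinates \<open>(e \<bullet> x, \<nu> \<bullet> x)\<close>, the set is
  the region strictly above the graph of a \<open>C\<^sup>2\<close> function.\<close>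

definition C2_boundary :: "(real ^ 2) set \<Rightarrow> bool" where
  "C2_boundary \<Omega> \<longleftrightarrow> (\<forall>x0 \<in> frontier \<Omega>. \<exists>r>0. \<exists>e \<nu>. \<exists>\<gamma> \<in> Ck_on 2 (UNIV :: real set).
      norm e = 1 \<and> norm \<nu> = 1 \<and> e \<bullet> \<nu> = 0 \<and>
      \<Omega> \<inter> ball x0 r = {x \<in> ball x0 r. \<gamma> (e \<bullet> x) < \<nu> \<bullet> x})"

section \<open>Weak derivatives and Sobolev spaces\<close>

text \<open>Functions on \<open>\<Omega>\<close> are represented by total functions whose values outside \<open>\<Omega>\<close> are
  irrelevant; no quotient by almost-everywhere equality is taken.\<close>

definition test_fun :: "'a::euclidean_space set \<Rightarrow> ('a \<Rightarrow> real) set" where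
  "test_fun \<Omega> = {\<eta>. (\<forall>k. \<eta> \<in> Ck_on k UNIV) \<and>
      compact (closure {x. \<eta> x \<noteq> 0}) \<and> closure {x. \<eta> x \<noteq> 0} \<subseteq> \<Omega>}"

definition locally_integrable :: "'a::euclidean_space set \<Rightarrow> ('a \<Rightarrow> real) \<Rightarrow> bool" where
  "locally_integrable \<Omega> f \<longleftrightarrow> (\<forall>K. compact K \<and> K \<subseteq> \<Omega> \<longrightarrow> f absolutely_integrable_on K)"

definition has_weak_deriv ::
    "'a::euclidean_space set \<Rightarrow> 'a \<Rightarrow> ('a \<Rightarrow> real) \<Rightarrow> ('a \<Rightarrow> real) \<Rightarrow> bool" where
  "has_weak_deriv \<Omega> i f g \<longleftrightarrow> locally_integrable \<Omega> f \<and> locally_integrable \<Omega> g \<and>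
      (\<forall>\<eta> \<in> test_fun \<Omega>. (LINT x|lebesgue_on \<Omega>. f x * partial_deriv i \<eta> x)
                       = - (LINT x|lebesgue_on \<Omega>. g x * \<eta> x))"

text \<open>A representative of the weak derivative, which is unique up to null sets if it exists.\<close>

definition weak_deriv :: "'a::euclidean_space set \<Rightarrow> 'a \<Rightarrow> ('a \<Rightarrow> real) \<Rightarrow> 'a \<Rightarrow> real" where
  "weak_deriv \<Omega> i f = (SOME g. has_weak_deriv \<Omega> i f g)"

definition weak_grad :: "'a::euclidean_space set \<Rightarrow> ('a \<Rightarrow> real) \<Rightarrow> 'a \<Rightarrow> 'a" where
  "weak_grad \<Omega> f x = (\<Sum>i\<in>Basis. weak_deriv \<Omega> i f x *\<^sub>R i)"

definition weak_div :: "'a::euclidean_space set \<Rightarrow> ('a \<Rightarrow> 'a) \<Rightarrow> 'a \<Rightarrow> real" where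
  "weak_div \<Omega> F x = (\<Sum>i\<in>Basis. weak_deriv \<Omega> i (\<lambda>y. F y \<bullet> i) x)"

definition L2_fun :: "'a::euclidean_space set \<Rightarrow> ('a \<Rightarrow> real) set" where
  "L2_fun \<Omega> = {f \<in> borel_measurable (lebesgue_on \<Omega>). integrable (lebesgue_on \<Omega>) (\<lambda>x. (f x)\<^sup>2)}"

primrec Hk :: "nat \<Rightarrow> 'a::euclidean_space set \<Rightarrow> ('a \<Rightarrow> real) set" where
  "Hk 0 \<Omega> = L2_fun \<Omega>"
| "Hk (Suc k) \<Omega> = {f \<in> L2_fun \<Omega>. \<forall>i\<in>Basis. \<exists>g \<in> Hk k \<Omega>. has_weak_deriv \<Omega> i f g}"

text \<open>The squared Sobolev norm; for \<open>k = 2\<close> it is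
  \<open>\<integral>\<^sub>\<Omega> f\<^sup>2 + \<bar>\<nabla>f\<bar>\<^sup>2 + \<bar>D\<^sup>2f\<bar>\<^sup>2\<close> with the Frobenius norm of the Hessian.\<close>

primrec Hk_normsq :: "nat \<Rightarrow> 'a::euclidean_space set \<Rightarrow> ('a \<Rightarrow> real) \<Rightarrow> real" where
  "Hk_normsq 0 \<Omega> f = (LINT x|lebesgue_on \<Omega>. (f x)\<^sup>2)"
| "Hk_normsq (Suc k) \<Omega> f =
     (LINT x|lebesgue_on \<Omega>. (f x)\<^sup>2) + (\<Sum>i\<in>Basis. Hk_normsq k \<Omega> (weak_deriv \<Omega> i f))"

definition Hk0 :: "nat \<Rightarrow> 'a::euclidean_space set \<Rightarrow> ('a \<Rightarrow> real) set" where
  "Hk0 k \<Omega> = {f \<in> Hk k \<Omega>. \<forall>\<epsilon>>0. \<exists>\<eta> \<in> test_fun \<Omega>. sqrt (Hk_normsq k \<Omega> (\<lambda>x. f x - \<eta> x)) < \<epsilon>}"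

section \<open>The Willmore functional and its relaxation\<close>

definition admissible :: "(real ^ 2) set \<Rightarrow> (real ^ 2 \<Rightarrow> real) \<Rightarrow> (real ^ 2 \<Rightarrow> real) set" where
  "admissible \<Omega> \<phi> = {v \<in> Hk 2 \<Omega>. (\<lambda>x. v x - \<phi> x) \<in> Hk0 2 \<Omega>}"

definition willmore :: "(real ^ 2) set \<Rightarrow> (real ^ 2 \<Rightarrow> real) \<Rightarrow> ennreal" where
  "willmore \<Omega> v = ennreal (1 / 4) * (\<integral>\<^sup>+ x. ennreal (
      (weak_div \<Omega> (\<lambda>y. weak_grad \<Omega> v y /\<^sub>R sqrt (1 + (norm (weak_grad \<Omega> v y))\<^sup>2)) x)\<^sup>2
        * sqrt (1 + (norm (weak_grad \<Omega> v x))\<^sup>2)) \<partial>lebesgue_on \<Omega>)"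

definition L1_converges ::
    "'a::euclidean_space set \<Rightarrow> (nat \<Rightarrow> 'a \<Rightarrow> real) \<Rightarrow> ('a \<Rightarrow> real) \<Rightarrow> bool" where
  "L1_converges \<Omega> U u \<longleftrightarrow>
      (\<forall>k. integrable (lebesgue_on \<Omega>) (U k)) \<and> integrable (lebesgue_on \<Omega>) u \<and>
      (\<lambda>k. LINT x|lebesgue_on \<Omega>. \<bar>U k x - u x\<bar>) \<longlonglongrightarrow> 0"

text \<open>The infimum over the empty set is \<open>\<infinity>\<close>.\<close>

definition willmore_relax ::
    "(real ^ 2) set \<Rightarrow> (real ^ 2 \<Rightarrow> real) \<Rightarrow> (real ^ 2 \<Rightarrow> real) \<Rightarrow> ennreal" where
  "willmore_relax \<Omega> \<phi> u =
     Inf {liminf (\<lambda>k. willmore \<Omega> (U k)) | U. (\<forall>k. U k \<in> admissible \<Omega> \<phi>) \<and> L1_converges \<Omega> U u}"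

end

(*
  Write N(p) = p / sqrt (1 + |p|^2) and r(p) = 1 / sqrt (1 + |p|^2), so that (N, r) is a unit vector.
  For u and v in M the vector fields N(grad u), N(grad v) have square integrable divergences h_u, h_v.
  Testing div (N(grad u) - N(grad v)) with arctan (u - v), which is bounded by sqrt (2 |u - v|), and
  using the strong monotonicity of N, one obtains

    int |N(grad u) - N(grad v)|^2 + |r(grad u) - r(grad v)|^2
      <= (|h_u|_2 + |h_v|_2) sqrt (2 |u - v|_1) + 3 |u - v|_1.

  Hence along a sequence of bounded energy that converges in L^1, the normals converge strongly in L^2.
  The energy is the supremum over test functions s of int 2 h_u s - s^2 r(grad u), which equals
  - int 2 N(grad u) . grad s + s^2 r(grad u) and therefore is continuous under this convergence; so
  the energy is lower semicontinuous.  The approximation of u by phi plus test functions, contained in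
  the definition of M, justifies the chain rule for N(grad u) and the test function arctan (u - v).
*)

theory Submission
  imports Defs
begin

section \<open>Smooth functions\<close>

text \<open>The obstacle is the degeneracy of the mean curvature operator at steep slopes: the
  derivative of N decays as the slope grows, so an energy bound does not directly control gradients
  or Hessians along a sequence. The pair (N, r) is bounded whatever the slope, and the energy
  dominates the squared L^2 norm of the divergence because the area element is at least 1. Hence
  normals are compared, never gradients. The test function has to be small in L^2 when w = u - v is
  small only in L^1, and its gradient has to be a nonnegative multiple of grad u - grad v, so that
  monotonicity applies. The choice arctan w does both; moreover arctan 0 = 0 and arctan is smooth,
  so test functions stay test functions. The price is the weight 1 / (1 + w^2) in front of the
  monotone expression. Removing it costs at most |w| / 2 times the pointwise bound 5 of the squared
  distance of normals, and 5 / 2 rounded up is the constant 3.\<close>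

definition smooth :: "('a::euclidean_space \<Rightarrow> real) set" where
  "smooth = {f. \<forall>k. f \<in> Ck_on k UNIV}"

lemma partial_deriv_eq:
  "(f has_derivative D) (at x) \<Longrightarrow> partial_deriv i f x = D i"
  unfolding partial_deriv_def by (metis frechet_derivative_at)

text \<open>A set of differentiable functions that contains its own partial derivatives contains all
  iterated ones, by induction on the list of directions, and differentiability supplies continuity.
  Proofs of smoothness exhibit such an invariant set and never compute derivatives of higher
  order.\<close>

lemma smooth_coinduct:
  assumes "f \<in> A"
    and "\<And>g x. g \<in> A \<Longrightarrow> g differentiable (at x)"
    and "\<And>g i. g \<in> A \<Longrightarrow> i \<in> Basis \<Longrightarrow> partial_deriv i g \<in> A"
  shows "f \<in> smooth"
proof -
  have A: "iter_partial is g \<in> A" if "is \<in> lists Basis" "g \<in> A" for "is" g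
    using that by (induction "is" arbitrary: g) (auto intro: assms)
  have "g differentiable_on UNIV" if "g \<in> A" for g
    using assms(2)[OF that] by (simp add: differentiable_on_def)
  with A[OF _ assms(1)] show ?thesis
    unfolding smooth_def Ck_on_def by (auto intro: differentiable_imp_continuous_on)
qed

lemma smooth_differentiable:
  assumes "f \<in> smooth" shows "f differentiable (at x)"
proof -
  have "f \<in> Ck_on 1 UNIV"
    using assms by (simp add: smooth_def)
  then have "\<forall>is\<in>lists Basis. length is < 1 \<longrightarrow> iter_partial is f differentiable_on UNIV"
    by (simp add: Ck_on_def)
  from bspec[OF this, of "[]"] have "f differentiable_on UNIV"
    by simp
  then show ?thesis by (simp add: differentiable_on_def)
qed

lemma smooth_has_derivative:
  "f \<in> smooth \<Longrightarrow> (f has_derivative (\<lambda>v. frechet_derivative f (at x) v)) (at x)"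
  using smooth_differentiable frechet_derivative_works by blast

lemma smooth_continuous_on: "f \<in> smooth \<Longrightarrow> continuous_on S f"
  by (meson continuous_at_imp_continuous_on differentiable_imp_continuous_within smooth_differentiable)

lemma smooth_partial:
  assumes "f \<in> smooth" "i \<in> Basis" shows "partial_deriv i f \<in> smooth"
  unfolding smooth_def Ck_on_def
proof (intro CollectI allI ballI impI)
  fix k "is" assume "is \<in> lists (Basis :: 'a set)" and "length is \<le> k"
  \<comment> \<open>\<open>iter_partial\<close> differentiates in the direction at the head of the
    list first, so order \<open>k\<close> for the partial derivative is order \<open>Suc k\<close>
    for \<open>f\<close>, with \<open>i\<close> put in front.\<close>
  moreover have "f \<in> Ck_on (Suc k) UNIV"
    using assms by (simp add: smooth_def)
  then have "\<forall>is\<in>lists Basis. length is \<le> Suc k \<longrightarrow>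
      continuous_on UNIV (iter_partial is f) \<and>
      (length is < Suc k \<longrightarrow> iter_partial is f differentiable_on UNIV)"
    by (simp add: Ck_on_def)
  then have "i # is \<in> lists Basis \<longrightarrow> length (i # is) \<le> Suc k \<longrightarrow>
      continuous_on UNIV (iter_partial (i # is) f) \<and>
      (length (i # is) < Suc k \<longrightarrow> iter_partial (i # is) f differentiable_on UNIV)"
    by blast
  ultimately show "continuous_on UNIV (iter_partial is (partial_deriv i f)) \<and>
      (length is < k \<longrightarrow> iter_partial is (partial_deriv i f) differentiable_on UNIV)"
    using assms by simp
qed

section \<open>Function algebras closed under differentiation, and compositions\<close>

inductive_set alg_hull :: "('a \<Rightarrow> real) set \<Rightarrow> ('a \<Rightarrow> real) set" for B where
  base: "b \<in> B \<Longrightarrow> b \<in> alg_hull B"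
| add: "f \<in> alg_hull B \<Longrightarrow> g \<in> alg_hull B \<Longrightarrow> (\<lambda>x. f x + g x) \<in> alg_hull B"
| mult: "f \<in> alg_hull B \<Longrightarrow> g \<in> alg_hull B \<Longrightarrow> (\<lambda>x. f x * g x) \<in> alg_hull B"

text \<open>By the Leibniz rule the derivative of a sum or product is built from the two functions
  and their derivatives by sums and products again. The hull thus inherits differentiability and
  invariance from its generators, and coinduction applies to it.\<close>

lemma alg_hull_smooth:
  fixes B :: "('a::euclidean_space \<Rightarrow> real) set"
  assumes B: "\<And>b x. b \<in> B \<Longrightarrow> b differentiable (at x)"
    and dB: "\<And>b i. b \<in> B \<Longrightarrow> i \<in> Basis \<Longrightarrow> partial_deriv i b \<in> alg_hull B"
    and "f \<in> alg_hull B"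
  shows "f \<in> smooth"
proof (rule smooth_coinduct[OF assms(3)])
  have *: "(\<forall>x. g differentiable (at x)) \<and> (\<forall>i\<in>Basis. partial_deriv i g \<in> alg_hull B)"
    if "g \<in> alg_hull B" for g
    using that
  proof induction
    case (base b)
    then show ?case using B dB by auto
  next
    case (add f g)
    have "partial_deriv i (\<lambda>x. f x + g x) x = partial_deriv i f x + partial_deriv i g x" for i x
      using add by (subst partial_deriv_eq)
        (auto intro!: has_derivative_add frechet_derivative_works[THEN iffD1] simp: partial_deriv_def)
    then have "partial_deriv i (\<lambda>x. f x + g x) = (\<lambda>x. partial_deriv i f x + partial_deriv i g x)" for i
      by auto
    with add show ?case by (auto intro: alg_hull.add)
  next
    case (mult f g)
    have "partial_deriv i (\<lambda>x. f x * g x) x = f x * partial_deriv i g x + partial_deriv i f x * g x" for i x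
      using mult by (subst partial_deriv_eq)
        (auto intro!: has_derivative_mult frechet_derivative_works[THEN iffD1] simp: partial_deriv_def)
    then have "partial_deriv i (\<lambda>x. f x * g x) =
        (\<lambda>x. f x * partial_deriv i g x + partial_deriv i f x * g x)" for i
      by auto
    with mult show ?case by (auto intro!: alg_hull.add alg_hull.mult)
  qed
  show "\<And>g x. g \<in> alg_hull B \<Longrightarrow> g differentiable (at x)"
    and "\<And>g i. g \<in> alg_hull B \<Longrightarrow> i \<in> Basis \<Longrightarrow> partial_deriv i g \<in> alg_hull B"
    using * by auto
qed

lemma smooth_alg_hull: "f \<in> alg_hull smooth \<Longrightarrow> f \<in> smooth"
  by (rule alg_hull_smooth) (auto intro: smooth_differentiable smooth_partial alg_hull.base)

lemma smooth_add [intro]: "f \<in> smooth \<Longrightarrow> g \<in> smooth \<Longrightarrow> (\<lambda>x. f x + g x) \<in> smooth"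
  by (rule smooth_alg_hull[OF alg_hull.add[OF alg_hull.base alg_hull.base]])

lemma smooth_mult [intro]: "f \<in> smooth \<Longrightarrow> g \<in> smooth \<Longrightarrow> (\<lambda>x. f x * g x) \<in> smooth"
  by (rule smooth_alg_hull[OF alg_hull.mult[OF alg_hull.base alg_hull.base]])

lemma smooth_const [intro, simp]: "(\<lambda>x::'a::euclidean_space. c) \<in> smooth"
proof (rule smooth_coinduct[where A = "range (\<lambda>c (x::'a). c)"])
  show "partial_deriv i g \<in> range (\<lambda>c x. c)" if "g \<in> range (\<lambda>c (x::'a). c)" for g :: "'a \<Rightarrow> real" and i
  proof -
    from that obtain c where g: "g = (\<lambda>x. c)" by auto
    have "partial_deriv i g x = 0" for x
      unfolding g by (rule partial_deriv_eq) (rule has_derivative_const)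
    then show ?thesis by auto
  qed
qed auto

lemma smooth_diff [intro]:
  assumes "f \<in> smooth" "g \<in> smooth" shows "(\<lambda>x. f x - g x) \<in> smooth"
  using smooth_add[OF assms(1) smooth_mult[OF smooth_const assms(2), of "-1"]] by simp

lemma smooth_sum:
  "finite I \<Longrightarrow> (\<And>i. i \<in> I \<Longrightarrow> f i \<in> smooth) \<Longrightarrow> (\<lambda>x. \<Sum>i\<in>I. f i x) \<in> smooth"
  by (induction I rule: finite_induct) auto

lemma smooth_prod:
  "finite I \<Longrightarrow> (\<And>i. i \<in> I \<Longrightarrow> f i \<in> smooth) \<Longrightarrow> (\<lambda>x. \<Prod>i\<in>I. f i x) \<in> smooth"
  by (induction I rule: finite_induct) auto

lemma smooth_power [intro]: "f \<in> smooth \<Longrightarrow> (\<lambda>x. f x ^ n) \<in> smooth"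
  by (induction n) auto

lemma smooth_linear:
  assumes "bounded_linear f" shows "f \<in> smooth"
proof (rule smooth_coinduct[where A = "insert f smooth"])
  have "partial_deriv i f = (\<lambda>x. f i)" for i
    by (intro ext partial_deriv_eq bounded_linear_imp_has_derivative assms)
  then show "\<And>g i. g \<in> insert f smooth \<Longrightarrow> i \<in> Basis \<Longrightarrow> partial_deriv i g \<in> insert f smooth"
    using smooth_partial by auto
  show "\<And>g x. g \<in> insert f smooth \<Longrightarrow> g differentiable (at x)"
    using assms bounded_linear_imp_differentiable smooth_differentiable by blast
qed auto

lemma smooth_polynomial: "real_polynomial_function p \<Longrightarrow> p \<in> smooth"
  by (induction rule: real_polynomial_function.induct) (auto intro: smooth_linear)

lemma partial_deriv_compose:
  assumes "(g has_real_derivative g') (at (f x))" "f differentiable (at x)"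
  shows "partial_deriv i (\<lambda>x. g (f x)) x = g' * partial_deriv i f x"
proof -
  have f: "(f has_derivative frechet_derivative f (at x)) (at x)"
    using assms(2) by (simp add: frechet_derivative_works)
  have "((\<lambda>x. g (f x)) has_derivative (\<lambda>v. frechet_derivative f (at x) v * g')) (at x)"
    using DERIV_compose_FDERIV[OF assms(1) f] by simp
  from partial_deriv_eq[OF this] show ?thesis by (simp add: partial_deriv_def mult.commute)
qed

text \<open>The chain rule gives \<open>G' n (f x) * partial_deriv i f x\<close>, which stays in the
  algebra generated by the smooth functions and all \<open>G m\<close> composed with
  \<open>f\<close>. The family is indexed because the derivative of one member usually involves
  other members.\<close>

lemma smooth_compose_family:
  fixes f :: "'a::euclidean_space \<Rightarrow> real" and G :: "nat \<Rightarrow> real \<Rightarrow> real"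
  assumes f: "f \<in> smooth"
    and G: "\<And>n s. (G n has_real_derivative G' n s) (at s)"
    and G': "\<And>n. (\<lambda>x. G' n (f x)) \<in> alg_hull (smooth \<union> {\<lambda>x. G n (f x) | n. True})"
  shows "(\<lambda>x. G n (f x)) \<in> smooth"
proof (rule alg_hull_smooth)
  let ?B = "smooth \<union> {\<lambda>x. G n (f x) | n. True}"
  show "(\<lambda>x. G n (f x)) \<in> alg_hull ?B"
    by (rule alg_hull.base) auto
  have fd: "f differentiable (at x)" for x
    using f by (rule smooth_differentiable)
  fix b assume b: "b \<in> ?B"
  have "(\<lambda>x. G n (f x)) differentiable (at x)" for n x
    using DERIV_compose_FDERIV[OF G smooth_has_derivative[OF f]] by (rule differentiableI)
  with b show "b differentiable (at x)" for x
    by (auto intro: smooth_differentiable)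
  have "partial_deriv i (\<lambda>x. G n (f x)) = (\<lambda>x. G' n (f x) * partial_deriv i f x)" for i n
    using partial_deriv_compose[OF G fd] by auto
  moreover have "(\<lambda>x. G' n (f x) * partial_deriv i f x) \<in> alg_hull ?B" if "i \<in> Basis" for i n
    by (intro alg_hull.mult G' alg_hull.base UnI1 smooth_partial f that)
  ultimately show "partial_deriv i b \<in> alg_hull ?B" if "i \<in> Basis" for i
    using b that by (auto intro: alg_hull.base smooth_partial)
qed

lemma smooth_arctan:
  assumes "f \<in> smooth" shows "(\<lambda>x. arctan (f x)) \<in> smooth"
proof -
  \<comment> \<open>Two functions close the system: with g(s) = 1 / (1 + s^2), arctan' = g and g' =
    -2 s g^2. All indices from 1 on denote g.\<close>
  define G :: "nat \<Rightarrow> real \<Rightarrow> real"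
    where "G n = (if n = 0 then arctan else (\<lambda>s. inverse (1 + s\<^sup>2)))" for n
  define G' :: "nat \<Rightarrow> real \<Rightarrow> real"
    where "G' n = (if n = 0 then G 1 else (\<lambda>s. - 2 * s * (G 1 s * G 1 s)))" for n
  have pos: "1 + s\<^sup>2 \<noteq> 0" for s :: real
    by (metis add_pos_nonneg less_numeral_extra(1) less_irrefl zero_le_power2)
  have "(\<lambda>x. G 0 (f x)) \<in> smooth"
  proof (rule smooth_compose_family[where G' = G', OF assms])
    show "(G n has_real_derivative G' n s) (at s)" for n s
      unfolding G_def G'_def using pos[of s]
      by (auto intro!: derivative_eq_intros DERIV_arctan simp: field_simps power2_eq_square)
    have "(\<lambda>x. - 2 * f x) \<in> smooth"
      by (rule smooth_mult[OF smooth_const assms])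
    then have "(\<lambda>x. - 2 * f x * (G 1 (f x) * G 1 (f x)))
        \<in> alg_hull (smooth \<union> {\<lambda>x. G n (f x) |n. True})"
      by (intro alg_hull.mult[of "\<lambda>x. - 2 * f x"] alg_hull.mult[of "\<lambda>x. G 1 (f x)"])
        (rule alg_hull.base; blast)+
    then show "(\<lambda>x. G' n (f x)) \<in> alg_hull (smooth \<union> {\<lambda>x. G n (f x) |n. True})" for n
      by (auto simp: G'_def intro!: alg_hull.base)
  qed
  then show ?thesis by (simp add: G_def)
qed

section \<open>The flat functions t^(-n) exp(-1/t) and smooth bumps\<close>

definition exp_inv :: "nat \<Rightarrow> real \<Rightarrow> real" where
  "exp_inv n t = (if t > 0 then inverse t ^ n * exp (- inverse t) else 0)"

text \<open>A single term of the exponential series is at most its sum, since all terms are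
  nonnegative.\<close>

lemma power_le_fact_exp:
  fixes s :: real
  assumes "s \<ge> 0" shows "s ^ n \<le> fact n * exp s"
proof -
  have "s ^ n /\<^sub>R fact n \<le> (\<Sum>k. s ^ k /\<^sub>R fact k)"
    using assms sum_le_suminf[OF summable_exp_generic[of s], of "{n}"] by simp
  then show ?thesis
    by (simp add: exp_def field_simps)
qed

text \<open>The series bound is taken at 1/t with exponent \<open>n + 2\<close>. The two surplus
  powers give quadratic decay at 0, so even the difference quotient at 0 vanishes in the
  limit.\<close>

lemma exp_inv_le: "\<bar>exp_inv n t\<bar> \<le> fact (n + 2) * t\<^sup>2"
proof (cases "t > 0")
  case True
  have "inverse t ^ (n + 2) \<le> fact (n + 2) * exp (inverse t)"
    using True by (intro power_le_fact_exp) auto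
  then have "inverse t ^ n * exp (- inverse t) \<le> fact (n + 2) * t\<^sup>2"
    using True by (simp add: exp_minus field_simps power_add power2_eq_square)
  then show ?thesis using True by (simp add: exp_inv_def)
qed (simp add: exp_inv_def)

text \<open>The derivative is a combination of two later members of the same family, which is what
  \<open>smooth_compose_family\<close> asks for. The formula persists for t \<le> 0 because every
  member is 0 there.\<close>

lemma DERIV_exp_inv:
  "(exp_inv n has_real_derivative (exp_inv (n + 2) t - n * exp_inv (n + 1) t)) (at t)"
proof -
  consider "t > 0" | "t < 0" | "t = 0" by linarith
  then show ?thesis
  proof cases
    case 1
    have "((\<lambda>t. inverse t ^ n * exp (- inverse t)) has_real_derivative
        (exp_inv (n + 2) t - n * exp_inv (n + 1) t)) (at t)"
    proof -
      have "(inverse has_real_derivative - (inverse t * inverse t)) (at t)"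
        using DERIV_inverse[of t UNIV] 1 by (simp add: power2_eq_square)
      from DERIV_mult[OF DERIV_power[OF this, of n] DERIV_fun_exp[OF DERIV_minus[OF this]]]
      show ?thesis
        using 1 by (cases n) (simp_all add: exp_inv_def algebra_simps)
    qed
    moreover have "\<forall>\<^sub>F s in nhds t. s > 0"
      using 1 order_tendstoD(1)[OF filterlim_ident] by blast
    then have "\<forall>\<^sub>F s in nhds t. inverse s ^ n * exp (- inverse s) = exp_inv n s"
      by eventually_elim (simp add: exp_inv_def)
    then have "((\<lambda>t. inverse t ^ n * exp (- inverse t)) has_real_derivative D) (at t)
        = (exp_inv n has_real_derivative D) (at t)" for D
      by (intro DERIV_cong_ev) auto
    ultimately show ?thesis by simp
  next
    case 2
    have "\<forall>\<^sub>F s in nhds t. s < 0"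
      using 2 order_tendstoD(2)[OF filterlim_ident] by blast
    then have "\<forall>\<^sub>F s in nhds t. 0 = exp_inv n s"
      by eventually_elim (simp add: exp_inv_def)
    then have "((\<lambda>s. 0) has_real_derivative 0) (at t) = (exp_inv n has_real_derivative 0) (at t)"
      by (intro DERIV_cong_ev) auto
    then show ?thesis using 2 by (simp add: exp_inv_def)
  next
    case 3
    \<comment> \<open>At 0 the two branches of the definition meet; the quadratic bound controls the
      quotient from both sides at once.\<close>
    have "((\<lambda>h. exp_inv n h / h) \<longlongrightarrow> 0) (at 0)"
    proof (rule Lim_null_comparison)
      show "\<forall>\<^sub>F h in at 0. norm (exp_inv n h / h) \<le> fact (n + 2) * \<bar>h\<bar>"
      proof (rule always_eventually, rule allI)
        fix h :: real
        have "\<bar>exp_inv n h\<bar> \<le> fact (n + 2) * (\<bar>h\<bar> * \<bar>h\<bar>)"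
          using exp_inv_le[of n h] by (simp only: power2_eq_square abs_mult_self_eq)
        then show "norm (exp_inv n h / h) \<le> fact (n + 2) * \<bar>h\<bar>"
          by (cases "h = 0") (simp_all add: divide_le_eq mult.assoc del: fact_Suc)
      qed
      show "((\<lambda>h. fact (n + 2) * \<bar>h\<bar>) \<longlongrightarrow> (0::real)) (at 0)"
        by (auto intro!: tendsto_eq_intros)
    qed
    then show ?thesis using 3 by (simp add: DERIV_def exp_inv_def)
  qed
qed

lemma smooth_exp_inv:
  assumes f: "f \<in> smooth" shows "(\<lambda>x. exp_inv n (f x)) \<in> smooth"
proof (rule smooth_compose_family[OF f DERIV_exp_inv])
  let ?A = "alg_hull (smooth \<union> {\<lambda>x. exp_inv n (f x) |n. True})"
  fix n
  have b: "(\<lambda>x. exp_inv m (f x)) \<in> ?A" for m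
    by (rule alg_hull.base) auto
  have c: "(\<lambda>x. - real n) \<in> ?A"
    by (rule alg_hull.base) auto
  show "(\<lambda>x. exp_inv (n + 2) (f x) - real n * exp_inv (n + 1) (f x)) \<in> ?A"
    using alg_hull.add[OF b[of "n + 2"] alg_hull.mult[OF c b[of "n + 1"]]] by simp
qed

text \<open>The squared distance is a polynomial in the coordinates, hence smooth also at
  \<open>c\<close>, where the norm is not. The peak value exp(-1/r^2) is below 1, so a bump is not
  yet a cutoff.\<close>

definition bump :: "'a::euclidean_space \<Rightarrow> real \<Rightarrow> 'a \<Rightarrow> real" where
  "bump c r x = exp_inv 0 (r\<^sup>2 - (x - c) \<bullet> (x - c))"

lemma bump_smooth: "bump c r \<in> smooth"
proof -
  have "(\<lambda>x. (x - c) \<bullet> b) \<in> smooth" for b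
    unfolding inner_diff_left by (intro smooth_diff smooth_const smooth_linear bounded_linear_inner_left)
  then have "(\<lambda>x. \<Sum>b\<in>Basis. ((x - c) \<bullet> b) * ((x - c) \<bullet> b)) \<in> smooth"
    by (intro smooth_sum smooth_mult) auto
  then have "(\<lambda>x. r\<^sup>2 - (x - c) \<bullet> (x - c)) \<in> smooth"
    by (subst euclidean_inner) auto
  then show ?thesis
    unfolding bump_def[abs_def] by (rule smooth_exp_inv)
qed

lemma bump_nonneg: "0 \<le> bump c r x" and bump_le_1: "bump c r x \<le> 1"
  by (auto simp: bump_def exp_inv_def)

lemma bump_nonzero_iff:
  assumes "r > 0" shows "bump c r x \<noteq> 0 \<longleftrightarrow> x \<in> ball c r"
proof -
  have "(x - c) \<bullet> (x - c) < r\<^sup>2 \<longleftrightarrow> norm (x - c) < r"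
    using assms power_less_imp_less_base[of "norm (x - c)" 2 r] power_strict_mono[of "norm (x - c)" r 2]
    by (auto simp flip: power2_norm_eq_inner)
  then show ?thesis
    by (simp add: bump_def exp_inv_def dist_norm norm_minus_commute)
qed

section \<open>Test functions\<close>

text \<open>Supports never have to be computed: some compact set outside which the function vanishes
  is enough.\<close>

lemma test_funI:
  assumes "\<eta> \<in> smooth" "compact K" "K \<subseteq> \<Omega>" "\<And>x. x \<notin> K \<Longrightarrow> \<eta> x = 0"
  shows "\<eta> \<in> test_fun \<Omega>"
proof -
  have "closure {x. \<eta> x \<noteq> 0} \<subseteq> K"
    using assms by (intro closure_minimal compact_imp_closed) auto
  moreover from this have "compact (closure {x. \<eta> x \<noteq> 0})"
    using assms(2) by (meson closed_closure compact_closure bounded_subset compact_imp_bounded closure_subset)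
  ultimately show ?thesis
    using assms by (auto simp: test_fun_def smooth_def)
qed

lemma test_funE:
  assumes "\<eta> \<in> test_fun \<Omega>"
  obtains K where "\<eta> \<in> smooth" "compact K" "K \<subseteq> \<Omega>" "\<And>x. x \<notin> K \<Longrightarrow> \<eta> x = 0"
proof (rule that[of "closure {x. \<eta> x \<noteq> 0}"])
  show "\<eta> \<in> smooth" "compact (closure {x. \<eta> x \<noteq> 0})" "closure {x. \<eta> x \<noteq> 0} \<subseteq> \<Omega>"
    using assms by (auto simp: test_fun_def smooth_def)
  show "\<And>x. x \<notin> closure {x. \<eta> x \<noteq> 0} \<Longrightarrow> \<eta> x = 0"
    by (metis (mono_tags, lifting) closure_subset mem_Collect_eq subsetD)
qed

lemma test_fun_smooth: "\<eta> \<in> test_fun \<Omega> \<Longrightarrow> \<eta> \<in> smooth"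
  by (simp add: test_fun_def smooth_def)

lemma test_fun_diff:
  assumes "\<eta> \<in> test_fun \<Omega>" "\<zeta> \<in> test_fun \<Omega>"
  shows "(\<lambda>x. \<eta> x - \<zeta> x) \<in> test_fun \<Omega>"
proof -
  obtain K where K: "\<eta> \<in> smooth" "compact K" "K \<subseteq> \<Omega>" "\<And>x. x \<notin> K \<Longrightarrow> \<eta> x = 0"
    using test_funE[OF assms(1)] by metis
  obtain L where L: "\<zeta> \<in> smooth" "compact L" "L \<subseteq> \<Omega>" "\<And>x. x \<notin> L \<Longrightarrow> \<zeta> x = 0"
    using test_funE[OF assms(2)] by metis
  show ?thesis
    using K L by (intro test_funI[of _ "K \<union> L"]) auto
qed

lemma test_fun_mult:
  assumes "\<eta> \<in> test_fun \<Omega>" "\<zeta> \<in> smooth"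
  shows "(\<lambda>x. \<eta> x * \<zeta> x) \<in> test_fun \<Omega>"
  using assms(1)
proof (rule test_funE)
  fix K assume K: "\<eta> \<in> smooth" "compact K" "K \<subseteq> \<Omega>" "\<And>x. x \<notin> K \<Longrightarrow> \<eta> x = 0"
  show ?thesis
    using K assms(2) by (intro test_funI[of _ K]) auto
qed

text \<open>Since arctan 0 = 0, the support does not grow.\<close>

lemma test_fun_arctan:
  assumes "\<eta> \<in> test_fun \<Omega>"
  shows "(\<lambda>x. arctan (\<eta> x)) \<in> test_fun \<Omega>"
  using assms
proof (rule test_funE)
  fix K assume K: "\<eta> \<in> smooth" "compact K" "K \<subseteq> \<Omega>" "\<And>x. x \<notin> K \<Longrightarrow> \<eta> x = 0"
  show ?thesis
    using K by (intro test_funI[of _ K] smooth_arctan) auto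
qed

lemma test_fun_partial:
  assumes "\<eta> \<in> test_fun \<Omega>" "i \<in> Basis"
  shows "partial_deriv i \<eta> \<in> test_fun \<Omega>"
  using assms(1)
proof (rule test_funE)
  fix K assume K: "\<eta> \<in> smooth" "compact K" "K \<subseteq> \<Omega>" "\<And>x. x \<notin> K \<Longrightarrow> \<eta> x = 0"
  have "partial_deriv i \<eta> x = 0" if "x \<notin> K" for x
  proof (rule partial_deriv_eq)
    have "open (- K)" using K(2) compact_imp_closed by blast
    then show "(\<eta> has_derivative (\<lambda>v. 0)) (at x)"
      using that K(4)
      by (intro has_derivative_transform_within_open[of "\<lambda>x. 0" "\<lambda>v. 0" x UNIV "- K" \<eta>]) auto
  qed
  then show ?thesis
    using K assms(2) by (intro test_funI[of _ K] smooth_partial) auto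
qed

lemma test_fun_bounded:
  assumes "\<eta> \<in> test_fun \<Omega>"
  obtains C where "C > 0" "\<And>x. \<bar>\<eta> x\<bar> \<le> C"
  using assms
proof (rule test_funE)
  fix K assume K: "\<eta> \<in> smooth" "compact K" "K \<subseteq> \<Omega>" "\<And>x. x \<notin> K \<Longrightarrow> \<eta> x = 0"
  have "compact (\<eta> ` K)"
    using K by (intro compact_continuous_image smooth_continuous_on)
  then obtain C where "\<forall>y\<in>\<eta> ` K. norm y \<le> C" "C > 0"
    by (meson compact_imp_bounded bounded_pos)
  then have "\<bar>\<eta> x\<bar> \<le> C" for x
    using K(4)[of x] by (cases "x \<in> K") auto
  with \<open>C > 0\<close> that show thesis by auto
qed

lemma test_fun_measurable:
  "\<eta> \<in> test_fun \<Omega> \<Longrightarrow> \<eta> \<in> borel_measurable (lebesgue_on S)"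
  by (intro measurable_restrict_space1 measurable_completion)
    (simp add: borel_measurable_continuous_onI smooth_continuous_on test_fun_smooth)

text \<open>By Lindeloef, countably many balls with closures inside \<Omega> cover it. Off the first
  n + 1 closed balls all their bumps vanish, which gives compact support; every point lies in some
  ball, which gives the limit 1.\<close>

lemma exists_cutoff:
  fixes \<Omega> :: "'a::euclidean_space set"
  assumes "open \<Omega>"
  obtains \<kappa> :: "nat \<Rightarrow> 'a \<Rightarrow> real" where "\<And>n. \<kappa> n \<in> test_fun \<Omega>"
    "\<And>n x. 0 \<le> \<kappa> n x" "\<And>n x. \<kappa> n x \<le> 1" "\<And>x. x \<in> \<Omega> \<Longrightarrow> (\<lambda>n. \<kappa> n x) \<longlonglongrightarrow> 1"
proof (cases "\<Omega> = {}")
  case True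
  then show thesis
    using test_funI[of "\<lambda>x. 0" "{}" \<Omega>] by (intro that[of "\<lambda>n x. 0"]) auto
next
  case False
  define F where "F = {ball c r | c r. r > 0 \<and> cball c r \<subseteq> \<Omega>}"
  have "\<Union>F = \<Omega>"
  proof
    show "\<Omega> \<subseteq> \<Union>F"
    proof
      fix x assume "x \<in> \<Omega>"
      then obtain r where "r > 0" "cball x r \<subseteq> \<Omega>"
        using assms open_contains_cball by blast
      then show "x \<in> \<Union>F" unfolding F_def by force
    qed
  qed (force simp: F_def)
  obtain F' where F': "F' \<subseteq> F" "countable F'" "\<Union>F' = \<Omega>"
  proof (rule Lindelof[of F])
    show "\<And>S. S \<in> F \<Longrightarrow> open S" by (auto simp: F_def)
  qed (use \<open>\<Union>F = \<Omega>\<close> in auto)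
  then have "F' \<noteq> {}" using False by auto
  have "\<exists>c r. r > 0 \<and> cball c r \<subseteq> \<Omega> \<and> from_nat_into F' n = ball c r" for n
    using from_nat_into[OF \<open>F' \<noteq> {}\<close>, of n] F'(1) unfolding F_def by blast
  then obtain c r where r: "\<And>n. r n > 0" "\<And>n. cball (c n) (r n) \<subseteq> \<Omega>"
      "\<And>n. from_nat_into F' n = ball (c n) (r n)"
    by metis
  \<comment> \<open>The number of factors and the exponent grow together. The exponent compensates
    for bumps below 1: a factor q < 1 attached to a ball containing the point enters as
    \<open>q ^ n\<close>.\<close>
  define P where "P n x = (\<Prod>i\<le>n. (1 - bump (c i) (r i) x) ^ n)" for n x
  have b: "0 \<le> 1 - bump (c i) (r i) x" "1 - bump (c i) (r i) x \<le> 1" for i x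
    using bump_nonneg[of "c i" "r i" x] bump_le_1[of "c i" "r i" x] by auto
  have P01: "0 \<le> P n x" "P n x \<le> 1" for n x
    unfolding P_def by (auto intro!: prod_nonneg prod_le_1 zero_le_power power_le_one b)
  show thesis
  proof (rule that[of "\<lambda>n x. 1 - P n x"])
    fix n
    show "(\<lambda>x. 1 - P n x) \<in> test_fun \<Omega>"
    proof (rule test_funI[of _ "\<Union>i\<le>n. cball (c i) (r i)"])
      show "(\<lambda>x. 1 - P n x) \<in> smooth"
        unfolding P_def by (intro smooth_diff smooth_const smooth_prod smooth_power bump_smooth) auto
      fix x assume x: "x \<notin> (\<Union>i\<le>n. cball (c i) (r i))"
      have "bump (c i) (r i) x = 0" if "i \<le> n" for i
        using x that bump_nonzero_iff[OF r(1)[of i], of "c i" x] ball_subset_cball by blast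
      then show "1 - P n x = 0" by (simp add: P_def)
    qed (use r(2) in auto)
  next
    fix x assume "x \<in> \<Omega>"
    then obtain B where "B \<in> F'" "x \<in> B" using F' by auto
    then obtain k where k: "x \<in> ball (c k) (r k)"
      using r(3) F'(2) by (metis from_nat_into_surj)
    define q where "q = 1 - bump (c k) (r k) x"
    have q: "0 \<le> q" "q < 1"
      using b[of k x] bump_nonzero_iff[OF r(1)[of k], of "c k" x] k by (auto simp: q_def)
    have "P n x \<le> q ^ n" if "n \<ge> k" for n
    proof -
      have "P n x = q ^ n * (\<Prod>i\<in>{..n} - {k}. (1 - bump (c i) (r i) x) ^ n)"
        unfolding P_def q_def using that by (subst prod.remove[of _ k]) auto
      also have "\<dots> \<le> q ^ n * 1"
        using q by (intro mult_left_mono prod_le_1) (auto intro!: zero_le_power power_le_one b)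
      finally show ?thesis by simp
    qed
    then have "\<forall>\<^sub>F n in sequentially. norm (P n x) \<le> q ^ n"
      using P01 by (auto intro: eventually_sequentiallyI[of k])
    moreover have "(\<lambda>n. q ^ n) \<longlonglongrightarrow> 0"
      using q by (intro LIMSEQ_realpow_zero) auto
    ultimately have "(\<lambda>n. P n x) \<longlonglongrightarrow> 0"
      by (rule Lim_null_comparison)
    then show "(\<lambda>n. 1 - P n x) \<longlonglongrightarrow> 1"
      using tendsto_diff[OF tendsto_const] by fastforce
  qed (use P01 in \<open>auto simp: algebra_simps\<close>)
qed

text \<open>A measurable function is an almost everywhere limit of continuous ones; on the compact
  closure these are uniformly close to polynomials by Stone-Weierstrass, and the cutoffs make the
  polynomials compactly supported. The 1 added to \<open>M\<close> absorbs the polynomial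
  error.\<close>

lemma exists_test_fun_approx:
  fixes \<Omega> :: "'a::euclidean_space set"
  assumes "open \<Omega>" "bounded \<Omega>" and g: "g \<in> borel_measurable (lebesgue_on \<Omega>)"
    and M: "\<And>x. x \<in> \<Omega> \<Longrightarrow> \<bar>g x\<bar> \<le> M"
  obtains \<eta> :: "nat \<Rightarrow> 'a \<Rightarrow> real" where "\<And>n. \<eta> n \<in> test_fun \<Omega>"
    "\<And>n x. x \<in> \<Omega> \<Longrightarrow> \<bar>\<eta> n x\<bar> \<le> M + 1" "AE x in lebesgue_on \<Omega>. (\<lambda>n. \<eta> n x) \<longlonglongrightarrow> g x"
proof -
  have L: "\<Omega> \<in> sets lebesgue" using assms(1) by simp
  obtain N G where N: "negligible N" and G: "\<And>n. continuous_on UNIV (G n)"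
      and lim: "\<And>x. x \<notin> N \<Longrightarrow> (\<lambda>n. G n x) \<longlonglongrightarrow> (if x \<in> \<Omega> then g x else 0)"
    using g measurable_on_iff_borel_measurable[OF L, of g] unfolding measurable_on_def by blast
  \<comment> \<open>Truncation at height \<open>M\<close> gives a bound uniform in n and preserves
    the limit, as \<open>g\<close> itself stays within this range.\<close>
  define H where "H n x = max (- M) (min M (G n x))" for n x
  have "continuous_on (closure \<Omega>) (H n)" for n
    unfolding H_def by (intro continuous_intros continuous_on_subset[OF G]) auto
  moreover have "compact (closure \<Omega>)" using assms(2) by simp
  ultimately have "\<exists>p. real_polynomial_function p \<and> (\<forall>x\<in>closure \<Omega>. \<bar>H n x - p x\<bar> < inverse (Suc n))" for n
    by (rule_tac Stone_Weierstrass_real_polynomial_function[of "closure \<Omega>" "H n" "inverse (real (Suc n))"]) auto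
  then obtain p where p: "\<And>n. real_polynomial_function (p n)"
      "\<And>n x. x \<in> closure \<Omega> \<Longrightarrow> \<bar>H n x - p n x\<bar> < inverse (Suc n)"
    by metis
  obtain \<kappa> :: "nat \<Rightarrow> 'a \<Rightarrow> real" where \<kappa>: "\<And>n. \<kappa> n \<in> test_fun \<Omega>"
    "\<And>n x. 0 \<le> \<kappa> n x" "\<And>n x. \<kappa> n x \<le> 1" "\<And>x. x \<in> \<Omega> \<Longrightarrow> (\<lambda>n. \<kappa> n x) \<longlonglongrightarrow> 1"
    using exists_cutoff[OF assms(1)] by metis
  show thesis
  proof (rule that[of "\<lambda>n x. \<kappa> n x * p n x"])
    show "(\<lambda>x. \<kappa> n x * p n x) \<in> test_fun \<Omega>" for n
      by (intro test_fun_mult \<kappa> smooth_polynomial p)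
    fix n x assume x: "x \<in> \<Omega>"
    have "0 \<le> M" using M[OF x] by linarith
    then have "\<bar>H n x\<bar> \<le> M" by (auto simp: H_def)
    moreover have "\<bar>H n x - p n x\<bar> \<le> 1"
      using p(2)[of x n] x closure_subset[of \<Omega>] by (smt (verit) inverse_le_1_iff of_nat_0_le_iff of_nat_Suc subsetD)
    ultimately have "\<bar>p n x\<bar> \<le> M + 1" by linarith
    then show "\<bar>\<kappa> n x * p n x\<bar> \<le> M + 1"
      using mult_mono[of "\<bar>\<kappa> n x\<bar>" 1 "\<bar>p n x\<bar>" "M + 1"] \<kappa>(2,3)[of n x] by (simp add: abs_mult)
  next
    have *: "(\<lambda>n. \<kappa> n x * p n x) \<longlonglongrightarrow> g x" if x: "x \<in> \<Omega>" "x \<notin> N" for x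
    proof -
      have "(\<lambda>n. H n x) \<longlonglongrightarrow> max (- M) (min M (g x))"
        unfolding H_def using lim[OF x(2)] x(1) by (intro tendsto_intros) auto
      then have "(\<lambda>n. H n x) \<longlonglongrightarrow> g x"
        using M[OF x(1)] by (simp add: abs_le_iff max_def min_def split: if_splits)
      moreover have "(\<lambda>n. H n x - p n x) \<longlonglongrightarrow> 0"
      proof (rule Lim_null_comparison[OF always_eventually LIMSEQ_inverse_real_of_nat])
        show "\<forall>n. norm (H n x - p n x) \<le> inverse (real (Suc n))"
          using p(2)[of x] x(1) closure_subset[of \<Omega>] less_imp_le by auto
      qed
      ultimately have "(\<lambda>n. H n x - (H n x - p n x)) \<longlonglongrightarrow> g x - 0"
        by (rule tendsto_diff)
      then show ?thesis
        using tendsto_mult[OF \<kappa>(4)[OF x(1)]] by fastforce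
    qed
    have "N \<in> null_sets lebesgue" using N negligible_iff_null_sets by blast
    then have "AE x in lebesgue. x \<notin> N" by (rule AE_not_in)
    then show "AE x in lebesgue_on \<Omega>. (\<lambda>n. \<kappa> n x * p n x) \<longlonglongrightarrow> g x"
      using * L by (subst AE_restrict_space_iff) auto
  qed
qed

section \<open>Weak derivatives\<close>

text \<open>Rests on completeness of Lebesgue measure, after extension by 0. It carries
  measurability over to \<open>weak_deriv\<close>, which is an arbitrary choice up to null
  sets.\<close>

lemma borel_measurable_lebesgue_on_AE:
  fixes f g :: "'a::euclidean_space \<Rightarrow> real"
  assumes S: "S \<in> sets lebesgue" and f: "f \<in> borel_measurable (lebesgue_on S)"
    and fg: "AE x in lebesgue_on S. f x = g x"
  shows "g \<in> borel_measurable (lebesgue_on S)"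
proof -
  have "(\<lambda>x. if x \<in> S then f x else 0) \<in> borel_measurable lebesgue"
    using f S by (simp add: borel_measurable_if)
  moreover have "AE x in lebesgue. (if x \<in> S then f x else 0) = (if x \<in> S then g x else 0)"
    using fg S by (subst (asm) AE_restrict_space_iff) auto
  ultimately have "(\<lambda>x. if x \<in> S then g x else 0) \<in> borel_measurable lebesgue"
    by (rule borel_measurable_AE)
  then show ?thesis
    using S by (simp add: borel_measurable_if)
qed

lemma continuous_on_zero_outside:
  fixes g :: "'a::euclidean_space \<Rightarrow> real"
  assumes "open \<Omega>" "compact K" "K \<subseteq> \<Omega>" "continuous_on \<Omega> g" "\<And>x. x \<notin> K \<Longrightarrow> g x = 0"
  shows "continuous_on UNIV g"
proof -
  have "open (- K)"
    using assms(2) compact_imp_closed by blast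
  moreover have "continuous_on (- K) g"
    by (rule continuous_on_eq[OF continuous_on_const[of _ 0]]) (simp add: assms(5))
  ultimately have "continuous_on (\<Omega> \<union> - K) g"
    using assms(1,4) by (intro continuous_on_open_Un) auto
  moreover have "\<Omega> \<union> - K = UNIV"
    using assms(3) by auto
  ultimately show ?thesis by simp
qed

section \<open>Integration by parts against compactly supported functions\<close>

lemma integrable_lborel_compact_support:
  fixes g :: "'a::euclidean_space \<Rightarrow> real"
  assumes "compact K" "continuous_on UNIV g" "\<And>x. x \<notin> K \<Longrightarrow> g x = 0"
  shows "integrable lborel g"
proof -
  have "integrable lborel (\<lambda>x. indicator K x *\<^sub>R g x)"
    using assms by (intro borel_integrable_compact continuous_on_subset[OF assms(2)]) auto
  moreover have "(\<lambda>x. indicator K x *\<^sub>R g x) = g"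
    using assms(3) by (auto simp: indicator_def fun_eq_iff)
  ultimately show ?thesis by simp
qed

lemma integral_translation:
  fixes g :: "'a::euclidean_space \<Rightarrow> real"
  assumes "g \<in> borel_measurable borel"
  shows "(LINT x|lborel. g (a + x)) = (LINT x|lborel. g x)"
proof -
  have "(LINT x|lborel. g (a + x)) = (LINT x|distr lborel borel ((+) a). g x)"
    using assms by (subst integral_distr) auto
  then show ?thesis by (simp add: lborel_distr_plus)
qed

text \<open>The difference quotients of a compactly supported function have vanishing integral, by
  translation invariance.\<close>

lemma integral_directional_deriv_compact_support:
  fixes \<psi> :: "'a::euclidean_space \<Rightarrow> real"
  assumes K: "compact K" "\<And>x. x \<notin> K \<Longrightarrow> \<psi> x = 0"
    and D: "\<And>x. (\<psi> has_derivative D x) (at x)"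
    and cont: "continuous_on UNIV (\<lambda>x. D x v)"
  shows "(LINT x|lborel. D x v) = 0"
proof -
  have c\<psi>: "continuous_on UNIV \<psi>"
    using D has_derivative_continuous by (blast intro: continuous_at_imp_continuous_on)
  have "D x v = 0" if "x \<notin> K" for x
  proof -
    have "open (- K)" using K(1) compact_imp_closed by blast
    then have "(\<psi> has_derivative (\<lambda>v. 0)) (at x)"
      using that K(2)
      by (intro has_derivative_transform_within_open[of "\<lambda>x. 0" "\<lambda>v. 0" x UNIV "- K" \<psi>]) auto
    then show ?thesis
      using D[of x] has_derivative_unique by metis
  qed
  note DK = this
  have "compact ((\<lambda>x. D x v) ` K)"
    using cont K(1) by (intro compact_continuous_image continuous_on_subset[OF cont]) auto
  then obtain B where B: "\<forall>y\<in>(\<lambda>x. D x v) ` K. norm y \<le> B" "B > 0"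
    by (meson compact_imp_bounded bounded_pos)
  then have DB: "\<bar>D x v\<bar> \<le> B" for x
    using DK[of x] by (cases "x \<in> K") auto
  obtain R where R: "K \<subseteq> cball 0 R"
    using compact_imp_bounded[OF K(1)] by (auto simp: bounded_iff subset_iff)
  define q where "q n x = (\<psi> (inverse (Suc n) *\<^sub>R v + x) - \<psi> x) / inverse (Suc n)" for n x
  have line: "((\<lambda>t. \<psi> (t *\<^sub>R v + x)) has_real_derivative D (t *\<^sub>R v + x) v) (at t)" for t x
  proof -
    have "((\<lambda>t. t *\<^sub>R v + x) has_derivative (\<lambda>h. h *\<^sub>R v)) (at t)"
      by (auto intro!: derivative_eq_intros)
    from has_derivative_compose[OF this D[of "t *\<^sub>R v + x"]]
    have "((\<lambda>t. \<psi> (t *\<^sub>R v + x)) has_derivative (\<lambda>h. D (t *\<^sub>R v + x) (h *\<^sub>R v))) (at t)"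
      by simp
    moreover have "linear (D (t *\<^sub>R v + x))"
      using D has_derivative_linear by blast
    ultimately show ?thesis
      by (simp add: has_field_derivative_def linear_scale mult.commute[of _ "D _ v"] cong: if_cong)
  qed
  \<comment> \<open>By the mean value theorem the quotient is the derivative at a point shifted by
    at most \<open>norm v\<close>, because the increments are at most 1. Enlarging the radius
    \<open>R\<close> by \<open>norm v\<close> therefore yields one integrable majorant for all
    n.\<close>
  have q_bound: "\<bar>q n x\<bar> \<le> B * indicator (cball 0 (R + norm v)) x" for n x
  proof -
    let ?t = "inverse (real (Suc n))"
    have t: "0 < ?t" "?t \<le> 1" by (auto simp: field_simps)
    from MVT2[OF t(1), of "\<lambda>t. \<psi> (t *\<^sub>R v + x)" "\<lambda>t. D (t *\<^sub>R v + x) v"] line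
    obtain z where z: "\<psi> (?t *\<^sub>R v + x) - \<psi> (0 *\<^sub>R v + x) = (?t - 0) * D (z *\<^sub>R v + x) v"
      "0 < z" "z < ?t"
      by blast
    then have "q n x = D (z *\<^sub>R v + x) v"
      unfolding q_def using t by simp
    moreover have "D (z *\<^sub>R v + x) v = 0" if "x \<notin> cball 0 (R + norm v)"
    proof (rule DK)
      have "norm (z *\<^sub>R v) \<le> norm v"
        using z t mult_right_mono[of z 1 "norm v"] by simp
      then have "norm (z *\<^sub>R v + x) > R"
        using that norm_diff_ineq[of x "z *\<^sub>R v"] by (auto simp: add.commute)
      then show "z *\<^sub>R v + x \<notin> K" using R by auto
    qed
    ultimately show ?thesis
      using DB[of "z *\<^sub>R v + x"] by (auto simp: indicator_def)
  qed
  have int\<psi>: "integrable lborel \<psi>"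
    by (rule integrable_lborel_compact_support[OF K(1) c\<psi> K(2)])
  have m: "\<psi> \<in> borel_measurable borel"
    using c\<psi> by (rule borel_measurable_continuous_onI)
  have "integrable lborel (\<lambda>x. \<psi> (a + x))" for a
    using int\<psi> m integrable_distr_eq[of "(+) a" lborel borel \<psi>] by (simp add: lborel_distr_plus)
  then have q0: "(LINT x|lborel. q n x) = 0" for n
    unfolding q_def using int\<psi> integral_translation[OF m] by simp
  have "(\<lambda>n. LINT x|lborel. q n x) \<longlonglongrightarrow> (LINT x|lborel. D x v)"
  proof (rule integral_dominated_convergence[where w = "\<lambda>x. B * indicator (cball 0 (R + norm v)) x"])
    show "(\<lambda>x. D x v) \<in> borel_measurable lborel"
      using borel_measurable_continuous_onI[OF cont] by simp
    show "q n \<in> borel_measurable lborel" for n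
      unfolding q_def using m by simp
    show "integrable lborel (\<lambda>x. B * indicator (cball 0 (R + norm v)) x)"
      by (intro integrable_mult_right integrable_real_indicator) (simp_all add: emeasure_bounded_finite[unfolded infinity_ennreal_def])
    show "AE x in lborel. (\<lambda>n. q n x) \<longlonglongrightarrow> D x v"
    proof (rule AE_I2)
      fix x
      have "((\<lambda>h. (\<psi> (h *\<^sub>R v + x) - \<psi> x) / h) \<longlongrightarrow> D x v) (at 0)"
        using line[of x 0] by (simp add: DERIV_def)
      moreover have "filterlim (\<lambda>n. inverse (real (Suc n))) (at 0) sequentially"
        using LIMSEQ_inverse_real_of_nat by (auto simp: filterlim_at)
      ultimately show "(\<lambda>n. q n x) \<longlonglongrightarrow> D x v"
        unfolding q_def by (rule filterlim_compose)
    qed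
    show "AE x in lborel. norm (q n x) \<le> B * indicator (cball 0 (R + norm v)) x" for n
      using q_bound by simp
  qed
  then show ?thesis
    by (simp add: q0 LIMSEQ_const_iff)
qed

lemma locally_integrable_mult_integrable:
  assumes \<Omega>: "\<Omega> \<in> sets lebesgue" and "locally_integrable \<Omega> f"
    and K: "compact K" "K \<subseteq> \<Omega>" "\<And>x. x \<notin> K \<Longrightarrow> \<eta> x = 0" and \<eta>: "continuous_on UNIV \<eta>"
  shows "integrable (lebesgue_on \<Omega>) (\<lambda>x. f x * \<eta> x)"
proof -
  have f: "integrable lebesgue (\<lambda>x. indicator K x *\<^sub>R f x)"
    using assms unfolding locally_integrable_def set_integrable_def by blast
  have "compact (\<eta> ` K)"
    using K \<eta> by (intro compact_continuous_image continuous_on_subset[OF \<eta>]) auto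
  then obtain C where C: "\<forall>y\<in>\<eta> ` K. norm y \<le> C" "C > 0"
    by (meson compact_imp_bounded bounded_pos)
  then have b: "\<bar>\<eta> x\<bar> \<le> C" for x
    using K(3)[of x] by (cases "x \<in> K") auto
  have \<eta>m: "\<eta> \<in> borel_measurable lebesgue"
    using borel_measurable_continuous_onI[OF \<eta>] by (intro measurable_completion) simp
  have "integrable lebesgue (\<lambda>x. (indicator K x *\<^sub>R f x) * \<eta> x)"
  proof (rule Bochner_Integration.integrable_bound)
    show "integrable lebesgue (\<lambda>x. C * (indicator K x *\<^sub>R f x))"
      using f by simp
    show "AE x in lebesgue. norm (indicat_real K x *\<^sub>R f x * \<eta> x) \<le> norm (C * indicat_real K x *\<^sub>R f x)"
      using b C(2) by (auto simp: abs_mult mult.commute[of C] intro!: mult_left_mono)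
  qed (use f \<eta>m in auto)
  moreover have "(\<lambda>x. (indicator K x *\<^sub>R f x) * \<eta> x) = (\<lambda>x. indicator \<Omega> x *\<^sub>R (f x * \<eta> x))"
    using K by (auto simp: indicator_def fun_eq_iff)
  ultimately show ?thesis
    using \<Omega> by (simp add: integrable_restrict_space)
qed

lemma has_weak_deriv_integrable:
  assumes "has_weak_deriv \<Omega> i f g" "open \<Omega>" "\<eta> \<in> test_fun \<Omega>" "i \<in> Basis"
  shows "integrable (lebesgue_on \<Omega>) (\<lambda>x. f x * partial_deriv i \<eta> x)"
    and "integrable (lebesgue_on \<Omega>) (\<lambda>x. g x * \<eta> x)"
proof -
  have *: "integrable (lebesgue_on \<Omega>) (\<lambda>x. h x * \<zeta> x)"
    if "locally_integrable \<Omega> h" "\<zeta> \<in> test_fun \<Omega>" for h \<zeta>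
    using that(2)
  proof (rule test_funE)
    fix K assume "\<zeta> \<in> smooth" "compact K" "K \<subseteq> \<Omega>" "\<And>x. x \<notin> K \<Longrightarrow> \<zeta> x = 0"
    then show ?thesis
      using assms(2) that(1)
      by (intro locally_integrable_mult_integrable[of _ _ K] smooth_continuous_on) auto
  qed
  show "integrable (lebesgue_on \<Omega>) (\<lambda>x. f x * partial_deriv i \<eta> x)"
    using assms by (intro * test_fun_partial) (auto simp: has_weak_deriv_def)
  show "integrable (lebesgue_on \<Omega>) (\<lambda>x. g x * \<eta> x)"
    using assms by (intro *) (auto simp: has_weak_deriv_def)
qed

lemma has_weak_derivD:
  assumes "has_weak_deriv \<Omega> i f g" "\<eta> \<in> test_fun \<Omega>"
  shows "(LINT x|lebesgue_on \<Omega>. f x * partial_deriv i \<eta> x) = - (LINT x|lebesgue_on \<Omega>. g x * \<eta> x)"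
  using assms by (auto simp: has_weak_deriv_def)

lemma locally_integrable_continuous:
  assumes "continuous_on \<Omega> f" shows "locally_integrable \<Omega> f"
  unfolding locally_integrable_def set_integrable_def
proof (intro allI impI)
  fix K assume K: "compact K \<and> K \<subseteq> \<Omega>"
  then have "integrable lborel (\<lambda>x. indicator K x *\<^sub>R f x)"
    using assms by (intro borel_integrable_compact continuous_on_subset[OF assms]) auto
  then show "integrable lebesgue (\<lambda>x. indicator K x *\<^sub>R f x)"
    by (subst integrable_completion) auto
qed

text \<open>The product of \<open>f\<close> with a test function, extended by 0, is differentiable
  everywhere, and its derivative along \<open>i\<close> is continuous with compact support. That
  derivative has integral 0, and the product rule splits the integral.\<close>

lemma has_weak_deriv_classical:
  fixes f :: "'a::euclidean_space \<Rightarrow> real"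
  assumes "open \<Omega>" and D: "\<And>x. x \<in> \<Omega> \<Longrightarrow> (f has_derivative D x) (at x)"
    and cont: "continuous_on \<Omega> (\<lambda>x. D x i)" and i: "i \<in> Basis"
  shows "has_weak_deriv \<Omega> i f (\<lambda>x. D x i)"
  unfolding has_weak_deriv_def
proof (intro conjI ballI)
  have cf: "continuous_on \<Omega> f"
    using D has_derivative_continuous by (blast intro: continuous_at_imp_continuous_on)
  show li: "locally_integrable \<Omega> f" "locally_integrable \<Omega> (\<lambda>x. D x i)"
    using cf cont by (auto intro: locally_integrable_continuous)
  fix \<eta> assume \<eta>: "\<eta> \<in> test_fun \<Omega>"
  then show "(LINT x|lebesgue_on \<Omega>. f x * partial_deriv i \<eta> x) = - (LINT x|lebesgue_on \<Omega>. D x i * \<eta> x)"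
  proof (rule test_funE)
    fix K assume K: "\<eta> \<in> smooth" "compact K" "K \<subseteq> \<Omega>" "\<And>x. x \<notin> K \<Longrightarrow> \<eta> x = 0"
    \<comment> \<open>The derivative of the product is set to 0 outside \<Omega>, where nothing is
      known about \<open>f\<close>; both descriptions agree on the open set \<Omega> minus
      \<open>K\<close>.\<close>
    define E where "E x = (if x \<in> \<Omega>
      then (\<lambda>v. f x * frechet_derivative \<eta> (at x) v + D x v * \<eta> x) else (\<lambda>v. 0))" for x
    have opK: "open (- K)" using K(2) compact_imp_closed by blast
    have E: "((\<lambda>x. f x * \<eta> x) has_derivative E x) (at x)" for x
    proof (cases "x \<in> \<Omega>")
      case True
      then show ?thesis
        unfolding E_def using has_derivative_mult[OF D smooth_has_derivative[OF K(1)]] by simp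
    next
      case False
      then have "x \<in> - K" using K(3) by auto
      then have "((\<lambda>x. f x * \<eta> x) has_derivative (\<lambda>v. 0)) (at x)"
        using opK K(4)
        by (intro has_derivative_transform_within_open[of "\<lambda>x. 0" "\<lambda>v. 0" x UNIV "- K" "\<lambda>x. f x * \<eta> x"]) auto
      then show ?thesis
        using False by (simp add: E_def)
    qed
    have d0: "partial_deriv i \<eta> x = 0" if "x \<notin> K" for x
      using that opK K(4)
      by (intro partial_deriv_eq[where D = "\<lambda>v. 0"]
          has_derivative_transform_within_open[of "\<lambda>x. 0" "\<lambda>v. 0" x UNIV "- K" \<eta>]) auto
    have Ei: "E x i = f x * partial_deriv i \<eta> x + D x i * \<eta> x" for x
    proof (cases "x \<in> \<Omega>")
      case False
      then have "x \<notin> K" using K(3) by auto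
      then show ?thesis using False by (simp add: E_def d0 K(4))
    qed (simp add: E_def partial_deriv_def)
    have cE: "continuous_on UNIV (\<lambda>x. E x i)"
      unfolding Ei
    proof (rule continuous_on_zero_outside[OF assms(1) K(2,3)])
      show "continuous_on \<Omega> (\<lambda>x. f x * partial_deriv i \<eta> x + D x i * \<eta> x)"
        by (intro continuous_on_add continuous_on_mult cf cont smooth_continuous_on smooth_partial K i)
    qed (simp add: d0 K(4))
    have "(LINT x|lborel. E x i) = 0"
      using integral_directional_deriv_compact_support[OF K(2) _ E cE] K(4) by simp
    then have "(LINT x|lebesgue. E x i) = 0"
      using borel_measurable_continuous_onI[OF cE] by (subst integral_completion) auto
    moreover have "(\<lambda>x. E x i) = (\<lambda>x. indicator \<Omega> x *\<^sub>R E x i)"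
      by (auto simp: E_def fun_eq_iff)
    ultimately have "(LINT x|lebesgue_on \<Omega>. E x i) = 0"
      using assms(1) by (subst integral_restrict_space) auto
    moreover have "integrable (lebesgue_on \<Omega>) (\<lambda>x. f x * partial_deriv i \<eta> x)"
      using K assms(1) li d0
      by (intro locally_integrable_mult_integrable[of _ _ K] smooth_continuous_on smooth_partial i) auto
    moreover have "integrable (lebesgue_on \<Omega>) (\<lambda>x. D x i * \<eta> x)"
      using K assms(1) li
      by (intro locally_integrable_mult_integrable[of _ _ K] smooth_continuous_on) auto
    ultimately show ?thesis
      unfolding Ei by simp
  qed
qed

text \<open>The fundamental lemma of the calculus of variations. As \<open>d\<close> is only locally
  integrable, it is first multiplied by a cutoff; testing with bounded approximations of the sign of
  the product then gives its L^1 norm, and the cutoffs tend to 1.\<close>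

lemma ae_zero_if_test_integrals_zero:
  fixes \<Omega> :: "'a::euclidean_space set"
  assumes "open \<Omega>" "bounded \<Omega>" and d: "locally_integrable \<Omega> d"
    and zero: "\<And>\<eta>. \<eta> \<in> test_fun \<Omega> \<Longrightarrow> (LINT x|lebesgue_on \<Omega>. d x * \<eta> x) = 0"
  shows "AE x in lebesgue_on \<Omega>. d x = 0"
proof -
  have L: "\<Omega> \<in> sets lebesgue" using assms(1) by simp
  obtain \<kappa> :: "nat \<Rightarrow> 'a \<Rightarrow> real" where \<kappa>: "\<And>n. \<kappa> n \<in> test_fun \<Omega>"
    "\<And>n x. 0 \<le> \<kappa> n x" "\<And>n x. \<kappa> n x \<le> 1" "\<And>x. x \<in> \<Omega> \<Longrightarrow> (\<lambda>n. \<kappa> n x) \<longlonglongrightarrow> 1"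
    using exists_cutoff[OF assms(1)] by metis
  have "AE x in lebesgue_on \<Omega>. d x * \<kappa> n x = 0" for n
  proof -
    let ?f = "\<lambda>x. d x * \<kappa> n x"
    have int: "integrable (lebesgue_on \<Omega>) ?f"
      using \<kappa>(1)[of n]
    proof (rule test_funE)
      fix K assume K: "\<kappa> n \<in> smooth" "compact K" "K \<subseteq> \<Omega>" "\<And>x. x \<notin> K \<Longrightarrow> \<kappa> n x = 0"
      show ?thesis
        using L d K by (intro locally_integrable_mult_integrable[of _ _ K] smooth_continuous_on) auto
    qed
    then have fm: "?f \<in> borel_measurable (lebesgue_on \<Omega>)" by simp
    have gm: "(\<lambda>x. sgn (?f x)) \<in> borel_measurable (lebesgue_on \<Omega>)"
      using fm by simp
    obtain \<eta> :: "nat \<Rightarrow> 'a \<Rightarrow> real" where \<eta>: "\<And>n. \<eta> n \<in> test_fun \<Omega>"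
      "\<And>n x. x \<in> \<Omega> \<Longrightarrow> \<bar>\<eta> n x\<bar> \<le> 1 + 1" "AE x in lebesgue_on \<Omega>. (\<lambda>n. \<eta> n x) \<longlonglongrightarrow> sgn (?f x)"
      using exists_test_fun_approx[OF assms(1,2) gm, of 1] by (auto simp: abs_sgn_eq)
    have lim: "(\<lambda>m. LINT x|lebesgue_on \<Omega>. ?f x * \<eta> m x) \<longlonglongrightarrow> (LINT x|lebesgue_on \<Omega>. ?f x * sgn (?f x))"
    proof (rule integral_dominated_convergence[where w = "\<lambda>x. 2 * norm (?f x)"])
      show "(\<lambda>x. ?f x * sgn (?f x)) \<in> borel_measurable (lebesgue_on \<Omega>)"
        using fm gm by (rule borel_measurable_times)
      show "(\<lambda>x. ?f x * \<eta> m x) \<in> borel_measurable (lebesgue_on \<Omega>)" for m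
        using fm test_fun_measurable[OF \<eta>(1)] by (rule borel_measurable_times)
      show "integrable (lebesgue_on \<Omega>) (\<lambda>x. 2 * norm (?f x))"
        using int by (intro integrable_mult_right integrable_norm)
      show "AE x in lebesgue_on \<Omega>. (\<lambda>m. ?f x * \<eta> m x) \<longlonglongrightarrow> ?f x * sgn (?f x)"
        using \<eta>(3) by eventually_elim (intro tendsto_intros)
      show "AE x in lebesgue_on \<Omega>. norm (?f x * \<eta> m x) \<le> 2 * norm (?f x)" for m
      proof (rule AE_I2)
        fix x assume "x \<in> space (lebesgue_on \<Omega>)"
        then have "\<bar>\<eta> m x\<bar> \<le> 2" using \<eta>(2)[of x m] by simp
        then show "norm (?f x * \<eta> m x) \<le> 2 * norm (?f x)"
          using mult_left_mono[of "\<bar>\<eta> m x\<bar>" 2 "\<bar>?f x\<bar>"] by (simp add: abs_mult mult.commute)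
      qed
    qed
    \<comment> \<open>The cutoff times the approximation of the sign is itself a test function, so
      the hypothesis applies to \<open>d\<close>.\<close>
    have int0: "(LINT x|lebesgue_on \<Omega>. ?f x * \<eta> m x) = 0" for m
      using zero[OF test_fun_mult[OF \<kappa>(1)[of n] test_fun_smooth[OF \<eta>(1)[of m]]]] by (simp add: mult.assoc)
    have "?f x * sgn (?f x) = \<bar>?f x\<bar>" for x
      by (simp only: abs_sgn)
    then have "(LINT x|lebesgue_on \<Omega>. \<bar>?f x\<bar>) = 0"
      using lim unfolding int0 by (simp only: LIMSEQ_const_iff)
    then have "AE x in lebesgue_on \<Omega>. \<bar>?f x\<bar> = 0"
      using int by (subst (asm) integral_nonneg_eq_0_iff_AE) auto
    then show ?thesis by eventually_elim simp
  qed
  then have "AE x in lebesgue_on \<Omega>. \<forall>n. d x * \<kappa> n x = 0"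
    unfolding AE_all_countable by blast
  moreover have "AE x in lebesgue_on \<Omega>. x \<in> \<Omega>"
    using AE_space[of "lebesgue_on \<Omega>"] by simp
  ultimately show ?thesis
  proof eventually_elim
    case (elim x)
    show "d x = 0"
    proof (rule ccontr)
      assume "d x \<noteq> 0"
      then have "\<kappa> n x = 0" for n using elim(1) by simp
      then have "(\<lambda>n::nat. 0::real) \<longlonglongrightarrow> 1" using \<kappa>(4)[OF elim(2)] by simp
      then show False by (simp add: LIMSEQ_const_iff)
    qed
  qed
qed

section \<open>Square integrable functions\<close>

definition sq_integrable :: "'a measure \<Rightarrow> ('a \<Rightarrow> 'b::euclidean_space) \<Rightarrow> bool" where
  "sq_integrable M F \<longleftrightarrow> F \<in> borel_measurable M \<and> integrable M (\<lambda>x. (norm (F x))\<^sup>2)"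

lemma L2_fun_iff: "f \<in> L2_fun \<Omega> \<longleftrightarrow> sq_integrable (lebesgue_on \<Omega>) f"
  by (simp add: L2_fun_def sq_integrable_def)

lemma sq_integrable_measurable: "sq_integrable M F \<Longrightarrow> F \<in> borel_measurable M"
  by (simp add: sq_integrable_def)

lemma sq_integrable_bound:
  assumes "sq_integrable M F" "G \<in> borel_measurable M" "AE x in M. norm (G x) \<le> C * norm (F x)"
  shows "sq_integrable M G"
  unfolding sq_integrable_def
proof
  have "integrable M (\<lambda>x. C\<^sup>2 * (norm (F x))\<^sup>2)"
    using assms(1) by (simp add: sq_integrable_def)
  then show "integrable M (\<lambda>x. (norm (G x))\<^sup>2)"
  proof (rule Bochner_Integration.integrable_bound)
    show "AE x in M. norm ((norm (G x))\<^sup>2) \<le> norm (C\<^sup>2 * (norm (F x))\<^sup>2)"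
      using assms(3)
    proof eventually_elim
      case (elim x)
      then show ?case using power_mono[OF elim, of 2] by (simp add: power_mult_distrib)
    qed
  qed (use assms(2) in simp)
qed fact

lemma sq_integrable_add:
  assumes "sq_integrable M F" "sq_integrable M G"
  shows "sq_integrable M (\<lambda>x. F x + G x)"
  unfolding sq_integrable_def
proof
  show m: "(\<lambda>x. F x + G x) \<in> borel_measurable M"
    using assms by (auto simp: sq_integrable_def)
  have "integrable M (\<lambda>x. 2 * (norm (F x))\<^sup>2 + 2 * (norm (G x))\<^sup>2)"
    using assms by (simp add: sq_integrable_def)
  then show "integrable M (\<lambda>x. (norm (F x + G x))\<^sup>2)"
  proof (rule Bochner_Integration.integrable_bound)
    have "(norm (F x + G x))\<^sup>2 \<le> 2 * (norm (F x))\<^sup>2 + 2 * (norm (G x))\<^sup>2" for x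
      using power_mono[OF norm_triangle_ineq[of "F x" "G x"], of 2]
        sum_squares_bound[of "norm (F x)" "norm (G x)"] by (simp add: power2_sum)
    then show "AE x in M. norm ((norm (F x + G x))\<^sup>2) \<le> norm (2 * (norm (F x))\<^sup>2 + 2 * (norm (G x))\<^sup>2)"
      by simp
  qed (use m in simp)
qed

lemma sq_integrable_scaleR: "sq_integrable M F \<Longrightarrow> sq_integrable M (\<lambda>x. c *\<^sub>R F x)"
  by (auto simp: sq_integrable_def power_mult_distrib)

lemma sq_integrable_diff:
  "sq_integrable M F \<Longrightarrow> sq_integrable M G \<Longrightarrow> sq_integrable M (\<lambda>x. F x - G x)"
  using sq_integrable_add[of M F "\<lambda>x. (-1) *\<^sub>R G x"] sq_integrable_scaleR[of M G "-1"] by simp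

lemma sq_integrable_sum:
  "finite I \<Longrightarrow> (\<And>i. i \<in> I \<Longrightarrow> sq_integrable M (F i)) \<Longrightarrow> sq_integrable M (\<lambda>x. \<Sum>i\<in>I. F i x)"
proof (induction I rule: finite_induct)
  case empty
  then show ?case by (simp add: sq_integrable_def)
qed (simp add: sq_integrable_add)

lemma (in finite_measure) sq_integrable_bounded:
  assumes "F \<in> borel_measurable M" "AE x in M. norm (F x) \<le> C"
  shows "sq_integrable M F"
proof (rule sq_integrable_bound[of M "\<lambda>x. 1 :: real"])
  show "sq_integrable M (\<lambda>x. 1 :: real)"
    by (simp add: sq_integrable_def)
qed (use assms in auto)

lemma sq_integrable_mult:
  assumes "sq_integrable M F" "sq_integrable M G"
  shows "integrable M (\<lambda>x. norm (F x) * norm (G x))"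
proof (rule Bochner_Integration.integrable_bound)
  show "integrable M (\<lambda>x. (norm (F x))\<^sup>2 + (norm (G x))\<^sup>2)"
    using assms by (simp add: sq_integrable_def)
  have "norm (F x) * norm (G x) \<le> (norm (F x))\<^sup>2 + (norm (G x))\<^sup>2" for x
    using sum_squares_bound[of "norm (F x)" "norm (G x)"]
      mult_nonneg_nonneg[OF norm_ge_zero[of "F x"] norm_ge_zero[of "G x"]]
    by linarith
  then show "AE x in M. norm (norm (F x) * norm (G x)) \<le> norm ((norm (F x))\<^sup>2 + (norm (G x))\<^sup>2)"
    by simp
qed (use assms in \<open>auto simp: sq_integrable_def\<close>)

lemma sq_integrable_mult_real:
  fixes f g :: "'a \<Rightarrow> real"
  assumes "sq_integrable M f" "sq_integrable M g"
  shows "integrable M (\<lambda>x. f x * g x)"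
proof (rule Bochner_Integration.integrable_bound[OF sq_integrable_mult[OF assms]])
  show "AE x in M. norm (f x * g x) \<le> norm (norm (f x) * norm (g x))"
    by (simp add: abs_mult)
qed (use assms in \<open>auto simp: sq_integrable_def\<close>)

lemma Cauchy_Schwarz_integral:
  assumes "sq_integrable M F" "sq_integrable M G"
  shows "(LINT x|M. norm (F x) * norm (G x))
    \<le> sqrt (LINT x|M. (norm (F x))\<^sup>2) * sqrt (LINT x|M. (norm (G x))\<^sup>2)"
proof -
  have m: "F \<in> borel_measurable M" "G \<in> borel_measurable M"
    using assms by (auto simp: sq_integrable_def)
  have "(\<integral>\<^sup>+x. ennreal (norm (F x)) * ennreal (norm (G x)) \<partial>M)\<^sup>2
      \<le> (\<integral>\<^sup>+x. (ennreal (norm (F x)))\<^sup>2 \<partial>M) * (\<integral>\<^sup>+x. (ennreal (norm (G x)))\<^sup>2 \<partial>M)"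
    using m by (intro Cauchy_Schwarz_nn_integral) auto
  moreover have "(\<integral>\<^sup>+x. ennreal (norm (F x)) * ennreal (norm (G x)) \<partial>M)
      = ennreal (LINT x|M. norm (F x) * norm (G x))"
    using sq_integrable_mult[OF assms]
    by (simp flip: ennreal_mult add: nn_integral_eq_integral)
  moreover have "(\<integral>\<^sup>+x. (ennreal (norm (F x)))\<^sup>2 \<partial>M) = ennreal (LINT x|M. (norm (F x))\<^sup>2)"
    "(\<integral>\<^sup>+x. (ennreal (norm (G x)))\<^sup>2 \<partial>M) = ennreal (LINT x|M. (norm (G x))\<^sup>2)"
    using assms by (simp_all add: ennreal_power nn_integral_eq_integral sq_integrable_def)
  ultimately have "ennreal ((LINT x|M. norm (F x) * norm (G x))\<^sup>2)
      \<le> ennreal ((LINT x|M. (norm (F x))\<^sup>2) * (LINT x|M. (norm (G x))\<^sup>2))"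
    by (simp only: ennreal_power ennreal_mult) (simp add: ennreal_power ennreal_mult)
  then have "(LINT x|M. norm (F x) * norm (G x))\<^sup>2
      \<le> (LINT x|M. (norm (F x))\<^sup>2) * (LINT x|M. (norm (G x))\<^sup>2)"
    by (subst (asm) ennreal_le_iff) auto
  from real_sqrt_le_mono[OF this] show ?thesis
    by (simp add: real_sqrt_mult)
qed

lemma tendsto_integral_norm_mult:
  assumes "\<And>n. sq_integrable M (F n)" "sq_integrable M G"
    and "(\<lambda>n. LINT x|M. (norm (F n x))\<^sup>2) \<longlonglongrightarrow> 0"
  shows "(\<lambda>n. LINT x|M. norm (F n x) * norm (G x)) \<longlonglongrightarrow> 0"
proof (rule Lim_null_comparison[OF always_eventually])
  show "\<forall>n. norm (LINT x|M. norm (F n x) * norm (G x))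
      \<le> sqrt (LINT x|M. (norm (F n x))\<^sup>2) * sqrt (LINT x|M. (norm (G x))\<^sup>2)"
    using Cauchy_Schwarz_integral[OF assms(1,2)] by simp
  show "(\<lambda>n. sqrt (LINT x|M. (norm (F n x))\<^sup>2) * sqrt (LINT x|M. (norm (G x))\<^sup>2)) \<longlonglongrightarrow> 0"
    using tendsto_mult[OF tendsto_real_sqrt[OF assms(3)] tendsto_const] by simp
qed

text \<open>Replaces dominated convergence where approximations converge only in an integral norm:
  no subsequence converging pointwise has to be extracted.\<close>

lemma tendsto_integral_of_bound:
  fixes X :: "nat \<Rightarrow> 'a \<Rightarrow> real"
  assumes "\<And>n. integrable M (X n)" "integrable M Y" "\<And>n. integrable M (b n)"
    and "\<And>n. AE x in M. \<bar>X n x - Y x\<bar> \<le> b n x"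
    and "(\<lambda>n. LINT x|M. b n x) \<longlonglongrightarrow> 0"
  shows "(\<lambda>n. LINT x|M. X n x) \<longlonglongrightarrow> (LINT x|M. Y x)"
proof -
  have "\<bar>(LINT x|M. X n x) - (LINT x|M. Y x)\<bar> \<le> (LINT x|M. b n x)" for n
  proof -
    have "\<bar>LINT x|M. X n x - Y x\<bar> \<le> (LINT x|M. \<bar>X n x - Y x\<bar>)"
      by (rule integral_abs_bound)
    also have "\<dots> \<le> (LINT x|M. b n x)"
      using assms by (intro integral_mono_AE) auto
    finally show ?thesis
      using assms by simp
  qed
  then have "(\<lambda>n. (LINT x|M. X n x) - (LINT x|M. Y x)) \<longlonglongrightarrow> 0"
    by (intro Lim_null_comparison[OF always_eventually assms(5)]) auto
  then show ?thesis by (simp add: LIM_zero_iff)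
qed

section \<open>Sobolev functions\<close>

lemma finite_measure_lebesgue_on_bounded:
  fixes \<Omega> :: "'a::euclidean_space set"
  assumes "open \<Omega>" "bounded \<Omega>" shows "finite_measure (lebesgue_on \<Omega>)"
  using assms by (intro finite_measure_lebesgue_on) (simp add: lmeasurable_open)

lemma sq_integrable_locally_integrable:
  assumes "open \<Omega>" "bounded \<Omega>" "sq_integrable (lebesgue_on \<Omega>) f"
  shows "locally_integrable \<Omega> f"
  unfolding locally_integrable_def
proof (intro allI impI)
  fix K assume K: "compact K \<and> K \<subseteq> \<Omega>"
  interpret finite_measure "lebesgue_on \<Omega>"
    using assms by (intro finite_measure_lebesgue_on_bounded)
  have "\<Omega> \<in> sets lebesgue" using assms(1) by simp
  moreover have m: "f \<in> borel_measurable (lebesgue_on \<Omega>)"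
    using assms(3) by (simp add: sq_integrable_def)
  have i: "integrable (lebesgue_on \<Omega>) (\<lambda>x. (f x)\<^sup>2)"
    using assms(3) by (simp add: sq_integrable_def)
  have "integrable (lebesgue_on \<Omega>) f"
    by (rule square_integrable_imp_integrable[OF m i])
  ultimately have "set_integrable lebesgue \<Omega> f"
    by (simp add: integrable_restrict_space set_integrable_def)
  then show "set_integrable lebesgue K f"
    by (rule set_integrable_subset) (use K fmeasurableD[OF lmeasurable_compact[of K]] in auto)
qed

lemma locally_integrable_cong_AE:
  assumes "open \<Omega>" "locally_integrable \<Omega> f" "AE x in lebesgue_on \<Omega>. f x = g x"
  shows "locally_integrable \<Omega> g"
  unfolding locally_integrable_def set_integrable_def
proof (intro allI impI)
  fix K assume K: "compact K \<and> K \<subseteq> \<Omega>"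
  then have f: "integrable lebesgue (\<lambda>x. indicator K x *\<^sub>R f x)"
    using assms(2) by (auto simp: locally_integrable_def set_integrable_def)
  have ae: "AE x in lebesgue. indicator K x *\<^sub>R f x = indicator K x *\<^sub>R g x"
    using assms(3) assms(1) K by (subst (asm) AE_restrict_space_iff) (auto simp: indicator_def elim!: AE_mp)
  with f have "(\<lambda>x. indicator K x *\<^sub>R g x) \<in> borel_measurable lebesgue"
    by (intro borel_measurable_AE[OF _ ae]) auto
  then show "integrable lebesgue (\<lambda>x. indicator K x *\<^sub>R g x)"
    using f ae integrable_cong_AE[OF borel_measurable_integrable[OF f] _ ae] by blast
qed

lemma LINT_test_cong_AE:
  fixes f g :: "'a::euclidean_space \<Rightarrow> real"
  assumes "AE x in lebesgue_on \<Omega>. f x = g x" "open \<Omega>"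
  shows "(LINT x|lebesgue_on \<Omega>. f x * h x) = (LINT x|lebesgue_on \<Omega>. g x * h x)"
proof (cases "(\<lambda>x. f x * h x) \<in> borel_measurable (lebesgue_on \<Omega>)")
  case True
  have ae: "AE x in lebesgue_on \<Omega>. f x * h x = g x * h x"
    using assms(1) by eventually_elim simp
  then have "(\<lambda>x. g x * h x) \<in> borel_measurable (lebesgue_on \<Omega>)"
    using True assms(2) by (intro borel_measurable_lebesgue_on_AE[OF _ True ae]) auto
  then show ?thesis using True ae by (intro integral_cong_AE)
next
  \<comment> \<open>Then neither product is measurable, so neither is integrable, and both integrals
    have the default value 0.\<close>
  case False
  have ae: "AE x in lebesgue_on \<Omega>. g x * h x = f x * h x"
    using assms(1) by eventually_elim simp
  have "(\<lambda>x. g x * h x) \<notin> borel_measurable (lebesgue_on \<Omega>)"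
    using False assms(2) borel_measurable_lebesgue_on_AE[OF _ _ ae] by auto
  then show ?thesis
    using False by (metis borel_measurable_integrable not_integrable_integral_eq)
qed

section \<open>Weak derivatives modulo null sets: invariance, uniqueness, choice of a
  representative\<close>

lemma has_weak_deriv_cong_AE:
  assumes "open \<Omega>" "has_weak_deriv \<Omega> i f g"
    and "AE x in lebesgue_on \<Omega>. f x = f' x" "AE x in lebesgue_on \<Omega>. g x = g' x"
  shows "has_weak_deriv \<Omega> i f' g'"
  using assms locally_integrable_cong_AE[OF assms(1) _ assms(3)]
    locally_integrable_cong_AE[OF assms(1) _ assms(4)]
  by (auto simp: has_weak_deriv_def LINT_test_cong_AE[OF assms(3,1)] LINT_test_cong_AE[OF assms(4,1)])

lemma locally_integrable_diff:
  "locally_integrable \<Omega> f \<Longrightarrow> locally_integrable \<Omega> g \<Longrightarrow> locally_integrable \<Omega> (\<lambda>x. f x - g x)"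
  by (auto simp: locally_integrable_def intro!: set_integral_diff)

lemma has_weak_deriv_diff:
  assumes "open \<Omega>" "i \<in> Basis" "has_weak_deriv \<Omega> i f g" "has_weak_deriv \<Omega> i f' g'"
  shows "has_weak_deriv \<Omega> i (\<lambda>x. f x - f' x) (\<lambda>x. g x - g' x)"
  unfolding has_weak_deriv_def
proof (intro conjI ballI)
  show "locally_integrable \<Omega> (\<lambda>x. f x - f' x)" "locally_integrable \<Omega> (\<lambda>x. g x - g' x)"
    using assms by (auto simp: has_weak_deriv_def intro: locally_integrable_diff)
  fix \<eta> assume \<eta>: "\<eta> \<in> test_fun \<Omega>"
  show "(LINT x|lebesgue_on \<Omega>. (f x - f' x) * partial_deriv i \<eta> x)
      = - (LINT x|lebesgue_on \<Omega>. (g x - g' x) * \<eta> x)"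
    using has_weak_deriv_integrable[OF assms(3,1) \<eta> assms(2)]
      has_weak_deriv_integrable[OF assms(4,1) \<eta> assms(2)]
      has_weak_derivD[OF assms(3) \<eta>] has_weak_derivD[OF assms(4) \<eta>]
    by (simp add: left_diff_distrib)
qed

lemma has_weak_deriv_unique:
  assumes "open \<Omega>" "bounded \<Omega>" "i \<in> Basis" "has_weak_deriv \<Omega> i f g" "has_weak_deriv \<Omega> i f g'"
  shows "AE x in lebesgue_on \<Omega>. g x = g' x"
proof -
  have d: "has_weak_deriv \<Omega> i (\<lambda>x. f x - f x) (\<lambda>x. g x - g' x)"
    using assms by (intro has_weak_deriv_diff)
  have "AE x in lebesgue_on \<Omega>. g x - g' x = 0"
  proof (rule ae_zero_if_test_integrals_zero[OF assms(1,2)])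
    show "locally_integrable \<Omega> (\<lambda>x. g x - g' x)"
      using d by (simp add: has_weak_deriv_def)
    show "(LINT x|lebesgue_on \<Omega>. (g x - g' x) * \<eta> x) = 0" if "\<eta> \<in> test_fun \<Omega>" for \<eta>
      using has_weak_derivD[OF d that] by simp
  qed
  then show ?thesis by simp
qed

lemma weak_deriv_works:
  assumes "has_weak_deriv \<Omega> i f g"
  shows "has_weak_deriv \<Omega> i f (weak_deriv \<Omega> i f)"
  unfolding weak_deriv_def using assms by (rule someI[of "has_weak_deriv \<Omega> i f"])

lemma weak_deriv_AE_eq:
  assumes "open \<Omega>" "bounded \<Omega>" "i \<in> Basis" "has_weak_deriv \<Omega> i f g"
  shows "AE x in lebesgue_on \<Omega>. weak_deriv \<Omega> i f x = g x"
  using has_weak_deriv_unique[OF assms(1-3) weak_deriv_works[OF assms(4)] assms(4)] .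

lemma sq_integrable_cong_AE:
  fixes f g :: "'a::euclidean_space \<Rightarrow> real"
  assumes "open \<Omega>" "sq_integrable (lebesgue_on \<Omega>) f" "AE x in lebesgue_on \<Omega>. f x = g x"
  shows "sq_integrable (lebesgue_on \<Omega>) g"
proof (rule sq_integrable_bound[OF assms(2), of _ 1])
  show "g \<in> borel_measurable (lebesgue_on \<Omega>)"
    using assms by (intro borel_measurable_lebesgue_on_AE[OF _ _ assms(3)]) (auto simp: sq_integrable_def)
qed (use assms(3) in auto)

text \<open>A case distinction replaces induction: the weak derivatives of \<open>f\<close> serve
  unchanged for \<open>g\<close>.\<close>

lemma Hk_cong_AE:
  assumes "open \<Omega>" "f \<in> Hk k \<Omega>" "AE x in lebesgue_on \<Omega>. f x = g x"
  shows "g \<in> Hk k \<Omega>"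
proof (cases k)
  case 0
  then show ?thesis
    using assms sq_integrable_cong_AE by (auto simp: L2_fun_iff)
next
  case (Suc m)
  have "\<exists>h\<in>Hk m \<Omega>. has_weak_deriv \<Omega> i g h" if "i \<in> Basis" for i
    using assms Suc that has_weak_deriv_cong_AE[OF assms(1) _ assms(3)] by fastforce
  then show ?thesis
    using Suc assms sq_integrable_cong_AE by (auto simp: L2_fun_iff)
qed

text \<open>The representative picked by \<open>SOME\<close> may differ from the one that witnesses
  membership in \<open>Hk\<close>. Uniqueness makes them agree almost everywhere, and the regularity
  is transferred.\<close>

lemma Hk_weak_deriv:
  assumes "open \<Omega>" "bounded \<Omega>" "i \<in> Basis" "f \<in> Hk (Suc k) \<Omega>"
  shows "has_weak_deriv \<Omega> i f (weak_deriv \<Omega> i f)" "weak_deriv \<Omega> i f \<in> Hk k \<Omega>"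
proof -
  obtain g where g: "g \<in> Hk k \<Omega>" "has_weak_deriv \<Omega> i f g"
    using assms by auto
  show "has_weak_deriv \<Omega> i f (weak_deriv \<Omega> i f)"
    using g weak_deriv_works by blast
  have "AE x in lebesgue_on \<Omega>. g x = weak_deriv \<Omega> i f x"
    using weak_deriv_AE_eq[OF assms(1-3) g(2)] by eventually_elim simp
  then show "weak_deriv \<Omega> i f \<in> Hk k \<Omega>"
    using Hk_cong_AE[OF assms(1) g(1)] by blast
qed

lemma Hk_sq_integrable: "f \<in> Hk k \<Omega> \<Longrightarrow> sq_integrable (lebesgue_on \<Omega>) f"
  by (cases k) (auto simp: L2_fun_iff)

lemma test_fun_sq_integrable:
  assumes "open \<Omega>" "bounded \<Omega>" "\<eta> \<in> test_fun \<Omega>"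
  shows "sq_integrable (lebesgue_on \<Omega>) \<eta>"
proof -
  interpret finite_measure "lebesgue_on \<Omega>"
    using assms by (intro finite_measure_lebesgue_on_bounded)
  obtain C where "\<And>x. \<bar>\<eta> x\<bar> \<le> C"
    using test_fun_bounded[OF assms(3)] by blast
  then show ?thesis
    using assms(3) by (intro sq_integrable_bounded[of _ C] test_fun_measurable) auto
qed

section \<open>Classical derivatives as weak derivatives\<close>

lemma has_weak_deriv_smooth:
  assumes "open \<Omega>" "\<eta> \<in> smooth" "i \<in> Basis"
  shows "has_weak_deriv \<Omega> i \<eta> (partial_deriv i \<eta>)"
  using has_weak_deriv_classical[OF assms(1) smooth_has_derivative[OF assms(2)] _ assms(3)]
    smooth_continuous_on[OF smooth_partial[OF assms(2,3)]]
  unfolding partial_deriv_def[abs_def] by blast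

lemma Ck_on_2D:
  assumes "\<phi> \<in> Ck_on 2 \<Omega>" "open \<Omega>" "i \<in> Basis"
  shows "x \<in> \<Omega> \<Longrightarrow> (\<phi> has_derivative frechet_derivative \<phi> (at x)) (at x)"
    and "x \<in> \<Omega> \<Longrightarrow> (partial_deriv i \<phi> has_derivative frechet_derivative (partial_deriv i \<phi>) (at x)) (at x)"
    and "continuous_on \<Omega> (partial_deriv i \<phi>)"
    and "l \<in> Basis \<Longrightarrow> continuous_on \<Omega> (partial_deriv l (partial_deriv i \<phi>))"
proof -
  have *: "is \<in> lists Basis \<Longrightarrow> length is \<le> 2 \<Longrightarrow>
      continuous_on \<Omega> (iter_partial is \<phi>) \<and> (length is < 2 \<longrightarrow> iter_partial is \<phi> differentiable_on \<Omega>)" for "is"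
    using assms(1) unfolding Ck_on_def by blast
  have diff: "h differentiable_on \<Omega> \<Longrightarrow> (h has_derivative frechet_derivative h (at x)) (at x)"
    if "x \<in> \<Omega>" for h :: "'a \<Rightarrow> real"
    using that assms(2) differentiable_on_eq_differentiable_at frechet_derivative_works by blast
  show "x \<in> \<Omega> \<Longrightarrow> (\<phi> has_derivative frechet_derivative \<phi> (at x)) (at x)"
    using *[of "[]"] by (intro diff) simp_all
  show "x \<in> \<Omega> \<Longrightarrow> (partial_deriv i \<phi> has_derivative frechet_derivative (partial_deriv i \<phi>) (at x)) (at x)"
    using *[of "[i]"] assms(3) by (intro diff) simp_all
  show "continuous_on \<Omega> (partial_deriv i \<phi>)"
    using *[of "[i]"] assms(3) by simp
  show "l \<in> Basis \<Longrightarrow> continuous_on \<Omega> (partial_deriv l (partial_deriv i \<phi>))"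
    using *[of "[i, l]"] assms(3) by simp
qed

lemma Ck_on_2_has_weak_deriv:
  assumes "\<phi> \<in> Ck_on 2 \<Omega>" "open \<Omega>" "i \<in> Basis"
  shows "has_weak_deriv \<Omega> i \<phi> (partial_deriv i \<phi>)"
    and "l \<in> Basis \<Longrightarrow> has_weak_deriv \<Omega> l (partial_deriv i \<phi>) (partial_deriv l (partial_deriv i \<phi>))"
proof -
  note D = Ck_on_2D[OF assms]
  show "has_weak_deriv \<Omega> i \<phi> (partial_deriv i \<phi>)"
    using has_weak_deriv_classical[OF assms(2) D(1) _ assms(3)] D(3)
    unfolding partial_deriv_def[abs_def] by blast
  show "has_weak_deriv \<Omega> l (partial_deriv i \<phi>) (partial_deriv l (partial_deriv i \<phi>))" if "l \<in> Basis"
    using has_weak_deriv_classical[OF assms(2) D(2) _ that] D(4)[OF that]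
    unfolding partial_deriv_def[of l, abs_def] by blast
qed

lemma weak_deriv_diff_classical:
  assumes "open \<Omega>" "bounded \<Omega>" "i \<in> Basis" "v \<in> Hk (Suc k) \<Omega>" "has_weak_deriv \<Omega> i \<zeta> \<zeta>'"
  shows "AE x in lebesgue_on \<Omega>. weak_deriv \<Omega> i (\<lambda>x. v x - \<zeta> x) x = weak_deriv \<Omega> i v x - \<zeta>' x"
  using assms Hk_weak_deriv[OF assms(1-4)]
  by (intro weak_deriv_AE_eq has_weak_deriv_diff) auto

text \<open>The inner derivative of the difference is a choice of its own, equal to the difference
  of derivatives only almost everywhere, so invariance under null sets is invoked before
  differentiating again.\<close>

lemma weak_deriv2_diff_classical:
  assumes "open \<Omega>" "bounded \<Omega>" "i \<in> Basis" "l \<in> Basis" "v \<in> Hk (Suc (Suc k)) \<Omega>"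
    and "has_weak_deriv \<Omega> i \<zeta> \<zeta>'" "has_weak_deriv \<Omega> l \<zeta>' \<zeta>''"
  shows "AE x in lebesgue_on \<Omega>. weak_deriv \<Omega> l (weak_deriv \<Omega> i (\<lambda>x. v x - \<zeta> x)) x
    = weak_deriv \<Omega> l (weak_deriv \<Omega> i v) x - \<zeta>'' x"
proof (rule weak_deriv_AE_eq[OF assms(1,2,4)])
  have v: "weak_deriv \<Omega> i v \<in> Hk (Suc k) \<Omega>"
    using Hk_weak_deriv[OF assms(1-3,5)] by simp
  have "has_weak_deriv \<Omega> l (\<lambda>x. weak_deriv \<Omega> i v x - \<zeta>' x)
      (\<lambda>x. weak_deriv \<Omega> l (weak_deriv \<Omega> i v) x - \<zeta>'' x)"
    using Hk_weak_deriv[OF assms(1,2,4) v] assms by (intro has_weak_deriv_diff) auto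
  moreover have "AE x in lebesgue_on \<Omega>. weak_deriv \<Omega> i v x - \<zeta>' x = weak_deriv \<Omega> i (\<lambda>x. v x - \<zeta> x) x"
    using weak_deriv_diff_classical[OF assms(1-3,5,6)] by eventually_elim simp
  ultimately show "has_weak_deriv \<Omega> l (weak_deriv \<Omega> i (\<lambda>x. v x - \<zeta> x))
      (\<lambda>x. weak_deriv \<Omega> l (weak_deriv \<Omega> i v) x - \<zeta>'' x)"
    by (rule has_weak_deriv_cong_AE[OF assms(1)]) simp
qed

section \<open>Approximation in H^2 by compactly supported functions\<close>

lemma LINT_square_cong_AE:
  fixes f g :: "'a::euclidean_space \<Rightarrow> real"
  assumes "open \<Omega>" "sq_integrable (lebesgue_on \<Omega>) g" "AE x in lebesgue_on \<Omega>. f x = g x"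
  shows "(LINT x|lebesgue_on \<Omega>. (f x)\<^sup>2) = (LINT x|lebesgue_on \<Omega>. (g x)\<^sup>2)"
proof (rule integral_cong_AE)
  have "AE x in lebesgue_on \<Omega>. g x = f x"
    using assms(3) by eventually_elim simp
  from sq_integrable_cong_AE[OF assms(1,2) this]
  have "f \<in> borel_measurable (lebesgue_on \<Omega>)" by (rule sq_integrable_measurable)
  then show "(\<lambda>x. (f x)\<^sup>2) \<in> borel_measurable (lebesgue_on \<Omega>)" by simp
  show "(\<lambda>x. (g x)\<^sup>2) \<in> borel_measurable (lebesgue_on \<Omega>)"
    using sq_integrable_measurable[OF assms(2)] by simp
  show "AE x in lebesgue_on \<Omega>. (f x)\<^sup>2 = (g x)\<^sup>2"
    using assms(3) by eventually_elim simp
qed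

text \<open>The squared Sobolev norm is a sum of nonnegative integrals, one for each derivative of
  order at most two, so each of them is controlled by the whole.\<close>

lemma Hk0_2_approx:
  fixes \<Omega> :: "'a::euclidean_space set"
  assumes \<Omega>: "open \<Omega>" "bounded \<Omega>" and v: "v \<in> Hk0 2 \<Omega>"
  obtains \<eta> :: "nat \<Rightarrow> 'a \<Rightarrow> real" where "\<And>n. \<eta> n \<in> test_fun \<Omega>"
    "(\<lambda>n. LINT x|lebesgue_on \<Omega>. (v x - \<eta> n x)\<^sup>2) \<longlonglongrightarrow> 0"
    "\<And>i. i \<in> Basis \<Longrightarrow>
      (\<lambda>n. LINT x|lebesgue_on \<Omega>. (weak_deriv \<Omega> i v x - partial_deriv i (\<eta> n) x)\<^sup>2) \<longlonglongrightarrow> 0"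
    "\<And>i l. i \<in> Basis \<Longrightarrow> l \<in> Basis \<Longrightarrow>
      (\<lambda>n. LINT x|lebesgue_on \<Omega>. (weak_deriv \<Omega> l (weak_deriv \<Omega> i v) x
          - partial_deriv l (partial_deriv i (\<eta> n)) x)\<^sup>2) \<longlonglongrightarrow> 0"
proof -
  have v2: "v \<in> Hk (Suc (Suc 0)) \<Omega>"
    using v by (simp add: Hk0_def numeral_2_eq_2)
  have "\<exists>\<eta>\<in>test_fun \<Omega>. sqrt (Hk_normsq 2 \<Omega> (\<lambda>x. v x - \<eta> x)) < inverse (Suc n)" for n
    using v unfolding Hk0_def by auto
  then obtain \<eta> where \<eta>: "\<And>n. \<eta> n \<in> test_fun \<Omega>"
    "\<And>n. sqrt (Hk_normsq 2 \<Omega> (\<lambda>x. v x - \<eta> n x)) < inverse (Suc n)"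
    by metis
  define A where "A n = (LINT x|lebesgue_on \<Omega>. (v x - \<eta> n x)\<^sup>2)" for n
  define B where "B i n = (LINT x|lebesgue_on \<Omega>. (weak_deriv \<Omega> i v x - partial_deriv i (\<eta> n) x)\<^sup>2)" for i n
  define C where "C i l n = (LINT x|lebesgue_on \<Omega>. (weak_deriv \<Omega> l (weak_deriv \<Omega> i v) x
          - partial_deriv l (partial_deriv i (\<eta> n)) x)\<^sup>2)" for i l n
  have nonneg: "0 \<le> A n" "0 \<le> B i n" "0 \<le> C i l n" for i l n
    by (auto simp: A_def B_def C_def)
  \<comment> \<open>\<open>Hk_normsq\<close> speaks about newly chosen weak derivatives of the
    difference; almost everywhere these are the weak derivative of \<open>v\<close> minus the
    classical one of the test function.\<close>
  have norm: "Hk_normsq 2 \<Omega> (\<lambda>x. v x - \<eta> n x) = A n + (\<Sum>i\<in>Basis. B i n + (\<Sum>l\<in>Basis. C i l n))" for n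
  proof -
    have w1: "has_weak_deriv \<Omega> i (\<eta> n) (partial_deriv i (\<eta> n))" if "i \<in> Basis" for i
      using that \<Omega> \<eta>(1) by (intro has_weak_deriv_smooth test_fun_smooth)
    have w2: "has_weak_deriv \<Omega> l (partial_deriv i (\<eta> n)) (partial_deriv l (partial_deriv i (\<eta> n)))"
      if "i \<in> Basis" "l \<in> Basis" for i l
      using that \<Omega> \<eta>(1) by (intro has_weak_deriv_smooth test_fun_smooth test_fun_partial)
    have "(LINT x|lebesgue_on \<Omega>. (weak_deriv \<Omega> i (\<lambda>x. v x - \<eta> n x) x)\<^sup>2) = B i n" if i: "i \<in> Basis" for i
      unfolding B_def
      by (rule LINT_square_cong_AE[OF \<Omega>(1) sq_integrable_diff[OF Hk_sq_integrable[OF Hk_weak_deriv(2)[OF \<Omega> i v2]]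
          test_fun_sq_integrable[OF \<Omega> test_fun_partial[OF \<eta>(1) i]]]
          weak_deriv_diff_classical[OF \<Omega> i v2 w1[OF i]]])
    moreover have "(LINT x|lebesgue_on \<Omega>. (weak_deriv \<Omega> l (weak_deriv \<Omega> i (\<lambda>x. v x - \<eta> n x)) x)\<^sup>2) = C i l n"
      if i: "i \<in> Basis" and l: "l \<in> Basis" for i l
      unfolding C_def
      by (rule LINT_square_cong_AE[OF \<Omega>(1)
          sq_integrable_diff[OF Hk_sq_integrable[OF Hk_weak_deriv(2)[OF \<Omega> l Hk_weak_deriv(2)[OF \<Omega> i v2]]]
            test_fun_sq_integrable[OF \<Omega> test_fun_partial[OF test_fun_partial[OF \<eta>(1) i] l]]]
          weak_deriv2_diff_classical[OF \<Omega> i l v2 w1[OF i] w2[OF i l]]])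
    ultimately show ?thesis
      by (simp add: numeral_2_eq_2 A_def)
  qed
  have le: "A n + (\<Sum>i\<in>Basis. B i n + (\<Sum>l\<in>Basis. C i l n)) \<le> inverse (Suc n)" for n
  proof -
    have s: "sqrt (Hk_normsq 2 \<Omega> (\<lambda>x. v x - \<eta> n x)) < inverse (Suc n)" by (rule \<eta>)
    have p: "0 \<le> Hk_normsq 2 \<Omega> (\<lambda>x. v x - \<eta> n x)"
      unfolding norm by (intro add_nonneg_nonneg sum_nonneg nonneg)
    \<comment> \<open>Squaring the bound on the root gives inverse (n + 1) squared, which is at most
      inverse (n + 1).\<close>
    have "Hk_normsq 2 \<Omega> (\<lambda>x. v x - \<eta> n x) < (inverse (real (Suc n)))\<^sup>2"
      using s real_less_rsqrt by (smt (verit) p real_sqrt_less_iff real_sqrt_unique inverse_nonnegative_iff_nonnegative of_nat_0_le_iff)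
    also have "\<dots> \<le> inverse (real (Suc n))"
      using power_decreasing[of 1 2 "inverse (real (Suc n))"] by (simp add: inverse_le_1_iff)
    finally show ?thesis by (simp add: norm)
  qed
  have lim: "X \<longlonglongrightarrow> 0" if "\<And>n. 0 \<le> X n"
      "\<And>n. X n \<le> A n + (\<Sum>i\<in>Basis. B i n + (\<Sum>l\<in>Basis. C i l n))" for X
    using that le by (intro Lim_null_comparison[OF always_eventually LIMSEQ_inverse_real_of_nat])
      (auto intro: order_trans)
  have le': "B i n + (\<Sum>l\<in>Basis. C i l n) \<le> (\<Sum>i\<in>Basis. B i n + (\<Sum>l\<in>Basis. C i l n))"
    if "i \<in> Basis" for i n
    using that by (intro member_le_sum[of i Basis "\<lambda>i. B i n + (\<Sum>l\<in>Basis. C i l n)"])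
      (auto intro!: add_nonneg_nonneg sum_nonneg nonneg)
  have le'': "C i l n \<le> (\<Sum>l\<in>Basis. C i l n)" if "l \<in> Basis" for i l n
    using that by (intro member_le_sum[of l Basis "\<lambda>l. C i l n"]) (auto intro: nonneg)
  have sn: "0 \<le> (\<Sum>l\<in>Basis. C i l n)" for i n
    by (intro sum_nonneg nonneg)
  show thesis
  proof (rule that[of \<eta>])
    show "(\<lambda>n. LINT x|lebesgue_on \<Omega>. (v x - \<eta> n x)\<^sup>2) \<longlonglongrightarrow> 0"
      unfolding A_def[symmetric]
      by (intro lim nonneg) (auto intro!: add_nonneg_nonneg sum_nonneg nonneg)
    show "(\<lambda>n. LINT x|lebesgue_on \<Omega>. (weak_deriv \<Omega> i v x - partial_deriv i (\<eta> n) x)\<^sup>2) \<longlonglongrightarrow> 0"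
      if "i \<in> Basis" for i
      unfolding B_def[symmetric]
    proof (intro lim nonneg)
      show "B i n \<le> A n + (\<Sum>i\<in>Basis. B i n + (\<Sum>l\<in>Basis. C i l n))" for n
        using le'[OF that, of n] nonneg(1)[of n] sn[of i n] by linarith
    qed
    show "(\<lambda>n. LINT x|lebesgue_on \<Omega>. (weak_deriv \<Omega> l (weak_deriv \<Omega> i v) x
          - partial_deriv l (partial_deriv i (\<eta> n)) x)\<^sup>2) \<longlonglongrightarrow> 0" if "i \<in> Basis" "l \<in> Basis" for i l
      unfolding C_def[symmetric]
    proof (intro lim nonneg)
      show "C i l n \<le> A n + (\<Sum>i\<in>Basis. B i n + (\<Sum>l\<in>Basis. C i l n))" for n
        using le'[OF that(1), of n] le''[OF that(2), of i n] nonneg(1)[of n] nonneg(2)[of i n] by linarith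
    qed
  qed (rule \<eta>)
qed

lemma norm_sum_Basis_sq:
  "(norm (\<Sum>i\<in>Basis. c i *\<^sub>R (i::'a::euclidean_space)))\<^sup>2 = (\<Sum>i\<in>Basis. (c i)\<^sup>2)"
  unfolding power2_norm_eq_inner
  by (subst euclidean_inner) (simp add: inner_sum_left_Basis power2_eq_square)

lemma sq_integrable_sum_Basis:
  fixes c :: "'b::euclidean_space \<Rightarrow> 'a \<Rightarrow> real"
  assumes "\<And>i. i \<in> Basis \<Longrightarrow> sq_integrable M (c i)"
  shows "sq_integrable M (\<lambda>x. \<Sum>i\<in>Basis. c i x *\<^sub>R i)"
proof (rule sq_integrable_sum)
  fix i :: 'b assume i: "i \<in> Basis"
  from assms[OF i] have "(\<lambda>x. c i x *\<^sub>R i) \<in> borel_measurable M"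
    by (intro borel_measurable_scaleR borel_measurable_const) (rule sq_integrable_measurable)
  then show "sq_integrable M (\<lambda>x. c i x *\<^sub>R i)"
    using i by (intro sq_integrable_bound[OF assms[OF i], of _ 1]) auto
qed simp

lemma tendsto_LINT_norm_sum_Basis:
  fixes c :: "nat \<Rightarrow> 'b::euclidean_space \<Rightarrow> 'a \<Rightarrow> real"
  assumes "\<And>n i. i \<in> Basis \<Longrightarrow> sq_integrable M (c n i)"
    and "\<And>i. i \<in> Basis \<Longrightarrow> (\<lambda>n. LINT x|M. (c n i x)\<^sup>2) \<longlonglongrightarrow> 0"
  shows "(\<lambda>n. LINT x|M. (norm (\<Sum>i\<in>Basis. c n i x *\<^sub>R i))\<^sup>2) \<longlonglongrightarrow> 0"
proof -
  have "(LINT x|M. (norm (\<Sum>i\<in>Basis. c n i x *\<^sub>R i))\<^sup>2) = (\<Sum>i\<in>Basis. LINT x|M. (c n i x)\<^sup>2)" for n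
    unfolding norm_sum_Basis_sq
    using assms(1) by (intro Bochner_Integration.integral_sum) (auto simp: sq_integrable_def)
  then show ?thesis
    using tendsto_sum[of Basis "\<lambda>i n. LINT x|M. (c n i x)\<^sup>2" "\<lambda>i. 0"] assms(2) by simp
qed

definition grad :: "('a::euclidean_space \<Rightarrow> real) \<Rightarrow> 'a \<Rightarrow> 'a" where
  "grad f x = (\<Sum>i\<in>Basis. partial_deriv i f x *\<^sub>R i)"

text \<open>Column \<open>l\<close> of the Hessian, kept as a vector because the chain rule
  evaluates \<open>nrm_deriv\<close> in this direction.\<close>

definition partial_grad :: "'a::euclidean_space \<Rightarrow> ('a \<Rightarrow> real) \<Rightarrow> 'a \<Rightarrow> 'a" where
  "partial_grad l f x = (\<Sum>i\<in>Basis. partial_deriv l (partial_deriv i f) x *\<^sub>R i)"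

definition weak_partial_grad :: "'a::euclidean_space set \<Rightarrow> 'a \<Rightarrow> ('a \<Rightarrow> real) \<Rightarrow> 'a \<Rightarrow> 'a" where
  "weak_partial_grad \<Omega> l u x = (\<Sum>i\<in>Basis. weak_deriv \<Omega> l (weak_deriv \<Omega> i u) x *\<^sub>R i)"

lemma H2_sq_integrable:
  assumes "open \<Omega>" "bounded \<Omega>" "u \<in> Hk 2 \<Omega>"
  shows "sq_integrable (lebesgue_on \<Omega>) u" "sq_integrable (lebesgue_on \<Omega>) (weak_grad \<Omega> u)"
    and "l \<in> Basis \<Longrightarrow> sq_integrable (lebesgue_on \<Omega>) (weak_partial_grad \<Omega> l u)"
proof -
  have u2: "u \<in> Hk (Suc (Suc 0)) \<Omega>"
    using assms(3) by (simp add: numeral_2_eq_2)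
  note 1 = Hk_weak_deriv(2)[OF assms(1,2) _ u2]
  show "sq_integrable (lebesgue_on \<Omega>) u"
    using assms(3) by (rule Hk_sq_integrable)
  show "sq_integrable (lebesgue_on \<Omega>) (weak_grad \<Omega> u)"
    unfolding weak_grad_def[abs_def] by (intro sq_integrable_sum_Basis Hk_sq_integrable[OF 1])
  show "sq_integrable (lebesgue_on \<Omega>) (weak_partial_grad \<Omega> l u)" if "l \<in> Basis"
    unfolding weak_partial_grad_def[abs_def]
    by (intro sq_integrable_sum_Basis Hk_sq_integrable[OF Hk_weak_deriv(2)[OF assms(1,2) that 1]])
qed

text \<open>The approximants \<open>\<phi> x + \<eta> n x\<close> are C^2 in \<Omega>, so classical
  calculus applies to them. Any two admissible functions are approximated with the same \<phi>,
  which cancels in their difference.\<close>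

lemma admissible_approx:
  fixes \<Omega> :: "'a::euclidean_space set"
  assumes \<Omega>: "open \<Omega>" "bounded \<Omega>" and \<phi>: "\<phi> \<in> Ck_on 2 \<Omega>"
    and u: "u \<in> Hk 2 \<Omega>" "(\<lambda>x. u x - \<phi> x) \<in> Hk0 2 \<Omega>"
  obtains \<eta> :: "nat \<Rightarrow> 'a \<Rightarrow> real" where "\<And>n. \<eta> n \<in> test_fun \<Omega>"
    "\<And>n. sq_integrable (lebesgue_on \<Omega>) (\<lambda>x. u x - (\<phi> x + \<eta> n x))"
    "(\<lambda>n. LINT x|lebesgue_on \<Omega>. (norm (u x - (\<phi> x + \<eta> n x)))\<^sup>2) \<longlonglongrightarrow> 0"
    "\<And>n. sq_integrable (lebesgue_on \<Omega>) (\<lambda>x. weak_grad \<Omega> u x - (grad \<phi> x + grad (\<eta> n) x))"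
    "(\<lambda>n. LINT x|lebesgue_on \<Omega>. (norm (weak_grad \<Omega> u x - (grad \<phi> x + grad (\<eta> n) x)))\<^sup>2) \<longlonglongrightarrow> 0"
    "\<And>n l. l \<in> Basis \<Longrightarrow>
      sq_integrable (lebesgue_on \<Omega>) (\<lambda>x. weak_partial_grad \<Omega> l u x - (partial_grad l \<phi> x + partial_grad l (\<eta> n) x))"
    "\<And>l. l \<in> Basis \<Longrightarrow>
      (\<lambda>n. LINT x|lebesgue_on \<Omega>. (norm (weak_partial_grad \<Omega> l u x
          - (partial_grad l \<phi> x + partial_grad l (\<eta> n) x)))\<^sup>2) \<longlonglongrightarrow> 0"
proof -
  let ?L = "lebesgue_on \<Omega>"
  let ?v = "\<lambda>x. u x - \<phi> x"
  have u2: "u \<in> Hk (Suc (Suc 0)) \<Omega>"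
    using u(1) by (simp add: numeral_2_eq_2)
  have v2: "?v \<in> Hk (Suc (Suc 0)) \<Omega>"
    using u(2) by (simp add: Hk0_def numeral_2_eq_2)
  obtain \<eta> :: "nat \<Rightarrow> 'a \<Rightarrow> real" where \<eta>: "\<And>n. \<eta> n \<in> test_fun \<Omega>"
    "(\<lambda>n. LINT x|?L. (?v x - \<eta> n x)\<^sup>2) \<longlonglongrightarrow> 0"
    "\<And>i. i \<in> Basis \<Longrightarrow> (\<lambda>n. LINT x|?L. (weak_deriv \<Omega> i ?v x - partial_deriv i (\<eta> n) x)\<^sup>2) \<longlonglongrightarrow> 0"
    "\<And>i l. i \<in> Basis \<Longrightarrow> l \<in> Basis \<Longrightarrow>
      (\<lambda>n. LINT x|?L. (weak_deriv \<Omega> l (weak_deriv \<Omega> i ?v) x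
          - partial_deriv l (partial_deriv i (\<eta> n)) x)\<^sup>2) \<longlonglongrightarrow> 0"
    using Hk0_2_approx[OF \<Omega> u(2)] by blast
  note \<phi>1 = Ck_on_2_has_weak_deriv(1)[OF \<phi> \<Omega>(1)] and \<phi>2 = Ck_on_2_has_weak_deriv(2)[OF \<phi> \<Omega>(1)]
  have c1: "sq_integrable ?L (\<lambda>x. weak_deriv \<Omega> i u x - (partial_deriv i \<phi> x + partial_deriv i (\<eta> n) x)) \<and>
      (LINT x|?L. (weak_deriv \<Omega> i u x - (partial_deriv i \<phi> x + partial_deriv i (\<eta> n) x))\<^sup>2)
        = (LINT x|?L. (weak_deriv \<Omega> i ?v x - partial_deriv i (\<eta> n) x)\<^sup>2)" if i: "i \<in> Basis" for i n
  proof -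
    have ae: "AE x in ?L. weak_deriv \<Omega> i ?v x - partial_deriv i (\<eta> n) x
        = weak_deriv \<Omega> i u x - (partial_deriv i \<phi> x + partial_deriv i (\<eta> n) x)"
      using weak_deriv_diff_classical[OF \<Omega> i u2 \<phi>1[OF i]] by eventually_elim simp
    have s: "sq_integrable ?L (\<lambda>x. weak_deriv \<Omega> i ?v x - partial_deriv i (\<eta> n) x)"
      by (rule sq_integrable_diff[OF Hk_sq_integrable[OF Hk_weak_deriv(2)[OF \<Omega> i v2]]
          test_fun_sq_integrable[OF \<Omega> test_fun_partial[OF \<eta>(1) i]]])
    have s': "sq_integrable ?L (\<lambda>x. weak_deriv \<Omega> i u x - (partial_deriv i \<phi> x + partial_deriv i (\<eta> n) x))"
      by (rule sq_integrable_cong_AE[OF \<Omega>(1) s ae])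
    show ?thesis
      using s' LINT_square_cong_AE[OF \<Omega>(1) s' ae] by simp
  qed
  have c2: "sq_integrable ?L (\<lambda>x. weak_deriv \<Omega> l (weak_deriv \<Omega> i u) x
        - (partial_deriv l (partial_deriv i \<phi>) x + partial_deriv l (partial_deriv i (\<eta> n)) x)) \<and>
      (LINT x|?L. (weak_deriv \<Omega> l (weak_deriv \<Omega> i u) x
        - (partial_deriv l (partial_deriv i \<phi>) x + partial_deriv l (partial_deriv i (\<eta> n)) x))\<^sup>2)
        = (LINT x|?L. (weak_deriv \<Omega> l (weak_deriv \<Omega> i ?v) x - partial_deriv l (partial_deriv i (\<eta> n)) x)\<^sup>2)"
    if i: "i \<in> Basis" and l: "l \<in> Basis" for i l n
  proof -
    have ae: "AE x in ?L. weak_deriv \<Omega> l (weak_deriv \<Omega> i ?v) x - partial_deriv l (partial_deriv i (\<eta> n)) x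
        = weak_deriv \<Omega> l (weak_deriv \<Omega> i u) x
          - (partial_deriv l (partial_deriv i \<phi>) x + partial_deriv l (partial_deriv i (\<eta> n)) x)"
      using weak_deriv2_diff_classical[OF \<Omega> i l u2 \<phi>1[OF i] \<phi>2[OF i l]] by eventually_elim simp
    have s: "sq_integrable ?L (\<lambda>x. weak_deriv \<Omega> l (weak_deriv \<Omega> i ?v) x - partial_deriv l (partial_deriv i (\<eta> n)) x)"
      by (rule sq_integrable_diff[OF Hk_sq_integrable[OF Hk_weak_deriv(2)[OF \<Omega> l Hk_weak_deriv(2)[OF \<Omega> i v2]]]
          test_fun_sq_integrable[OF \<Omega> test_fun_partial[OF test_fun_partial[OF \<eta>(1) i] l]]])
    have s': "sq_integrable ?L (\<lambda>x. weak_deriv \<Omega> l (weak_deriv \<Omega> i u) x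
          - (partial_deriv l (partial_deriv i \<phi>) x + partial_deriv l (partial_deriv i (\<eta> n)) x))"
      by (rule sq_integrable_cong_AE[OF \<Omega>(1) s ae])
    show ?thesis
      using s' LINT_square_cong_AE[OF \<Omega>(1) s' ae] by simp
  qed
  have g: "weak_grad \<Omega> u x - (grad \<phi> x + grad (\<eta> n) x)
      = (\<Sum>i\<in>Basis. (weak_deriv \<Omega> i u x - (partial_deriv i \<phi> x + partial_deriv i (\<eta> n) x)) *\<^sub>R i)" for n x
    by (simp add: weak_grad_def grad_def sum.distrib[symmetric] sum_subtractf[symmetric] algebra_simps)
  have pg: "weak_partial_grad \<Omega> l u x - (partial_grad l \<phi> x + partial_grad l (\<eta> n) x)
      = (\<Sum>i\<in>Basis. (weak_deriv \<Omega> l (weak_deriv \<Omega> i u) x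
        - (partial_deriv l (partial_deriv i \<phi>) x + partial_deriv l (partial_deriv i (\<eta> n)) x)) *\<^sub>R i)" for n l x
    by (simp add: weak_partial_grad_def partial_grad_def sum.distrib[symmetric] sum_subtractf[symmetric] algebra_simps)
  show thesis
  proof (rule that[of \<eta>])
    show "sq_integrable ?L (\<lambda>x. u x - (\<phi> x + \<eta> n x))" for n
      using sq_integrable_diff[OF Hk_sq_integrable[OF v2] test_fun_sq_integrable[OF \<Omega> \<eta>(1)[of n]]]
      by (simp add: diff_diff_eq)
    show "(\<lambda>n. LINT x|?L. (norm (u x - (\<phi> x + \<eta> n x)))\<^sup>2) \<longlonglongrightarrow> 0"
      using \<eta>(2) by (simp add: diff_diff_eq)
    show "sq_integrable ?L (\<lambda>x. weak_grad \<Omega> u x - (grad \<phi> x + grad (\<eta> n) x))" for n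
      unfolding g using c1 by (intro sq_integrable_sum_Basis) auto
    show "(\<lambda>n. LINT x|?L. (norm (weak_grad \<Omega> u x - (grad \<phi> x + grad (\<eta> n) x)))\<^sup>2) \<longlonglongrightarrow> 0"
      unfolding g using c1 \<eta>(3) by (intro tendsto_LINT_norm_sum_Basis) auto
    show "sq_integrable ?L (\<lambda>x. weak_partial_grad \<Omega> l u x - (partial_grad l \<phi> x + partial_grad l (\<eta> n) x))"
      if "l \<in> Basis" for n l
      unfolding pg using c2 that by (intro sq_integrable_sum_Basis) auto
    show "(\<lambda>n. LINT x|?L. (norm (weak_partial_grad \<Omega> l u x
          - (partial_grad l \<phi> x + partial_grad l (\<eta> n) x)))\<^sup>2) \<longlonglongrightarrow> 0" if "l \<in> Basis" for l
      unfolding pg using c2 \<eta>(4) that by (intro tendsto_LINT_norm_sum_Basis) auto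
  qed (rule \<eta>)
qed

section \<open>The unit normal of a graph\<close>

definition area_elem :: "'a::euclidean_space \<Rightarrow> real" where
  "area_elem p = sqrt (1 + (norm p)\<^sup>2)"

text \<open>The horizontal part of the upright or downward unit normal, up to sign, of a graph with
  gradient \<open>p\<close>; the vertical part has size
  \<open>inverse (area_elem p)\<close>.\<close>

definition nrm :: "'a::euclidean_space \<Rightarrow> 'a" where
  "nrm p = p /\<^sub>R area_elem p"

text \<open>The quotient rule for p / \<open>area_elem p\<close>, using that
  \<open>area_elem\<close> has derivative \<open>nrm p \<bullet> v\<close> in direction
  \<open>v\<close>.\<close>

definition nrm_deriv :: "'a::euclidean_space \<Rightarrow> 'a \<Rightarrow> 'a" where
  "nrm_deriv p v = (v - (nrm p \<bullet> v) *\<^sub>R nrm p) /\<^sub>R area_elem p"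

lemma area_elem_ge_1: "1 \<le> area_elem p"
  by (simp add: area_elem_def)

lemma area_elem_pos: "0 < area_elem p"
  using area_elem_ge_1[of p] by linarith

lemma area_elem_sq: "(area_elem p)\<^sup>2 = 1 + p \<bullet> p"
  by (simp add: area_elem_def power2_norm_eq_inner)

lemma inverse_area_elem_bounds: "0 < inverse (area_elem p)" "inverse (area_elem p) \<le> 1"
  using area_elem_ge_1[of p] by (auto intro: le_imp_inverse_le[of 1, simplified] order.strict_trans2)

lemma nrm_inner_self: "nrm p \<bullet> nrm p = 1 - (inverse (area_elem p))\<^sup>2"
proof -
  have "nrm p \<bullet> nrm p = (p \<bullet> p) * (inverse (area_elem p))\<^sup>2"
    by (simp add: nrm_def power2_eq_square)
  also have "p \<bullet> p = (area_elem p)\<^sup>2 - 1"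
    by (simp add: area_elem_sq)
  finally show ?thesis
    using area_elem_pos[of p] by (simp add: left_diff_distrib power_inverse)
qed

lemma norm_nrm_le_1: "norm (nrm p) \<le> 1"
proof -
  have "(norm (nrm p))\<^sup>2 \<le> 1\<^sup>2"
    unfolding power2_norm_eq_inner nrm_inner_self by simp
  then show ?thesis by (rule power2_le_imp_le) simp
qed

text \<open>The pair \<open>(nrm p, 1 / area_elem p)\<close> is a unit vector, which gives the strong monotonicity
  of the mean curvature operator.\<close>

lemma nrm_monotone_eq:
  "(nrm p - nrm q) \<bullet> (p - q) = (area_elem p + area_elem q) / 2 *
    ((norm (nrm p - nrm q))\<^sup>2 + (inverse (area_elem p) - inverse (area_elem q))\<^sup>2)"
proof -
  define a b c where "a = inverse (area_elem p)" and "b = inverse (area_elem q)" and "c = p \<bullet> q"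
  have ab: "area_elem p = inverse a" "area_elem q = inverse b" "a > 0" "b > 0"
    using area_elem_pos[of p] area_elem_pos[of q] by (auto simp: a_def b_def)
  have pp: "p \<bullet> p = (inverse a)\<^sup>2 - 1" "q \<bullet> q = (inverse b)\<^sup>2 - 1"
    using area_elem_sq[of p] area_elem_sq[of q] by (auto simp: ab)
  have nn: "nrm p \<bullet> nrm p = 1 - a\<^sup>2" "nrm q \<bullet> nrm q = 1 - b\<^sup>2" "nrm p \<bullet> nrm q = a * b * c"
    using nrm_inner_self[of p] nrm_inner_self[of q] by (auto simp: a_def b_def c_def nrm_def)
  have "(norm (nrm p - nrm q))\<^sup>2 = (1 - a\<^sup>2) + (1 - b\<^sup>2) - 2 * (a * b * c)"
  proof -
    have "nrm q \<bullet> nrm p = a * b * c" using nn(3) by (simp add: inner_commute)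
    then show ?thesis
      unfolding power2_norm_eq_inner by (simp add: inner_diff_left inner_diff_right nn)
  qed
  moreover have "(nrm p - nrm q) \<bullet> (p - q) = a * ((inverse a)\<^sup>2 - 1) + b * ((inverse b)\<^sup>2 - 1) - (a + b) * c"
    by (simp add: nrm_def inner_diff inner_commute[of q p] pp distrib_right flip: a_def b_def c_def)
  \<comment> \<open>For unit vectors the bracket on the right is 2 - 2 a b (1 + c), and (1/a + 1/b)
    a b = a + b turns the right side into the left one.\<close>
  moreover have "a * ((inverse a)\<^sup>2 - 1) + b * ((inverse b)\<^sup>2 - 1) - (a + b) * c
      = (inverse a + inverse b) / 2 * ((1 - a\<^sup>2) + (1 - b\<^sup>2) - 2 * (a * b * c) + (a - b)\<^sup>2)"
    using ab(3,4) by (simp add: field_simps power2_eq_square)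
  ultimately show ?thesis
    by (simp add: ab(1,2))
qed

text \<open>The factor in \<open>nrm_monotone_eq\<close> is the mean of two area elements, each at
  least 1.\<close>

lemma nrm_monotone:
  "(norm (nrm p - nrm q))\<^sup>2 + (inverse (area_elem p) - inverse (area_elem q))\<^sup>2 \<le> (nrm p - nrm q) \<bullet> (p - q)"
proof -
  have "1 * ((norm (nrm p - nrm q))\<^sup>2 + (inverse (area_elem p) - inverse (area_elem q))\<^sup>2)
      \<le> (nrm p - nrm q) \<bullet> (p - q)"
    unfolding nrm_monotone_eq using area_elem_ge_1[of p] area_elem_ge_1[of q]
    by (intro mult_right_mono) auto
  then show ?thesis by simp
qed

text \<open>With n and r the two differences, monotonicity and Cauchy-Schwarz give n^2 + r^2 \<le> n
  |p - q|. Dropping r^2 bounds n by |p - q|; dropping n^2 and inserting this bound controls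
  r.\<close>

lemma nrm_lipschitz: "norm (nrm p - nrm q) \<le> norm (p - q)"
  and inverse_area_elem_lipschitz: "\<bar>inverse (area_elem p) - inverse (area_elem q)\<bar> \<le> norm (p - q)"
proof -
  let ?n = "norm (nrm p - nrm q)" and ?r = "inverse (area_elem p) - inverse (area_elem q)"
  have *: "?n\<^sup>2 + ?r\<^sup>2 \<le> ?n * norm (p - q)"
    using nrm_monotone[of p q] norm_cauchy_schwarz[of "nrm p - nrm q" "p - q"] by linarith
  then have "?n * ?n \<le> ?n * norm (p - q)"
    using zero_le_power2[of ?r] by (simp only: power2_eq_square)
  then show n: "?n \<le> norm (p - q)"
    by (cases "?n = 0") (auto simp: mult_le_cancel_left)
  have "?r\<^sup>2 \<le> ?n * norm (p - q)"
    using * zero_le_power2[of ?n] by linarith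
  also have "\<dots> \<le> (norm (p - q))\<^sup>2"
    using n by (simp add: power2_eq_square mult_right_mono)
  finally show "\<bar>?r\<bar> \<le> norm (p - q)"
    by (metis abs_le_square_iff abs_norm_cancel)
qed

lemma has_derivative_nrm: "(nrm has_derivative nrm_deriv p) (at p)"
proof -
  have pos: "1 + p \<bullet> p > 0" by (simp add: add_pos_nonneg)
  have e: "area_elem = (\<lambda>p. sqrt (1 + p \<bullet> p))"
    by (simp add: area_elem_def fun_eq_iff power2_norm_eq_inner)
  have d: "(area_elem has_derivative (\<lambda>v. nrm p \<bullet> v)) (at p)"
    unfolding e nrm_def using pos
    by (auto intro!: derivative_eq_intros simp: inner_commute field_simps)
  have "area_elem p \<noteq> 0" using area_elem_pos[of p] by simp
  have "((\<lambda>p. p /\<^sub>R area_elem p) has_derivative nrm_deriv p) (at p)"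
    unfolding nrm_deriv_def using area_elem_pos[of p]
    by (auto intro!: derivative_eq_intros d simp: nrm_def algebra_simps)
  then show ?thesis
    unfolding nrm_def[abs_def] .
qed

lemma nrm_deriv_diff: "nrm_deriv p v - nrm_deriv p w = nrm_deriv p (v - w)"
  by (simp add: nrm_deriv_def inner_diff_right algebra_simps)

lemma norm_nrm_deriv_le: "norm (nrm_deriv p v) \<le> 2 * norm v"
proof -
  have "norm ((nrm p \<bullet> v) *\<^sub>R nrm p) \<le> norm v * 1"
    unfolding norm_scaleR using Cauchy_Schwarz_ineq2[of "nrm p" v] norm_nrm_le_1[of p]
      mult_right_mono[OF norm_nrm_le_1[of p], of "norm v"]
    by (intro mult_mono) auto
  then have "norm (v - (nrm p \<bullet> v) *\<^sub>R nrm p) \<le> 2 * norm v"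
    using norm_triangle_ineq4[of v "(nrm p \<bullet> v) *\<^sub>R nrm p"] by linarith
  then have "inverse (area_elem p) * norm (v - (nrm p \<bullet> v) *\<^sub>R nrm p) \<le> 1 * (2 * norm v)"
    using inverse_area_elem_bounds[of p] by (intro mult_mono) auto
  then show ?thesis
    using area_elem_pos[of p] by (simp add: nrm_deriv_def)
qed

text \<open>The form of the right side is dictated by the limit in the chain rule: the difference of
  gradients multiplies only \<open>w\<close>, which there is the fixed Hessian column of the limit,
  so the product of two L^2 functions tends to 0 in L^1.\<close>

lemma norm_nrm_deriv_diff_le:
  "norm (nrm_deriv p v - nrm_deriv q w) \<le> 2 * norm (v - w) + 4 * (norm (p - q) * norm w)"
proof -
  let ?r = "\<lambda>p. inverse (area_elem p)"
  \<comment> \<open>Telescoping over the three places where \<open>p\<close> occurs; with the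
    Lipschitz bounds they contribute 2, 1 and 1, whence the constant 4.\<close>
  have "nrm_deriv p w - nrm_deriv q w = (?r p - ?r q) *\<^sub>R (w - (nrm p \<bullet> w) *\<^sub>R nrm p)
     - ?r q *\<^sub>R (((nrm p - nrm q) \<bullet> w) *\<^sub>R nrm p + (nrm q \<bullet> w) *\<^sub>R (nrm p - nrm q))"
    by (simp add: nrm_deriv_def algebra_simps inner_diff_left)
  also have "norm \<dots> \<le> norm (p - q) * (2 * norm w) + 1 * (norm (p - q) * norm w + norm w * norm (p - q))"
  proof (rule order_trans[OF norm_triangle_ineq4 add_mono])
    have c: "\<bar>nrm p \<bullet> w\<bar> \<le> norm w" for p
      using Cauchy_Schwarz_ineq2[of "nrm p" w] mult_right_mono[OF norm_nrm_le_1[of p], of "norm w"] by simp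
    have "norm ((nrm p \<bullet> w) *\<^sub>R nrm p) \<le> norm w * 1"
      unfolding norm_scaleR by (intro mult_mono c norm_nrm_le_1) auto
    then have "norm (w - (nrm p \<bullet> w) *\<^sub>R nrm p) \<le> 2 * norm w"
      using norm_triangle_ineq4[of w "(nrm p \<bullet> w) *\<^sub>R nrm p"] by linarith
    then show "norm ((?r p - ?r q) *\<^sub>R (w - (nrm p \<bullet> w) *\<^sub>R nrm p)) \<le> norm (p - q) * (2 * norm w)"
      unfolding norm_scaleR by (intro mult_mono inverse_area_elem_lipschitz) auto
    have "norm (((nrm p - nrm q) \<bullet> w) *\<^sub>R nrm p) \<le> (norm (p - q) * norm w) * 1"
      unfolding norm_scaleR
      using Cauchy_Schwarz_ineq2[of "nrm p - nrm q" w] mult_right_mono[OF nrm_lipschitz[of p q], of "norm w"]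
      by (intro mult_mono norm_nrm_le_1) auto
    moreover have "norm ((nrm q \<bullet> w) *\<^sub>R (nrm p - nrm q)) \<le> norm w * norm (p - q)"
      unfolding norm_scaleR by (intro mult_mono c nrm_lipschitz) auto
    ultimately have "norm (((nrm p - nrm q) \<bullet> w) *\<^sub>R nrm p + (nrm q \<bullet> w) *\<^sub>R (nrm p - nrm q))
        \<le> norm (p - q) * norm w + norm w * norm (p - q)"
      by (intro norm_triangle_le) linarith
    then show "norm (?r q *\<^sub>R (((nrm p - nrm q) \<bullet> w) *\<^sub>R nrm p + (nrm q \<bullet> w) *\<^sub>R (nrm p - nrm q)))
        \<le> 1 * (norm (p - q) * norm w + norm w * norm (p - q))"
      unfolding norm_scaleR using inverse_area_elem_bounds[of q] by (intro mult_mono) auto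
  qed
  finally have "norm (nrm_deriv p w - nrm_deriv q w) \<le> 4 * (norm (p - q) * norm w)"
    by (simp add: algebra_simps)
  moreover have "norm (nrm_deriv p v - nrm_deriv p w) \<le> 2 * norm (v - w)"
    unfolding nrm_deriv_diff by (rule norm_nrm_deriv_le)
  ultimately show ?thesis
    using norm_triangle_ineq[of "nrm_deriv p v - nrm_deriv p w" "nrm_deriv p w - nrm_deriv q w"] by simp
qed

section \<open>Continuity and measurability of the normal map\<close>

lemma continuous_on_nrm: "continuous_on S nrm"
  using has_derivative_nrm has_derivative_continuous by (blast intro: continuous_at_imp_continuous_on)

lemma borel_measurable_nrm [measurable]: "nrm \<in> borel_measurable borel"
  by (intro borel_measurable_continuous_onI continuous_on_nrm)

lemma borel_measurable_area_elem [measurable]: "area_elem \<in> borel_measurable borel"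
  unfolding area_elem_def[abs_def] by measurable

lemma continuous_on_area_elem: "continuous_on S area_elem"
  unfolding area_elem_def[abs_def] by (intro continuous_intros)

lemma continuous_on_nrm_deriv:
  assumes "continuous_on S f" "continuous_on S g"
  shows "continuous_on S (\<lambda>x. nrm_deriv (f x) (g x))"
proof -
  have "continuous_on S (\<lambda>x. nrm (f x))" "continuous_on S (\<lambda>x. area_elem (f x))"
    using continuous_on_compose2[OF continuous_on_nrm[of UNIV] assms(1)]
      continuous_on_compose2[OF continuous_on_area_elem[of UNIV] assms(1)] by auto
  moreover have "area_elem (f x) \<noteq> 0" for x
    using area_elem_pos[of "f x"] by simp
  ultimately show ?thesis
    unfolding nrm_deriv_def by (intro continuous_intros assms) auto
qed

lemma borel_measurable_nrm_deriv:
  assumes [measurable]: "F \<in> borel_measurable M" "G \<in> borel_measurable M"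
  shows "(\<lambda>x. nrm_deriv (F x) (G x)) \<in> borel_measurable M"
  unfolding nrm_deriv_def by measurable

section \<open>Chain rule for the normal of an H^2 graph\<close>

lemma sq_integrable_imp_integrable_norm:
  assumes "finite_measure M" "sq_integrable M F"
  shows "integrable M (\<lambda>x. norm (F x))"
proof -
  interpret finite_measure M by fact
  have "sq_integrable M (\<lambda>x. 1 :: real)"
    by (rule sq_integrable_bounded[of _ 1]) auto
  from sq_integrable_mult[OF assms(2) this] show ?thesis by simp
qed

lemma tendsto_LINT_norm:
  assumes "finite_measure M" "\<And>n. sq_integrable M (F n)"
    and "(\<lambda>n. LINT x|M. (norm (F n x))\<^sup>2) \<longlonglongrightarrow> 0"
  shows "(\<lambda>n. LINT x|M. norm (F n x)) \<longlonglongrightarrow> 0"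
proof -
  interpret finite_measure M by fact
  have "sq_integrable M (\<lambda>x. 1 :: real)"
    by (rule sq_integrable_bounded[of _ 1]) auto
  from tendsto_integral_norm_mult[OF assms(2) this assms(3)] show ?thesis by simp
qed

text \<open>For the approximants the identity is the classical chain rule. Both sides of the weak
  formulation then converge in L^1: the left one since \<open>nrm\<close> is Lipschitz, the right
  one by \<open>norm_nrm_deriv_diff_le\<close>.\<close>

lemma has_weak_deriv_nrm_weak_grad:
  fixes \<Omega> :: "'a::euclidean_space set"
  assumes \<Omega>: "open \<Omega>" "bounded \<Omega>" and \<phi>: "\<phi> \<in> Ck_on 2 \<Omega>"
    and u: "u \<in> Hk 2 \<Omega>" "(\<lambda>x. u x - \<phi> x) \<in> Hk0 2 \<Omega>"
    and i: "i \<in> Basis" and l: "l \<in> Basis"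
  shows "has_weak_deriv \<Omega> l (\<lambda>x. nrm (weak_grad \<Omega> u x) \<bullet> i)
    (\<lambda>x. nrm_deriv (weak_grad \<Omega> u x) (weak_partial_grad \<Omega> l u x) \<bullet> i)"
    and "sq_integrable (lebesgue_on \<Omega>) (\<lambda>x. nrm_deriv (weak_grad \<Omega> u x) (weak_partial_grad \<Omega> l u x) \<bullet> i)"
proof -
  let ?L = "lebesgue_on \<Omega>"
  have fin: "finite_measure ?L"
    by (rule finite_measure_lebesgue_on_bounded[OF \<Omega>])
  then interpret finite_measure ?L .
  define P where "P = weak_grad \<Omega> u"
  define A where "A = weak_partial_grad \<Omega> l u"
  have P: "sq_integrable ?L P" and A: "sq_integrable ?L A"
    using H2_sq_integrable[OF \<Omega> u(1)] l by (auto simp: P_def A_def)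
  note [measurable] = sq_integrable_measurable[OF P] sq_integrable_measurable[OF A]
  have iN: "\<bar>v \<bullet> i\<bar> \<le> norm v" for v :: 'a
    using Basis_le_norm[OF i] .
  have mD: "(\<lambda>x. nrm_deriv (P x) (A x) \<bullet> i) \<in> borel_measurable ?L"
    using borel_measurable_nrm_deriv[of P ?L A] by measurable
  have bN: "\<bar>nrm p \<bullet> i\<bar> \<le> 1" for p :: 'a
    using iN[of "nrm p"] norm_nrm_le_1[of p] by linarith
  have sD: "sq_integrable ?L (\<lambda>x. nrm_deriv (P x) (A x) \<bullet> i)"
  proof (rule sq_integrable_bound[OF A mD])
    show "AE x in ?L. norm (nrm_deriv (P x) (A x) \<bullet> i) \<le> 2 * norm (A x)"
      using order_trans[OF iN norm_nrm_deriv_le] by simp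
  qed
  have sN: "sq_integrable ?L (\<lambda>x. nrm (P x) \<bullet> i)"
    by (rule sq_integrable_bounded[of _ 1]) (use bN in auto)
  show "sq_integrable ?L (\<lambda>x. nrm_deriv (weak_grad \<Omega> u x) (weak_partial_grad \<Omega> l u x) \<bullet> i)"
    using sD by (simp add: P_def A_def)
  obtain \<eta> :: "nat \<Rightarrow> 'a \<Rightarrow> real" where \<eta>: "\<And>n. \<eta> n \<in> test_fun \<Omega>"
    and s1: "\<And>n. sq_integrable ?L (\<lambda>x. P x - (grad \<phi> x + grad (\<eta> n) x))"
    and l1: "(\<lambda>n. LINT x|?L. (norm (P x - (grad \<phi> x + grad (\<eta> n) x)))\<^sup>2) \<longlonglongrightarrow> 0"
    and s2: "\<And>n. sq_integrable ?L (\<lambda>x. A x - (partial_grad l \<phi> x + partial_grad l (\<eta> n) x))"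
    and l2: "(\<lambda>n. LINT x|?L. (norm (A x - (partial_grad l \<phi> x + partial_grad l (\<eta> n) x)))\<^sup>2) \<longlonglongrightarrow> 0"
  proof (rule admissible_approx[OF \<Omega> \<phi> u, folded P_def], goal_cases)
    case (1 \<eta>)
    show ?case
      by (rule 1(1)[OF 1(2,5,6) 1(7)[OF l, folded A_def] 1(8)[OF l, folded A_def]])
  qed
  define g where "g n x = grad \<phi> x + grad (\<eta> n) x" for n x
  define a where "a n x = partial_grad l \<phi> x + partial_grad l (\<eta> n) x" for n x
  \<comment> \<open>The approximating gradient is differentiable at the points of \<Omega> only,
    where \<phi> is C^2, so \<open>has_weak_deriv_classical\<close> is used.\<close>
  have w: "has_weak_deriv \<Omega> l (\<lambda>x. nrm (g n x) \<bullet> i) (\<lambda>x. nrm_deriv (g n x) (a n x) \<bullet> i)" for n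
  proof -
    define Dg where "Dg x v = (\<Sum>j\<in>Basis. (frechet_derivative (partial_deriv j \<phi>) (at x) v
      + frechet_derivative (partial_deriv j (\<eta> n)) (at x) v) *\<^sub>R j)" for x and v :: 'a
    have g: "g n = (\<lambda>x. \<Sum>j\<in>Basis. (partial_deriv j \<phi> x + partial_deriv j (\<eta> n) x) *\<^sub>R j)"
      by (simp add: g_def grad_def fun_eq_iff sum.distrib algebra_simps)
    have a: "a n = (\<lambda>x. Dg x l)"
      by (simp add: a_def partial_grad_def Dg_def fun_eq_iff sum.distrib algebra_simps partial_deriv_def[of l])
    have sm: "partial_deriv j (\<eta> n) \<in> smooth" if "j \<in> Basis" for j
      using that \<eta>[of n] by (intro smooth_partial test_fun_smooth)
    have dg: "(g n has_derivative Dg x) (at x)" if "x \<in> \<Omega>" for x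
      unfolding g Dg_def
    proof (rule has_derivative_sum)
      fix j :: 'a assume j: "j \<in> Basis"
      show "((\<lambda>x. (partial_deriv j \<phi> x + partial_deriv j (\<eta> n) x) *\<^sub>R j) has_derivative
          (\<lambda>v. (frechet_derivative (partial_deriv j \<phi>) (at x) v
            + frechet_derivative (partial_deriv j (\<eta> n)) (at x) v) *\<^sub>R j)) (at x)"
        by (rule has_derivative_scaleR_left[OF has_derivative_add[OF
              Ck_on_2D(2)[OF \<phi> \<Omega>(1) j that] smooth_has_derivative[OF sm[OF j]]]])
    qed
    have d: "((\<lambda>x. nrm (g n x) \<bullet> i) has_derivative (\<lambda>v. nrm_deriv (g n x) (Dg x v) \<bullet> i)) (at x)" if "x \<in> \<Omega>" for x
      by (rule has_derivative_inner_left[OF has_derivative_compose[OF dg[OF that] has_derivative_nrm]])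
    have "continuous_on \<Omega> (g n)"
      using dg has_derivative_continuous by (blast intro: continuous_at_imp_continuous_on)
    moreover have "continuous_on \<Omega> (a n)"
      unfolding a_def partial_grad_def
      by (intro continuous_on_add continuous_on_sum continuous_on_scaleR continuous_on_const
          Ck_on_2D(4)[OF \<phi> \<Omega>(1) _ l] smooth_continuous_on smooth_partial[OF sm l])
    ultimately have "continuous_on \<Omega> (\<lambda>x. nrm_deriv (g n x) (a n x) \<bullet> i)"
      by (intro continuous_on_inner continuous_on_nrm_deriv continuous_on_const)
    then show ?thesis
      using has_weak_deriv_classical[OF \<Omega>(1) d _ l] unfolding a by blast
  qed
  have "has_weak_deriv \<Omega> l (\<lambda>x. nrm (P x) \<bullet> i) (\<lambda>x. nrm_deriv (P x) (A x) \<bullet> i)"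
    unfolding has_weak_deriv_def
  proof (intro conjI ballI sq_integrable_locally_integrable[OF \<Omega>] sN sD)
    fix \<zeta> assume \<zeta>: "\<zeta> \<in> test_fun \<Omega>"
    obtain C where C: "C > 0" "\<And>x. \<bar>\<zeta> x\<bar> \<le> C"
      using test_fun_bounded[OF \<zeta>] by blast
    obtain C' where C': "C' > 0" "\<And>x. \<bar>partial_deriv l \<zeta> x\<bar> \<le> C'"
      using test_fun_bounded[OF test_fun_partial[OF \<zeta> l]] by blast
    have s\<zeta>: "sq_integrable ?L \<zeta>" "sq_integrable ?L (partial_deriv l \<zeta>)"
      using test_fun_sq_integrable[OF \<Omega> \<zeta>] test_fun_sq_integrable[OF \<Omega> test_fun_partial[OF \<zeta> l]] .
    have sg: "sq_integrable ?L (\<lambda>x. P x - g n x)" and sa: "sq_integrable ?L (\<lambda>x. A x - a n x)" for n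
      using s1 s2 by (auto simp: g_def a_def)
    have lim1: "(\<lambda>n. LINT x|?L. nrm (g n x) \<bullet> i * partial_deriv l \<zeta> x)
        \<longlonglongrightarrow> (LINT x|?L. nrm (P x) \<bullet> i * partial_deriv l \<zeta> x)"
    proof (rule tendsto_integral_of_bound[where b = "\<lambda>n x. C' * norm (P x - g n x)"])
      show "integrable ?L (\<lambda>x. nrm (g n x) \<bullet> i * partial_deriv l \<zeta> x)" for n
        by (rule has_weak_deriv_integrable(1)[OF w \<Omega>(1) \<zeta> l])
      show "integrable ?L (\<lambda>x. nrm (P x) \<bullet> i * partial_deriv l \<zeta> x)"
        by (rule sq_integrable_mult_real[OF sN s\<zeta>(2)])
      show "integrable ?L (\<lambda>x. C' * norm (P x - g n x))" for n
        by (intro integrable_mult_right sq_integrable_imp_integrable_norm fin sg)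
      show "AE x in ?L. \<bar>nrm (g n x) \<bullet> i * partial_deriv l \<zeta> x - nrm (P x) \<bullet> i * partial_deriv l \<zeta> x\<bar>
          \<le> C' * norm (P x - g n x)" for n
      proof (rule AE_I2)
        fix x
        have "\<bar>(nrm (g n x) - nrm (P x)) \<bullet> i\<bar> \<le> norm (P x - g n x)"
          using iN[of "nrm (g n x) - nrm (P x)"] nrm_lipschitz[of "g n x" "P x"]
          by (simp add: norm_minus_commute[of "P x"])
        then have "\<bar>(nrm (g n x) - nrm (P x)) \<bullet> i\<bar> * \<bar>partial_deriv l \<zeta> x\<bar> \<le> norm (P x - g n x) * C'"
          using C' by (intro mult_mono) auto
        then show "\<bar>nrm (g n x) \<bullet> i * partial_deriv l \<zeta> x - nrm (P x) \<bullet> i * partial_deriv l \<zeta> x\<bar>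
            \<le> C' * norm (P x - g n x)"
          by (simp only: inner_diff_left left_diff_distrib[symmetric] abs_mult mult.commute[of _ C'])
      qed
      show "(\<lambda>n. LINT x|?L. C' * norm (P x - g n x)) \<longlonglongrightarrow> 0"
        using tendsto_mult_left[OF tendsto_LINT_norm[OF fin sg], where c = C'] l1 by (simp add: g_def)
    qed
    \<comment> \<open>The derivative has no uniform modulus of continuity in the Hessian argument
      alone; the fixed column \<open>A\<close> accompanies the gradient error, and Cauchy-Schwarz
      handles the product.\<close>
    have lim2: "(\<lambda>n. LINT x|?L. nrm_deriv (g n x) (a n x) \<bullet> i * \<zeta> x)
        \<longlonglongrightarrow> (LINT x|?L. nrm_deriv (P x) (A x) \<bullet> i * \<zeta> x)"
    proof (rule tendsto_integral_of_bound[where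
          b = "\<lambda>n x. C * (2 * norm (A x - a n x) + 4 * (norm (P x - g n x) * norm (A x)))"])
      show "integrable ?L (\<lambda>x. nrm_deriv (g n x) (a n x) \<bullet> i * \<zeta> x)" for n
        by (rule has_weak_deriv_integrable(2)[OF w \<Omega>(1) \<zeta> l])
      show "integrable ?L (\<lambda>x. nrm_deriv (P x) (A x) \<bullet> i * \<zeta> x)"
        by (rule sq_integrable_mult_real[OF sD s\<zeta>(1)])
      show "integrable ?L (\<lambda>x. C * (2 * norm (A x - a n x) + 4 * (norm (P x - g n x) * norm (A x))))" for n
        by (intro integrable_mult_right Bochner_Integration.integrable_add
            sq_integrable_imp_integrable_norm sq_integrable_mult fin sg sa A)
      show "AE x in ?L. \<bar>nrm_deriv (g n x) (a n x) \<bullet> i * \<zeta> x - nrm_deriv (P x) (A x) \<bullet> i * \<zeta> x\<bar>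
          \<le> C * (2 * norm (A x - a n x) + 4 * (norm (P x - g n x) * norm (A x)))" for n
      proof (rule AE_I2)
        fix x
        have "\<bar>(nrm_deriv (g n x) (a n x) - nrm_deriv (P x) (A x)) \<bullet> i\<bar>
            \<le> 2 * norm (A x - a n x) + 4 * (norm (P x - g n x) * norm (A x))"
          using iN[of "nrm_deriv (g n x) (a n x) - nrm_deriv (P x) (A x)"]
            norm_nrm_deriv_diff_le[of "g n x" "a n x" "P x" "A x"]
          by (simp add: norm_minus_commute[of "P x"] norm_minus_commute[of "A x"])
        then have "\<bar>(nrm_deriv (g n x) (a n x) - nrm_deriv (P x) (A x)) \<bullet> i\<bar> * \<bar>\<zeta> x\<bar>
            \<le> (2 * norm (A x - a n x) + 4 * (norm (P x - g n x) * norm (A x))) * C"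
          using C by (intro mult_mono) auto
        then show "\<bar>nrm_deriv (g n x) (a n x) \<bullet> i * \<zeta> x - nrm_deriv (P x) (A x) \<bullet> i * \<zeta> x\<bar>
            \<le> C * (2 * norm (A x - a n x) + 4 * (norm (P x - g n x) * norm (A x)))"
          by (simp only: inner_diff_left left_diff_distrib[symmetric] abs_mult mult.commute[of _ C])
      qed
      have "(\<lambda>n. LINT x|?L. norm (A x - a n x)) \<longlonglongrightarrow> 0"
        using tendsto_LINT_norm[OF fin sa] l2 by (simp add: a_def)
      moreover have "(\<lambda>n. LINT x|?L. norm (P x - g n x) * norm (A x)) \<longlonglongrightarrow> 0"
        using tendsto_integral_norm_mult[OF sg A] l1 by (simp add: g_def)
      ultimately have "(\<lambda>n. C * (2 * (LINT x|?L. norm (A x - a n x))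
            + 4 * (LINT x|?L. norm (P x - g n x) * norm (A x)))) \<longlonglongrightarrow> C * (2 * 0 + 4 * 0)"
        by (intro tendsto_intros)
      moreover have split: "(LINT x|?L. C * (2 * norm (A x - a n x) + 4 * (norm (P x - g n x) * norm (A x))))
          = C * (2 * (LINT x|?L. norm (A x - a n x)) + 4 * (LINT x|?L. norm (P x - g n x) * norm (A x)))" for n
        using sq_integrable_imp_integrable_norm[OF fin sa[of n]] sq_integrable_mult[OF sg[of n] A] by simp
      ultimately show "(\<lambda>n. LINT x|?L. C * (2 * norm (A x - a n x) + 4 * (norm (P x - g n x) * norm (A x)))) \<longlonglongrightarrow> 0"
        by (simp only: split) simp
    qed
    have "(\<lambda>n. LINT x|?L. nrm (g n x) \<bullet> i * partial_deriv l \<zeta> x)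
        \<longlonglongrightarrow> - (LINT x|?L. nrm_deriv (P x) (A x) \<bullet> i * \<zeta> x)"
      unfolding has_weak_derivD[OF w \<zeta>] by (intro tendsto_minus lim2)
    with lim1 show "(LINT x|?L. nrm (P x) \<bullet> i * partial_deriv l \<zeta> x)
        = - (LINT x|?L. nrm_deriv (P x) (A x) \<bullet> i * \<zeta> x)"
      by (rule LIMSEQ_unique)
  qed
  then show "has_weak_deriv \<Omega> l (\<lambda>x. nrm (weak_grad \<Omega> u x) \<bullet> i)
    (\<lambda>x. nrm_deriv (weak_grad \<Omega> u x) (weak_partial_grad \<Omega> l u x) \<bullet> i)"
    by (simp add: P_def A_def)
qed

section \<open>Mean curvature\<close>

text \<open>The trace of the derivative of the normal field, written out by the chain rule so that
  estimates do not depend on the choice made in \<open>weak_div\<close>. In two dimensions it is the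
  sum of the principal curvatures up to sign.\<close>

definition mean_curv :: "'a::euclidean_space set \<Rightarrow> ('a \<Rightarrow> real) \<Rightarrow> 'a \<Rightarrow> real" where
  "mean_curv \<Omega> u x = (\<Sum>i\<in>Basis. nrm_deriv (weak_grad \<Omega> u x) (weak_partial_grad \<Omega> i u x) \<bullet> i)"

locale H2_dirichlet =
  fixes \<Omega> :: "'a::euclidean_space set" and \<phi> u :: "'a \<Rightarrow> real"
  assumes \<Omega>: "open \<Omega>" "bounded \<Omega>" and \<phi>: "\<phi> \<in> Ck_on 2 \<Omega>"
    and u: "u \<in> Hk 2 \<Omega>" "(\<lambda>x. u x - \<phi> x) \<in> Hk0 2 \<Omega>"
begin

lemma mean_curv_sq_integrable: "sq_integrable (lebesgue_on \<Omega>) (mean_curv \<Omega> u)"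
  unfolding mean_curv_def[abs_def]
  by (intro sq_integrable_sum has_weak_deriv_nrm_weak_grad(2)[OF \<Omega> \<phi> u]) auto

lemma weak_div_eq_mean_curv:
  "AE x in lebesgue_on \<Omega>. weak_div \<Omega> (\<lambda>y. nrm (weak_grad \<Omega> u y)) x = mean_curv \<Omega> u x"
proof -
  have "AE x in lebesgue_on \<Omega>. \<forall>i\<in>Basis. weak_deriv \<Omega> i (\<lambda>y. nrm (weak_grad \<Omega> u y) \<bullet> i) x
      = nrm_deriv (weak_grad \<Omega> u x) (weak_partial_grad \<Omega> i u x) \<bullet> i"
    using weak_deriv_AE_eq[OF \<Omega> _ has_weak_deriv_nrm_weak_grad(1)[OF \<Omega> \<phi> u]]
    by (subst AE_finite_all) auto
  then show ?thesis
    by eventually_elim (simp add: weak_div_def mean_curv_def)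
qed

text \<open>Weak derivatives summed over the coordinates. On the left only the bounded normal is
  left of \<open>u\<close>, which is the quantity shown to converge.\<close>

lemma integral_nrm_grad:
  assumes \<eta>: "\<eta> \<in> test_fun \<Omega>"
  shows "(LINT x|lebesgue_on \<Omega>. nrm (weak_grad \<Omega> u x) \<bullet> grad \<eta> x)
    = - (LINT x|lebesgue_on \<Omega>. mean_curv \<Omega> u x * \<eta> x)"
proof -
  let ?L = "lebesgue_on \<Omega>"
  let ?D = "\<lambda>i x. nrm_deriv (weak_grad \<Omega> u x) (weak_partial_grad \<Omega> i u x) \<bullet> i"
  have w: "has_weak_deriv \<Omega> i (\<lambda>x. nrm (weak_grad \<Omega> u x) \<bullet> i) (?D i)" if "i \<in> Basis" for i
    using has_weak_deriv_nrm_weak_grad(1)[OF \<Omega> \<phi> u that that] .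
  have "(LINT x|?L. nrm (weak_grad \<Omega> u x) \<bullet> grad \<eta> x)
      = (LINT x|?L. (\<Sum>i\<in>Basis. nrm (weak_grad \<Omega> u x) \<bullet> i * partial_deriv i \<eta> x))"
    by (simp add: grad_def inner_sum_right mult.commute)
  also have "\<dots> = (\<Sum>i\<in>Basis. LINT x|?L. nrm (weak_grad \<Omega> u x) \<bullet> i * partial_deriv i \<eta> x)"
    by (intro Bochner_Integration.integral_sum has_weak_deriv_integrable(1)[OF w \<Omega>(1) \<eta>])
  also have "\<dots> = (\<Sum>i\<in>Basis. - (LINT x|?L. ?D i x * \<eta> x))"
    by (intro sum.cong refl has_weak_derivD[OF w \<eta>])
  also have "\<dots> = - (LINT x|?L. (\<Sum>i\<in>Basis. ?D i x * \<eta> x))"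
    by (subst Bochner_Integration.integral_sum)
      (auto intro: has_weak_deriv_integrable(2)[OF w \<Omega>(1) \<eta>] simp: sum_negf)
  finally show ?thesis
    by (simp add: mean_curv_def sum_distrib_right)
qed

end

section \<open>Continuity of the normal under \<open>L\<^sup>1\<close> convergence\<close>

lemma abs_nrm_inner_le: "\<bar>nrm p \<bullet> v\<bar> \<le> norm v"
  using Cauchy_Schwarz_ineq2[of "nrm p" v] mult_right_mono[OF norm_nrm_le_1[of p], of "norm v"] by simp

lemma arctan_diff_le: "\<bar>arctan a - arctan b\<bar> \<le> \<bar>a - b\<bar>"
proof -
  have *: "\<bar>arctan a - arctan b\<bar> \<le> \<bar>a - b\<bar>" if "a < b" for a b
  proof -
    from MVT2[OF that, of arctan "\<lambda>z. inverse (1 + z\<^sup>2)"] DERIV_arctan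
    obtain z where "arctan b - arctan a = (b - a) * inverse (1 + z\<^sup>2)"
      by blast
    moreover have "0 \<le> inverse (1 + z\<^sup>2)" "inverse (1 + z\<^sup>2) \<le> 1"
      by (auto simp: inverse_le_1_iff)
    ultimately have "0 \<le> arctan b - arctan a" "arctan b - arctan a \<le> (b - a) * 1"
      using that by (auto intro: mult_left_mono)
    then show ?thesis by simp
  qed
  show ?thesis
    using *[of a b] *[of b a] by (cases a b rule: linorder_cases) auto
qed

text \<open>One factor is bounded by 2, as pi < 4, and the other by |s|. Thus the L^2 norm of the
  test function is controlled by an L^1 norm.\<close>

lemma arctan_sq_le: "(arctan s)\<^sup>2 \<le> 2 * \<bar>s\<bar>"
proof -
  have "\<bar>arctan s\<bar> \<le> 2"
    using arctan_bounded[of s] pi_less_4 by auto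
  moreover have "\<bar>arctan s\<bar> \<le> \<bar>s\<bar>"
    using arctan_diff_le[of s 0] by simp
  ultimately have "\<bar>arctan s\<bar> * \<bar>arctan s\<bar> \<le> 2 * \<bar>s\<bar>"
    by (intro mult_mono) auto
  then show ?thesis by (simp add: power2_eq_square)
qed

lemma abs_le_half_one_plus_sq: "\<bar>a::real\<bar> \<le> (1 + a\<^sup>2) / 2"
  using zero_le_power2[of "\<bar>a\<bar> - 1"] by (simp add: power2_diff)

text \<open>The difference has the factor (a + b) / ((1 + a^2)(1 + b^2)), of modulus at most 1. The
  weight in the gradient of arctan is hence Lipschitz and passes to the limit.\<close>

lemma inverse_one_plus_sq_diff_le:
  fixes a b :: real
  shows "\<bar>inverse (1 + a\<^sup>2) - inverse (1 + b\<^sup>2)\<bar> \<le> \<bar>a - b\<bar>"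
proof -
  have pos: "1 + a\<^sup>2 > 0" "1 + b\<^sup>2 > 0"
    by (auto intro: add_pos_nonneg)
  have "\<bar>inverse (1 + a\<^sup>2) - inverse (1 + b\<^sup>2)\<bar> = \<bar>a - b\<bar> * (\<bar>a + b\<bar> / ((1 + a\<^sup>2) * (1 + b\<^sup>2)))"
  proof -
    have "inverse (1 + a\<^sup>2) - inverse (1 + b\<^sup>2) = (b - a) * ((a + b) / ((1 + a\<^sup>2) * (1 + b\<^sup>2)))"
      using pos by (simp add: field_simps power2_eq_square)
    then show ?thesis
      using pos by (simp add: abs_mult abs_minus_commute)
  qed
  also have "\<bar>a + b\<bar> / ((1 + a\<^sup>2) * (1 + b\<^sup>2)) \<le> 1"
  proof -
    have "\<bar>a + b\<bar> \<le> (1 + a\<^sup>2) / 2 + (1 + b\<^sup>2) / 2"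
      using abs_le_half_one_plus_sq[of a] abs_le_half_one_plus_sq[of b] by linarith
    also have "\<dots> \<le> (1 + a\<^sup>2) * (1 + b\<^sup>2)"
      using mult_nonneg_nonneg[OF zero_le_power2[of a] zero_le_power2[of b]] by (simp add: field_simps)
    finally show ?thesis using pos by (simp add: divide_le_eq)
  qed
  then have "\<bar>a - b\<bar> * (\<bar>a + b\<bar> / ((1 + a\<^sup>2) * (1 + b\<^sup>2))) \<le> \<bar>a - b\<bar> * 1"
    by (intro mult_left_mono) auto
  finally show ?thesis by simp
qed

lemma tendsto_LINT_norm_sq_diff:
  assumes "\<And>n. sq_integrable M (F n)" "\<And>n. sq_integrable M (G n)"
    and "(\<lambda>n. LINT x|M. (norm (F n x))\<^sup>2) \<longlonglongrightarrow> 0" "(\<lambda>n. LINT x|M. (norm (G n x))\<^sup>2) \<longlonglongrightarrow> 0"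
  shows "(\<lambda>n. LINT x|M. (norm (F n x - G n x))\<^sup>2) \<longlonglongrightarrow> 0"
proof (rule Lim_null_comparison[OF always_eventually])
  show "\<forall>n. norm (LINT x|M. (norm (F n x - G n x))\<^sup>2)
      \<le> 2 * (LINT x|M. (norm (F n x))\<^sup>2) + 2 * (LINT x|M. (norm (G n x))\<^sup>2)"
  proof
    fix n
    have b: "(norm (F n x - G n x))\<^sup>2 \<le> 2 * (norm (F n x))\<^sup>2 + 2 * (norm (G n x))\<^sup>2" for x
      using power_mono[OF norm_triangle_ineq4[of "F n x" "G n x"], of 2]
        sum_squares_bound[of "norm (F n x)" "norm (G n x)"] by (simp add: power2_sum)
    have "(LINT x|M. (norm (F n x - G n x))\<^sup>2)
        \<le> (LINT x|M. 2 * (norm (F n x))\<^sup>2 + 2 * (norm (G n x))\<^sup>2)"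
      using assms(1,2)[of n] sq_integrable_diff[OF assms(1,2)[of n]] b
      by (intro integral_mono) (auto simp: sq_integrable_def)
    also have "\<dots> = 2 * (LINT x|M. (norm (F n x))\<^sup>2) + 2 * (LINT x|M. (norm (G n x))\<^sup>2)"
      using assms(1,2)[of n] by (simp add: sq_integrable_def)
    finally show "norm (LINT x|M. (norm (F n x - G n x))\<^sup>2)
      \<le> 2 * (LINT x|M. (norm (F n x))\<^sup>2) + 2 * (LINT x|M. (norm (G n x))\<^sup>2)"
      by simp
  qed
  show "(\<lambda>n. 2 * (LINT x|M. (norm (F n x))\<^sup>2) + 2 * (LINT x|M. (norm (G n x))\<^sup>2)) \<longlonglongrightarrow> 0"
    using tendsto_add[OF tendsto_mult_left[OF assms(3), where c = 2] tendsto_mult_left[OF assms(4), where c = 2]] by simp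
qed

lemma grad_smooth_diff:
  assumes "\<eta> \<in> smooth" "\<zeta> \<in> smooth"
  shows "grad (\<lambda>x. \<eta> x - \<zeta> x) x = grad \<eta> x - grad \<zeta> x"
proof -
  have "partial_deriv i (\<lambda>x. \<eta> x - \<zeta> x) x = partial_deriv i \<eta> x - partial_deriv i \<zeta> x" for i
    using has_derivative_diff[OF smooth_has_derivative[OF assms(1)] smooth_has_derivative[OF assms(2)]]
    by (subst partial_deriv_eq) (auto simp: partial_deriv_def)
  then show ?thesis
    by (simp add: grad_def scaleR_diff_left sum_subtractf)
qed

lemma grad_arctan:
  assumes "\<zeta> \<in> smooth"
  shows "grad (\<lambda>x. arctan (\<zeta> x)) x = inverse (1 + (\<zeta> x)\<^sup>2) *\<^sub>R grad \<zeta> x"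
  by (simp add: grad_def scaleR_sum_right
      partial_deriv_compose[OF DERIV_arctan smooth_differentiable[OF assms]])

text \<open>Both functions share \<phi>, so their difference is an H^2 limit of test functions and
  can be used for testing.\<close>

locale H2_dirichlet_pair =
  v1: H2_dirichlet \<Omega> \<phi> u1 + v2: H2_dirichlet \<Omega> \<phi> u2
  for \<Omega> :: "'a::euclidean_space set" and \<phi> u1 u2
begin

abbreviation "L \<equiv> lebesgue_on \<Omega>"
abbreviation "N1 x \<equiv> nrm (weak_grad \<Omega> u1 x)"
abbreviation "N2 x \<equiv> nrm (weak_grad \<Omega> u2 x)"
abbreviation "r1 x \<equiv> inverse (area_elem (weak_grad \<Omega> u1 x))"
abbreviation "r2 x \<equiv> inverse (area_elem (weak_grad \<Omega> u2 x))"
abbreviation "normal_dist x \<equiv> (norm (N1 x - N2 x))\<^sup>2 + (r1 x - r2 x)\<^sup>2"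

lemma finite_L: "finite_measure L"
  by (rule finite_measure_lebesgue_on_bounded[OF v1.\<Omega>])

lemma N_measurable: "N1 \<in> borel_measurable L" "N2 \<in> borel_measurable L"
  "r1 \<in> borel_measurable L" "r2 \<in> borel_measurable L"
proof -
  note [measurable] = sq_integrable_measurable[OF H2_sq_integrable(2)[OF v1.\<Omega> v1.u(1)]]
    sq_integrable_measurable[OF H2_sq_integrable(2)[OF v2.\<Omega> v2.u(1)]]
  show "N1 \<in> borel_measurable L" "N2 \<in> borel_measurable L"
    "r1 \<in> borel_measurable L" "r2 \<in> borel_measurable L"
    by measurable
qed

lemma N_diff_bounds: "norm (N1 x - N2 x) \<le> 2" "\<bar>r1 x - r2 x\<bar> \<le> 1"
  using norm_triangle_ineq4[of "N1 x" "N2 x"] norm_nrm_le_1[of "weak_grad \<Omega> u1 x"]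
    norm_nrm_le_1[of "weak_grad \<Omega> u2 x"]
    inverse_area_elem_bounds[of "weak_grad \<Omega> u1 x"] inverse_area_elem_bounds[of "weak_grad \<Omega> u2 x"]
  by (linarith, linarith)

lemma N_diff_sq_integrable:
  "sq_integrable L (\<lambda>x. N1 x - N2 x)" "sq_integrable L (\<lambda>x. r1 x - r2 x)"
proof -
  interpret finite_measure L by (rule finite_L)
  note [measurable] = N_measurable
  show "sq_integrable L (\<lambda>x. N1 x - N2 x)"
    by (rule sq_integrable_bounded[of _ 2]) (use N_diff_bounds in auto)
  show "sq_integrable L (\<lambda>x. r1 x - r2 x)"
    by (rule sq_integrable_bounded[of _ 1]) (use N_diff_bounds in auto)
qed

lemma normal_dist_integrable: "integrable L normal_dist"
  using N_diff_sq_integrable by (auto simp: sq_integrable_def)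

text \<open>The bound is 2^2 + 1^2: two vectors of the unit ball and two numbers between 0 and
  1.\<close>

lemma normal_dist_le: "normal_dist x \<le> 5"
  using power_mono[OF N_diff_bounds(1)[of x], of 2] power_mono[OF N_diff_bounds(2)[of x], of 2] by simp

text \<open>The two curvature identities are subtracted and tested with arctan of a test function
  close to \<open>w\<close>. Convergence of that test function and of its gradient in L^2 then gives
  the identity for \<open>w\<close> itself.\<close>

lemma weak_form_arctan:
  defines "w \<equiv> \<lambda>x. u1 x - u2 x"
  shows "integrable L (\<lambda>x. (N1 x - N2 x) \<bullet> (inverse (1 + (w x)\<^sup>2) *\<^sub>R (weak_grad \<Omega> u1 x - weak_grad \<Omega> u2 x)))"
    and "(LINT x|L. (N1 x - N2 x) \<bullet> (inverse (1 + (w x)\<^sup>2) *\<^sub>R (weak_grad \<Omega> u1 x - weak_grad \<Omega> u2 x)))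
      = - (LINT x|L. (mean_curv \<Omega> u1 x - mean_curv \<Omega> u2 x) * arctan (w x))"
proof -
  interpret finite_measure L by (rule finite_L)
  note \<Omega> = v1.\<Omega>
  define G where "G x = weak_grad \<Omega> u1 x - weak_grad \<Omega> u2 x" for x
  define h where "h x = mean_curv \<Omega> u1 x - mean_curv \<Omega> u2 x" for x
  have sG: "sq_integrable L G"
    unfolding G_def[abs_def] by (intro sq_integrable_diff H2_sq_integrable \<Omega> v1.u v2.u)
  have sh: "sq_integrable L h"
    unfolding h_def[abs_def] by (intro sq_integrable_diff v1.mean_curv_sq_integrable v2.mean_curv_sq_integrable)
  have sw: "sq_integrable L w"
    unfolding w_def by (intro sq_integrable_diff H2_sq_integrable \<Omega> v1.u v2.u)
  note [measurable] = N_measurable sq_integrable_measurable[OF sG] sq_integrable_measurable[OF sh]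
    sq_integrable_measurable[OF sw]
  obtain \<eta>1 :: "nat \<Rightarrow> 'a \<Rightarrow> real" where \<eta>1: "\<And>n. \<eta>1 n \<in> test_fun \<Omega>"
    "\<And>n. sq_integrable L (\<lambda>x. u1 x - (\<phi> x + \<eta>1 n x))"
    "(\<lambda>n. LINT x|L. (norm (u1 x - (\<phi> x + \<eta>1 n x)))\<^sup>2) \<longlonglongrightarrow> 0"
    "\<And>n. sq_integrable L (\<lambda>x. weak_grad \<Omega> u1 x - (grad \<phi> x + grad (\<eta>1 n) x))"
    "(\<lambda>n. LINT x|L. (norm (weak_grad \<Omega> u1 x - (grad \<phi> x + grad (\<eta>1 n) x)))\<^sup>2) \<longlonglongrightarrow> 0"
  proof (rule admissible_approx[OF \<Omega> v1.\<phi> v1.u], goal_cases)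
    case (1 \<eta>)
    show ?case by (rule 1(1)[OF 1(2-6)])
  qed
  obtain \<eta>2 :: "nat \<Rightarrow> 'a \<Rightarrow> real" where \<eta>2: "\<And>n. \<eta>2 n \<in> test_fun \<Omega>"
    "\<And>n. sq_integrable L (\<lambda>x. u2 x - (\<phi> x + \<eta>2 n x))"
    "(\<lambda>n. LINT x|L. (norm (u2 x - (\<phi> x + \<eta>2 n x)))\<^sup>2) \<longlonglongrightarrow> 0"
    "\<And>n. sq_integrable L (\<lambda>x. weak_grad \<Omega> u2 x - (grad \<phi> x + grad (\<eta>2 n) x))"
    "(\<lambda>n. LINT x|L. (norm (weak_grad \<Omega> u2 x - (grad \<phi> x + grad (\<eta>2 n) x)))\<^sup>2) \<longlonglongrightarrow> 0"
  proof (rule admissible_approx[OF \<Omega> v2.\<phi> v2.u], goal_cases)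
    case (1 \<eta>)
    show ?case by (rule 1(1)[OF 1(2-6)])
  qed
  \<comment> \<open>The boundary datum cancels, which leaves a genuine test function.\<close>
  define \<zeta> where "\<zeta> n x = \<eta>1 n x - \<eta>2 n x" for n x
  have \<zeta>: "\<zeta> n \<in> test_fun \<Omega>" for n
    unfolding \<zeta>_def[abs_def] by (intro test_fun_diff \<eta>1 \<eta>2)
  have grad\<zeta>: "grad (\<zeta> n) x = grad (\<eta>1 n) x - grad (\<eta>2 n) x" for n x
    unfolding \<zeta>_def[abs_def] by (intro grad_smooth_diff test_fun_smooth[OF \<eta>1(1)] test_fun_smooth[OF \<eta>2(1)])
  have ew: "w x - \<zeta> n x = (u1 x - (\<phi> x + \<eta>1 n x)) - (u2 x - (\<phi> x + \<eta>2 n x))" for n x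
    by (simp add: w_def \<zeta>_def)
  have eG: "G x - grad (\<zeta> n) x = (weak_grad \<Omega> u1 x - (grad \<phi> x + grad (\<eta>1 n) x))
      - (weak_grad \<Omega> u2 x - (grad \<phi> x + grad (\<eta>2 n) x))" for n x
    by (simp add: G_def grad\<zeta>)
  have sdw: "sq_integrable L (\<lambda>x. w x - \<zeta> n x)" for n
    unfolding ew by (intro sq_integrable_diff[OF \<eta>1(2) \<eta>2(2)])
  have ldw: "(\<lambda>n. LINT x|L. (norm (w x - \<zeta> n x))\<^sup>2) \<longlonglongrightarrow> 0"
    unfolding ew by (rule tendsto_LINT_norm_sq_diff[OF \<eta>1(2) \<eta>2(2) \<eta>1(3) \<eta>2(3)])
  have sdG: "sq_integrable L (\<lambda>x. G x - grad (\<zeta> n) x)" for n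
    unfolding eG by (rule sq_integrable_diff[OF \<eta>1(4) \<eta>2(4)])
  have ldG: "(\<lambda>n. LINT x|L. (norm (G x - grad (\<zeta> n) x))\<^sup>2) \<longlonglongrightarrow> 0"
    unfolding eG by (rule tendsto_LINT_norm_sq_diff[OF \<eta>1(4) \<eta>2(4) \<eta>1(5) \<eta>2(5)])
  define X where "X n x = (N1 x - N2 x) \<bullet> (inverse (1 + (\<zeta> n x)\<^sup>2) *\<^sub>R grad (\<zeta> n) x)" for n x
  define Y where "Y x = (N1 x - N2 x) \<bullet> (inverse (1 + (w x)\<^sup>2) *\<^sub>R G x)" for x
  have inv01: "0 \<le> inverse (1 + s\<^sup>2)" "inverse (1 + s\<^sup>2) \<le> 1" for s :: real
    by (auto simp: inverse_le_1_iff)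
  have sgz: "sq_integrable L (grad (\<zeta> n))" for n
    unfolding grad_def[abs_def]
    by (intro sq_integrable_sum_Basis test_fun_sq_integrable \<Omega> test_fun_partial \<zeta>)
  note [measurable] = test_fun_measurable[OF \<zeta>] sq_integrable_measurable[OF sgz]
  have bound: "\<bar>(N1 x - N2 x) \<bullet> v\<bar> \<le> 2 * norm v" for x v
    using order_trans[OF Cauchy_Schwarz_ineq2 mult_right_mono[OF N_diff_bounds(1)[of x], of "norm v"]] by simp
  have dominated: "integrable L (\<lambda>x. (N1 x - N2 x) \<bullet> (inverse (1 + (s x)\<^sup>2) *\<^sub>R V x))"
    if "sq_integrable L V" "s \<in> borel_measurable L" for s and V :: "'a \<Rightarrow> 'a"
  proof (rule Bochner_Integration.integrable_bound)
    note [measurable] = that(2) sq_integrable_measurable[OF that(1)]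
    show "integrable L (\<lambda>x. 2 * norm (V x))"
      using sq_integrable_imp_integrable_norm[OF finite_L that(1)] by simp
    show "(\<lambda>x. (N1 x - N2 x) \<bullet> (inverse (1 + (s x)\<^sup>2) *\<^sub>R V x)) \<in> borel_measurable L"
      by measurable
    show "AE x in L. norm ((N1 x - N2 x) \<bullet> (inverse (1 + (s x)\<^sup>2) *\<^sub>R V x)) \<le> norm (2 * norm (V x))"
    proof (rule AE_I2)
      fix x
      have "\<bar>(N1 x - N2 x) \<bullet> (inverse (1 + (s x)\<^sup>2) *\<^sub>R V x)\<bar> \<le> 2 * (inverse (1 + (s x)\<^sup>2) * norm (V x))"
        using bound[of x "inverse (1 + (s x)\<^sup>2) *\<^sub>R V x"] inv01 by simp
      also have "\<dots> \<le> 2 * (1 * norm (V x))"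
        using inv01[of "s x"] by (intro mult_left_mono mult_right_mono) auto
      finally show "norm ((N1 x - N2 x) \<bullet> (inverse (1 + (s x)\<^sup>2) *\<^sub>R V x)) \<le> norm (2 * norm (V x))"
        by simp
    qed
  qed
  have iX: "integrable L (X n)" for n
    unfolding X_def[abs_def] by (intro dominated sgz) measurable
  show iY': "integrable L (\<lambda>x. (N1 x - N2 x) \<bullet> (inverse (1 + (w x)\<^sup>2) *\<^sub>R (weak_grad \<Omega> u1 x - weak_grad \<Omega> u2 x)))"
    unfolding G_def[symmetric] by (intro dominated sG) measurable
  then have iY: "integrable L Y"
    by (simp add: Y_def[abs_def] G_def)
  have XY: "(\<lambda>n. LINT x|L. X n x) \<longlonglongrightarrow> (LINT x|L. Y x)"
  proof (rule tendsto_integral_of_bound[where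
        b = "\<lambda>n x. 2 * norm (G x - grad (\<zeta> n) x) + 2 * (norm (w x - \<zeta> n x) * norm (G x))", OF iX iY])
    show "integrable L (\<lambda>x. 2 * norm (G x - grad (\<zeta> n) x) + 2 * (norm (w x - \<zeta> n x) * norm (G x)))" for n
      by (intro Bochner_Integration.integrable_add integrable_mult_right sq_integrable_mult
          sq_integrable_imp_integrable_norm finite_L sdG sdw sG)
    show "AE x in L. \<bar>X n x - Y x\<bar> \<le> 2 * norm (G x - grad (\<zeta> n) x) + 2 * (norm (w x - \<zeta> n x) * norm (G x))" for n
    proof (rule AE_I2)
      fix x
      let ?i = "\<lambda>s::real. inverse (1 + s\<^sup>2)"
      \<comment> \<open>The splitting lets the difference of weights meet the fixed field
        \<open>G\<close>, while the vanishing gradient error meets a weight bounded by 1.\<close>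
      have "?i (\<zeta> n x) *\<^sub>R grad (\<zeta> n) x - ?i (w x) *\<^sub>R G x
          = (?i (\<zeta> n x) - ?i (w x)) *\<^sub>R G x - ?i (\<zeta> n x) *\<^sub>R (G x - grad (\<zeta> n) x)"
        by (simp add: algebra_simps)
      also have "norm \<dots> \<le> \<bar>w x - \<zeta> n x\<bar> * norm (G x) + 1 * norm (G x - grad (\<zeta> n) x)"
      proof (rule order_trans[OF norm_triangle_ineq4 add_mono])
        show "norm ((?i (\<zeta> n x) - ?i (w x)) *\<^sub>R G x) \<le> \<bar>w x - \<zeta> n x\<bar> * norm (G x)"
          unfolding norm_scaleR using inverse_one_plus_sq_diff_le[of "\<zeta> n x" "w x"]
          by (intro mult_right_mono) (auto simp: abs_minus_commute)
        show "norm (?i (\<zeta> n x) *\<^sub>R (G x - grad (\<zeta> n) x)) \<le> 1 * norm (G x - grad (\<zeta> n) x)"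
          unfolding norm_scaleR using inv01[of "\<zeta> n x"] by (intro mult_right_mono) auto
      qed
      finally have "2 * norm (?i (\<zeta> n x) *\<^sub>R grad (\<zeta> n) x - ?i (w x) *\<^sub>R G x)
          \<le> 2 * norm (G x - grad (\<zeta> n) x) + 2 * (norm (w x - \<zeta> n x) * norm (G x))"
        by simp
      then show "\<bar>X n x - Y x\<bar> \<le> 2 * norm (G x - grad (\<zeta> n) x) + 2 * (norm (w x - \<zeta> n x) * norm (G x))"
        using bound[of x "?i (\<zeta> n x) *\<^sub>R grad (\<zeta> n) x - ?i (w x) *\<^sub>R G x"]
        unfolding X_def Y_def inner_diff_right by linarith
    qed
    have "(LINT x|L. 2 * norm (G x - grad (\<zeta> n) x) + 2 * (norm (w x - \<zeta> n x) * norm (G x)))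
        = 2 * (LINT x|L. norm (G x - grad (\<zeta> n) x)) + 2 * (LINT x|L. norm (w x - \<zeta> n x) * norm (G x))" for n
      using sq_integrable_imp_integrable_norm[OF finite_L sdG[of n]] sq_integrable_mult[OF sdw[of n] sG]
      by simp
    then show "(\<lambda>n. LINT x|L. 2 * norm (G x - grad (\<zeta> n) x) + 2 * (norm (w x - \<zeta> n x) * norm (G x))) \<longlonglongrightarrow> 0"
      using tendsto_add[OF tendsto_mult_left[OF tendsto_LINT_norm[OF finite_L sdG ldG], where c = 2]
          tendsto_mult_left[OF tendsto_integral_norm_mult[OF sdw sG ldw], where c = 2]] by simp
  qed
  have arctan2: "\<bar>arctan s\<bar> \<le> 2" for s
    using arctan_bounded[of s] pi_less_4 by auto
  have int_harctan: "integrable L (\<lambda>x. h x * arctan (s x))" if [measurable]: "s \<in> borel_measurable L" for s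
    by (intro sq_integrable_mult_real sh sq_integrable_bounded[of _ 2]) (auto simp: arctan2)
  have rhs: "(\<lambda>n. LINT x|L. h x * arctan (\<zeta> n x)) \<longlonglongrightarrow> (LINT x|L. h x * arctan (w x))"
  proof (rule tendsto_integral_of_bound[where b = "\<lambda>n x. norm (w x - \<zeta> n x) * norm (h x)"])
    show "AE x in L. \<bar>h x * arctan (\<zeta> n x) - h x * arctan (w x)\<bar> \<le> norm (w x - \<zeta> n x) * norm (h x)" for n
    proof (rule AE_I2)
      fix x
      have "\<bar>h x\<bar> * \<bar>arctan (\<zeta> n x) - arctan (w x)\<bar> \<le> \<bar>h x\<bar> * \<bar>\<zeta> n x - w x\<bar>"
        by (intro mult_left_mono arctan_diff_le) auto
      then show "\<bar>h x * arctan (\<zeta> n x) - h x * arctan (w x)\<bar> \<le> norm (w x - \<zeta> n x) * norm (h x)"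
        by (simp add: right_diff_distrib[symmetric] abs_mult abs_minus_commute mult.commute)
    qed
    show "(\<lambda>n. LINT x|L. norm (w x - \<zeta> n x) * norm (h x)) \<longlonglongrightarrow> 0"
      by (rule tendsto_integral_norm_mult[OF sdw sh ldw])
    show "integrable L (\<lambda>x. norm (w x - \<zeta> n x) * norm (h x))" for n
      by (rule sq_integrable_mult[OF sdw sh])
  qed (auto intro!: int_harctan)
  have "(LINT x|L. X n x) = - (LINT x|L. h x * arctan (\<zeta> n x))" for n
  proof -
    have t: "(\<lambda>x. arctan (\<zeta> n x)) \<in> test_fun \<Omega>"
      by (rule test_fun_arctan[OF \<zeta>])
    have st: "sq_integrable L (grad (\<lambda>x. arctan (\<zeta> n x)))"
      unfolding grad_def[abs_def]
      by (intro sq_integrable_sum_Basis test_fun_sq_integrable \<Omega> test_fun_partial t)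
    have int_N: "integrable L (\<lambda>x. nrm (weak_grad \<Omega> v x) \<bullet> grad (\<lambda>x. arctan (\<zeta> n x)) x)"
      if "(\<lambda>x. nrm (weak_grad \<Omega> v x)) \<in> borel_measurable L" for v
    proof (rule Bochner_Integration.integrable_bound[OF sq_integrable_imp_integrable_norm[OF finite_L st]])
      note [measurable] = that sq_integrable_measurable[OF st]
      show "(\<lambda>x. nrm (weak_grad \<Omega> v x) \<bullet> grad (\<lambda>x. arctan (\<zeta> n x)) x) \<in> borel_measurable L"
        by measurable
      show "AE x in L. norm (nrm (weak_grad \<Omega> v x) \<bullet> grad (\<lambda>x. arctan (\<zeta> n x)) x)
          \<le> norm (norm (grad (\<lambda>x. arctan (\<zeta> n x)) x))"
        by (simp add: abs_nrm_inner_le)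
    qed
    have int_h: "integrable L (\<lambda>x. mean_curv \<Omega> u1 x * arctan (\<zeta> n x))"
      "integrable L (\<lambda>x. mean_curv \<Omega> u2 x * arctan (\<zeta> n x))"
      by (intro sq_integrable_mult_real v1.mean_curv_sq_integrable v2.mean_curv_sq_integrable
          test_fun_sq_integrable \<Omega> t)+
    have "(LINT x|L. X n x) = (LINT x|L. N1 x \<bullet> grad (\<lambda>x. arctan (\<zeta> n x)) x - N2 x \<bullet> grad (\<lambda>x. arctan (\<zeta> n x)) x)"
      by (simp only: X_def grad_arctan[OF test_fun_smooth[OF \<zeta>]] inner_diff_left)
    also have "\<dots> = (LINT x|L. N1 x \<bullet> grad (\<lambda>x. arctan (\<zeta> n x)) x) - (LINT x|L. N2 x \<bullet> grad (\<lambda>x. arctan (\<zeta> n x)) x)"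
      by (intro Bochner_Integration.integral_diff int_N N_measurable)
    also have "\<dots> = - ((LINT x|L. mean_curv \<Omega> u1 x * arctan (\<zeta> n x)) - (LINT x|L. mean_curv \<Omega> u2 x * arctan (\<zeta> n x)))"
      by (simp add: v1.integral_nrm_grad[OF t] v2.integral_nrm_grad[OF t])
    also have "\<dots> = - (LINT x|L. h x * arctan (\<zeta> n x))"
      using int_h by (simp add: h_def left_diff_distrib)
    finally show ?thesis .
  qed
  then have "(\<lambda>n. LINT x|L. X n x) \<longlonglongrightarrow> - (LINT x|L. h x * arctan (w x))"
    using tendsto_minus[OF rhs] by simp
  from LIMSEQ_unique[OF XY this]
  show "(LINT x|L. (N1 x - N2 x) \<bullet> (inverse (1 + (w x)\<^sup>2) *\<^sub>R (weak_grad \<Omega> u1 x - weak_grad \<Omega> u2 x)))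
      = - (LINT x|L. (mean_curv \<Omega> u1 x - mean_curv \<Omega> u2 x) * arctan (w x))"
    by (simp add: Y_def G_def h_def)
qed

end

context H2_dirichlet_pair
begin

text \<open>Monotonicity bounds the weighted squared distance of normals by the tested integrand,
  the missing part of the weight costs a multiple of |w|, and Cauchy-Schwarz treats curvature times
  arctan w.\<close>

lemma normal_dist_estimate:
  defines "\<delta> \<equiv> LINT x|L. \<bar>u1 x - u2 x\<bar>"
  shows "(LINT x|L. normal_dist x)
    \<le> (sqrt (LINT x|L. (mean_curv \<Omega> u1 x)\<^sup>2) + sqrt (LINT x|L. (mean_curv \<Omega> u2 x)\<^sup>2)) * sqrt (2 * \<delta>) + 3 * \<delta>"
proof -
  interpret finite_measure L by (rule finite_L)
  note \<Omega> = v1.\<Omega>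
  define w where "w x = u1 x - u2 x" for x
  let ?h1 = "mean_curv \<Omega> u1" and ?h2 = "mean_curv \<Omega> u2"
  let ?Y = "\<lambda>x. (N1 x - N2 x) \<bullet> (inverse (1 + (w x)\<^sup>2) *\<^sub>R (weak_grad \<Omega> u1 x - weak_grad \<Omega> u2 x))"
  note weak = weak_form_arctan[folded w_def]
  have sw: "sq_integrable L w"
    unfolding w_def[abs_def] by (intro sq_integrable_diff H2_sq_integrable \<Omega> v1.u v2.u)
  have iw: "integrable L (\<lambda>x. \<bar>w x\<bar>)"
    using sq_integrable_imp_integrable_norm[OF finite_L sw] by simp
  note [measurable] = sq_integrable_measurable[OF sw]
  have arctan2: "\<bar>arctan s\<bar> \<le> 2" for s
    using arctan_bounded[of s] pi_less_4 by auto
  have sa: "sq_integrable L (\<lambda>x. arctan (w x))"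
    by (rule sq_integrable_bounded[of _ 2]) (auto simp: arctan2)
  have sh: "sq_integrable L ?h1" "sq_integrable L ?h2"
    by (rule v1.mean_curv_sq_integrable v2.mean_curv_sq_integrable)+
  have pointwise: "normal_dist x \<le> ?Y x + 3 * \<bar>w x\<bar>" for x
  proof -
    let ?i = "inverse (1 + (w x)\<^sup>2)"
    have pos: "1 + (w x)\<^sup>2 > 0" by (rule add_pos_nonneg) auto
    have "?i * normal_dist x \<le> ?i * ((N1 x - N2 x) \<bullet> (weak_grad \<Omega> u1 x - weak_grad \<Omega> u2 x))"
      using pos by (intro mult_left_mono nrm_monotone) auto
    then have 1: "?i * normal_dist x \<le> ?Y x" by simp
    have "1 - ?i = (w x)\<^sup>2 / (1 + (w x)\<^sup>2)"
      using pos by (simp add: field_simps)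
    also have "\<dots> \<le> \<bar>w x\<bar> / 2"
    proof -
      have "(w x)\<^sup>2 \<le> \<bar>w x\<bar> * ((1 + (w x)\<^sup>2) / 2)"
        using mult_left_mono[OF abs_le_half_one_plus_sq[of "w x"], of "\<bar>w x\<bar>"] by (simp add: power2_eq_square)
      then show ?thesis using pos by (simp add: divide_le_eq)
    qed
    \<comment> \<open>The product is 5/2 times |w|, below the 3 |w| that is claimed.\<close>
    finally have "(1 - ?i) * normal_dist x \<le> (\<bar>w x\<bar> / 2) * 5"
      using normal_dist_le[of x] by (intro mult_mono) auto
    with 1 show ?thesis
      by (simp add: left_diff_distrib)
  qed
  have "(LINT x|L. normal_dist x) \<le> (LINT x|L. ?Y x + 3 * \<bar>w x\<bar>)"
    using pointwise normal_dist_integrable weak(1) iw by (intro integral_mono) auto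
  also have "\<dots> = (LINT x|L. ?Y x) + 3 * (LINT x|L. \<bar>w x\<bar>)"
    using weak(1) iw by simp
  also have "(LINT x|L. ?Y x) = (LINT x|L. ?h2 x * arctan (w x)) - (LINT x|L. ?h1 x * arctan (w x))"
    unfolding weak(2) using sq_integrable_mult_real[OF sh(1) sa] sq_integrable_mult_real[OF sh(2) sa]
    by (simp add: left_diff_distrib)
  also have "\<dots> \<le> sqrt (LINT x|L. (?h2 x)\<^sup>2) * sqrt (2 * \<delta>) + sqrt (LINT x|L. (?h1 x)\<^sup>2) * sqrt (2 * \<delta>)"
  proof -
    have "(LINT x|L. (arctan (w x))\<^sup>2) \<le> (LINT x|L. 2 * \<bar>w x\<bar>)"
      using sa iw arctan_sq_le by (intro integral_mono) (auto simp: sq_integrable_def)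
    then have a: "sqrt (LINT x|L. (arctan (w x))\<^sup>2) \<le> sqrt (2 * \<delta>)"
      using iw by (simp add: \<delta>_def w_def)
    have "\<bar>LINT x|L. h x * arctan (w x)\<bar> \<le> sqrt (LINT x|L. (h x)\<^sup>2) * sqrt (2 * \<delta>)"
      if "sq_integrable L h" for h
    proof -
      have "\<bar>LINT x|L. h x * arctan (w x)\<bar> \<le> (LINT x|L. norm (h x) * norm (arctan (w x)))"
        using integral_abs_bound[of L "\<lambda>x. h x * arctan (w x)"] by (simp add: abs_mult)
      also have "\<dots> \<le> sqrt (LINT x|L. (norm (h x))\<^sup>2) * sqrt (LINT x|L. (norm (arctan (w x)))\<^sup>2)"
        by (rule Cauchy_Schwarz_integral[OF that sa])
      also have "\<dots> \<le> sqrt (LINT x|L. (h x)\<^sup>2) * sqrt (2 * \<delta>)"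
        using a by (simp add: mult_left_mono)
      finally show ?thesis .
    qed
    from this[OF sh(1)] this[OF sh(2)] show ?thesis by linarith
  qed
  finally show ?thesis
    by (simp add: algebra_simps \<delta>_def w_def)
qed

end

section \<open>Lower semicontinuity\<close>

definition curv_energy :: "'a::euclidean_space set \<Rightarrow> ('a \<Rightarrow> real) \<Rightarrow> ennreal" where
  "curv_energy \<Omega> u = (\<integral>\<^sup>+x. ennreal ((mean_curv \<Omega> u x)\<^sup>2 * area_elem (weak_grad \<Omega> u x)) \<partial>lebesgue_on \<Omega>)"

text \<open>The convex dual of \<open>curv_energy\<close>: for \<open>q > 0\<close>, \<open>h\<^sup>2 q\<close> is the supremum of \<open>2 h s - s\<^sup>2 / q\<close> over \<open>s\<close>.\<close>

definition dual_energy :: "'a::euclidean_space set \<Rightarrow> ('a \<Rightarrow> real) \<Rightarrow> ('a \<Rightarrow> real) \<Rightarrow> real" where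
  "dual_energy \<Omega> u s = (LINT x|lebesgue_on \<Omega>. 2 * mean_curv \<Omega> u x * s x
      - (s x)\<^sup>2 * inverse (area_elem (weak_grad \<Omega> u x)))"

text \<open>Completing the square leaves (h q - s)^2 / q. Equality at s = h q tells which functions
  have to be approximated in \<open>curv_energy_le_sup_dual\<close>.\<close>

lemma dual_le:
  fixes h s :: real
  assumes "q > 0" shows "2 * h * s - s\<^sup>2 * inverse q \<le> h\<^sup>2 * q"
proof -
  have "h\<^sup>2 * q - (2 * h * s - s\<^sup>2 * inverse q) = inverse q * (h * q - s)\<^sup>2"
    using assms by (simp add: field_simps power2_eq_square)
  also have "\<dots> \<ge> 0" using assms by simp
  finally show ?thesis by simp
qed

lemma ennreal_LINT_le_nn_integral:
  fixes f :: "'a \<Rightarrow> real"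
  assumes "integrable M f" shows "ennreal (LINT x|M. f x) \<le> (\<integral>\<^sup>+x. ennreal (f x) \<partial>M)"
proof -
  have i: "integrable M (\<lambda>x. max 0 (f x))" using assms by simp
  have "(LINT x|M. f x) \<le> (LINT x|M. max 0 (f x))"
    using assms i by (intro integral_mono) auto
  then have "ennreal (LINT x|M. f x) \<le> ennreal (LINT x|M. max 0 (f x))"
    by (rule ennreal_leI)
  also have "\<dots> = (\<integral>\<^sup>+x. ennreal (max 0 (f x)) \<partial>M)"
    using i by (intro nn_integral_eq_integral[symmetric]) auto
  also have "\<dots> = (\<integral>\<^sup>+x. ennreal (f x) \<partial>M)"
    by (intro nn_integral_cong) (auto simp: max_def ennreal_neg)
  finally show ?thesis .
qed

section \<open>Dual description of the energy of a single function\<close>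

context H2_dirichlet
begin

lemma inverse_area_elem_measurable:
  "(\<lambda>x. inverse (area_elem (weak_grad \<Omega> u x))) \<in> borel_measurable (lebesgue_on \<Omega>)"
proof -
  note [measurable] = sq_integrable_measurable[OF H2_sq_integrable(2)[OF \<Omega> u(1)]]
  show ?thesis by measurable
qed

lemma dual_integrable:
  assumes "s \<in> borel_measurable (lebesgue_on \<Omega>)" "\<And>x. x \<in> \<Omega> \<Longrightarrow> \<bar>s x\<bar> \<le> C"
  shows "integrable (lebesgue_on \<Omega>) (\<lambda>x. mean_curv \<Omega> u x * s x)"
    and "integrable (lebesgue_on \<Omega>) (\<lambda>x. (s x)\<^sup>2 * inverse (area_elem (weak_grad \<Omega> u x)))"
proof -
  interpret finite_measure "lebesgue_on \<Omega>"
    by (rule finite_measure_lebesgue_on_bounded[OF \<Omega>])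
  have s: "sq_integrable (lebesgue_on \<Omega>) s"
    using assms by (intro sq_integrable_bounded[of _ C]) auto
  show "integrable (lebesgue_on \<Omega>) (\<lambda>x. mean_curv \<Omega> u x * s x)"
    by (rule sq_integrable_mult_real[OF mean_curv_sq_integrable s])
  have "sq_integrable (lebesgue_on \<Omega>) (\<lambda>x. s x * inverse (area_elem (weak_grad \<Omega> u x)))"
  proof (rule sq_integrable_bound[OF s, of _ 1])
    show "(\<lambda>x. s x * inverse (area_elem (weak_grad \<Omega> u x))) \<in> borel_measurable (lebesgue_on \<Omega>)"
      by (rule borel_measurable_times[OF assms(1) inverse_area_elem_measurable])
    have "\<bar>s x\<bar> * \<bar>inverse (area_elem (weak_grad \<Omega> u x))\<bar> \<le> \<bar>s x\<bar> * 1" for x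
      using inverse_area_elem_bounds[of "weak_grad \<Omega> u x"] by (intro mult_left_mono) auto
    then show "AE x in lebesgue_on \<Omega>. norm (s x * inverse (area_elem (weak_grad \<Omega> u x))) \<le> 1 * norm (s x)"
      by (simp only: real_norm_def abs_mult mult_1 mult_1_right) simp
  qed
  from sq_integrable_mult_real[OF s this]
  show "integrable (lebesgue_on \<Omega>) (\<lambda>x. (s x)\<^sup>2 * inverse (area_elem (weak_grad \<Omega> u x)))"
    by (simp add: power2_eq_square mult.assoc)
qed

lemma dual_energy_le_curv_energy:
  assumes "\<eta> \<in> test_fun \<Omega>" shows "ennreal (dual_energy \<Omega> u \<eta>) \<le> curv_energy \<Omega> u"
proof -
  obtain C where C: "\<And>x. \<bar>\<eta> x\<bar> \<le> C" using test_fun_bounded[OF assms] by blast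
  note i = dual_integrable[OF test_fun_measurable[OF assms] C]
  have "integrable (lebesgue_on \<Omega>) (\<lambda>x. 2 * (mean_curv \<Omega> u x * \<eta> x)
      - (\<eta> x)\<^sup>2 * inverse (area_elem (weak_grad \<Omega> u x)))"
    by (intro Bochner_Integration.integrable_diff integrable_mult_right i)
  then have "ennreal (dual_energy \<Omega> u \<eta>) \<le> (\<integral>\<^sup>+x. ennreal (2 * mean_curv \<Omega> u x * \<eta> x
      - (\<eta> x)\<^sup>2 * inverse (area_elem (weak_grad \<Omega> u x))) \<partial>lebesgue_on \<Omega>)"
    unfolding dual_energy_def by (intro ennreal_LINT_le_nn_integral) (simp add: mult.assoc)
  also have "\<dots> \<le> curv_energy \<Omega> u"
    unfolding curv_energy_def by (intro nn_integral_mono ennreal_leI dual_le area_elem_pos)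
  finally show ?thesis .
qed

lemma dual_energy_test_fun:
  assumes "\<eta> \<in> test_fun \<Omega>"
  shows "dual_energy \<Omega> u \<eta> = - 2 * (LINT x|lebesgue_on \<Omega>. nrm (weak_grad \<Omega> u x) \<bullet> grad \<eta> x)
    - (LINT x|lebesgue_on \<Omega>. (\<eta> x)\<^sup>2 * inverse (area_elem (weak_grad \<Omega> u x)))"
proof -
  obtain C where C: "\<And>x. \<bar>\<eta> x\<bar> \<le> C" using test_fun_bounded[OF assms] by blast
  note i = dual_integrable[OF test_fun_measurable[OF assms] C]
  have "dual_energy \<Omega> u \<eta> = (LINT x|lebesgue_on \<Omega>. 2 * (mean_curv \<Omega> u x * \<eta> x)
      - (\<eta> x)\<^sup>2 * inverse (area_elem (weak_grad \<Omega> u x)))"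
    by (simp add: dual_energy_def mult.assoc)
  also have "\<dots> = (LINT x|lebesgue_on \<Omega>. 2 * (mean_curv \<Omega> u x * \<eta> x))
      - (LINT x|lebesgue_on \<Omega>. (\<eta> x)\<^sup>2 * inverse (area_elem (weak_grad \<Omega> u x)))"
    by (intro Bochner_Integration.integral_diff integrable_mult_right i)
  finally show ?thesis
    by (simp add: integral_nrm_grad[OF assms])
qed

text \<open>The area element is at least 1. This turns an energy bound into the curvature bound that
  \<open>normal_dist_estimate\<close> requires.\<close>

lemma curv_energy_ge_L2:
  "ennreal (LINT x|lebesgue_on \<Omega>. (mean_curv \<Omega> u x)\<^sup>2) \<le> curv_energy \<Omega> u"
proof -
  have "ennreal (LINT x|lebesgue_on \<Omega>. (mean_curv \<Omega> u x)\<^sup>2)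
      \<le> (\<integral>\<^sup>+x. ennreal ((mean_curv \<Omega> u x)\<^sup>2) \<partial>lebesgue_on \<Omega>)"
    using mean_curv_sq_integrable by (intro ennreal_LINT_le_nn_integral) (simp add: sq_integrable_def)
  also have "\<dots> \<le> curv_energy \<Omega> u"
    unfolding curv_energy_def
    using mult_left_mono[OF area_elem_ge_1, of "(mean_curv \<Omega> u _)\<^sup>2"]
    by (intro nn_integral_mono ennreal_leI) simp
  finally show ?thesis .
qed

text \<open>The pointwise maximiser h q need be neither bounded nor smooth. Truncation and monotone
  convergence make it bounded without presupposing finite energy; bounded approximation by test
  functions does the rest.\<close>

lemma curv_energy_le_sup_dual:
  assumes "z < curv_energy \<Omega> u"
  obtains \<eta> where "\<eta> \<in> test_fun \<Omega>" "z < ennreal (dual_energy \<Omega> u \<eta>)"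
proof -
  let ?L = "lebesgue_on \<Omega>"
  interpret finite_measure ?L by (rule finite_measure_lebesgue_on_bounded[OF \<Omega>])
  define h where "h = mean_curv \<Omega> u"
  define q where "q x = area_elem (weak_grad \<Omega> u x)" for x
  have sh: "sq_integrable ?L h"
    unfolding h_def by (rule mean_curv_sq_integrable)
  note [measurable] = sq_integrable_measurable[OF sh]
    sq_integrable_measurable[OF H2_sq_integrable(2)[OF \<Omega> u(1)]]
  have [measurable]: "q \<in> borel_measurable ?L"
    unfolding q_def[abs_def] by measurable
  have q: "q x > 0" "0 \<le> inverse (q x)" "inverse (q x) \<le> 1" for x
    using area_elem_pos inverse_area_elem_bounds[of "weak_grad \<Omega> u x"] by (auto simp: q_def less_imp_le)
  \<comment> \<open>Large values are replaced by 0 and not clipped: the dual integrand then equals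
    h^2 q or 0, so it is nonnegative and increasing in m.\<close>
  define g where "g m x = (if \<bar>h x * q x\<bar> \<le> real m then h x * q x else 0)" for m x
  have gm: "g m \<in> borel_measurable ?L" for m
    unfolding g_def[abs_def] by measurable
  have gb: "\<bar>g m x\<bar> \<le> real m" for m x
    by (simp add: g_def)
  have hg: "2 * h x * g m x - (g m x)\<^sup>2 * inverse (q x) = (if \<bar>h x * q x\<bar> \<le> real m then (h x)\<^sup>2 * q x else 0)" for m x
    using q(1)[of x] by (simp add: g_def power2_eq_square field_simps)
  define e where "e m x = ennreal (if \<bar>h x * q x\<bar> \<le> real m then (h x)\<^sup>2 * q x else 0)" for m x
  have "incseq e"
    unfolding e_def by (auto simp: incseq_def le_fun_def intro!: ennreal_leI mult_nonneg_nonneg less_imp_le[OF q(1)])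
  moreover have "e m \<in> borel_measurable ?L" for m
    unfolding e_def[abs_def] by measurable
  ultimately have "(\<lambda>m. \<integral>\<^sup>+x. e m x \<partial>?L) \<longlonglongrightarrow> (\<integral>\<^sup>+x. (SUP m. e m x) \<partial>?L)"
    by (simp add: nn_integral_monotone_convergence_SUP LIMSEQ_SUP incseq_def le_fun_def nn_integral_mono)
  moreover have "(SUP m. e m x) = ennreal ((h x)\<^sup>2 * q x)" for x
  proof (rule antisym)
    show "(SUP m. e m x) \<le> ennreal ((h x)\<^sup>2 * q x)"
      by (intro SUP_least) (auto simp: e_def)
    obtain m where "\<bar>h x * q x\<bar> \<le> real m" using real_arch_simple by blast
    then have "e m x = ennreal ((h x)\<^sup>2 * q x)" by (simp add: e_def)
    then show "ennreal ((h x)\<^sup>2 * q x) \<le> (SUP m. e m x)"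
      by (metis SUP_upper UNIV_I)
  qed
  ultimately have "(\<lambda>m. \<integral>\<^sup>+x. e m x \<partial>?L) \<longlonglongrightarrow> curv_energy \<Omega> u"
    by (simp add: curv_energy_def h_def q_def)
  from order_tendstoD(1)[OF this assms] obtain m where m: "z < (\<integral>\<^sup>+x. e m x \<partial>?L)"
    by (meson eventually_sequentially order_refl)
  obtain \<eta> where \<eta>: "\<And>n. \<eta> n \<in> test_fun \<Omega>" "\<And>n x. x \<in> \<Omega> \<Longrightarrow> \<bar>\<eta> n x\<bar> \<le> real m + 1"
      "AE x in ?L. (\<lambda>n. \<eta> n x) \<longlonglongrightarrow> g m x"
    using exists_test_fun_approx[OF \<Omega> gm gb] by blast
  let ?J = "\<lambda>s x. 2 * h x * s x - (s x)\<^sup>2 * inverse (q x)"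
  have iJ: "integrable ?L (?J s)" if "s \<in> borel_measurable ?L" "\<And>x. x \<in> \<Omega> \<Longrightarrow> \<bar>s x\<bar> \<le> C" for s C
    using dual_integrable[OF that] unfolding h_def q_def
    by (simp add: mult.assoc)
  \<comment> \<open>The majorant is integrable because \<open>h\<close> is square integrable on a
    set of finite measure and \<open>inverse (q x)\<close> is at most 1.\<close>
  have "(\<lambda>n. LINT x|?L. ?J (\<eta> n) x) \<longlonglongrightarrow> (LINT x|?L. ?J (g m) x)"
  proof (rule integral_dominated_convergence[where w = "\<lambda>x. 2 * \<bar>h x\<bar> * (real m + 1) + (real m + 1)\<^sup>2"])
    note [measurable] = gm test_fun_measurable[OF \<eta>(1)]
    show "?J (g m) \<in> borel_measurable ?L" "?J (\<eta> n) \<in> borel_measurable ?L" for n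
      by measurable
    show "integrable ?L (\<lambda>x. 2 * \<bar>h x\<bar> * (real m + 1) + (real m + 1)\<^sup>2)"
      using sq_integrable_imp_integrable_norm[OF _ sh] finite_measure_axioms by simp
    show "AE x in ?L. (\<lambda>n. ?J (\<eta> n) x) \<longlonglongrightarrow> ?J (g m) x"
      using \<eta>(3) by eventually_elim (intro tendsto_intros)
    show "AE x in ?L. norm (?J (\<eta> n) x) \<le> 2 * \<bar>h x\<bar> * (real m + 1) + (real m + 1)\<^sup>2" for n
    proof (rule AE_I2)
      fix x assume "x \<in> space ?L"
      then have b: "\<bar>\<eta> n x\<bar> \<le> real m + 1" using \<eta>(2) by simp
      have "\<bar>2 * h x * \<eta> n x\<bar> \<le> 2 * \<bar>h x\<bar> * (real m + 1)"
        using mult_left_mono[OF b, of "2 * \<bar>h x\<bar>"] by (simp add: abs_mult)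
      moreover have "\<bar>(\<eta> n x)\<^sup>2 * inverse (q x)\<bar> \<le> (real m + 1)\<^sup>2 * 1"
        unfolding abs_mult using power_mono[OF b, of 2] q[of x] by (intro mult_mono) auto
      ultimately show "norm (?J (\<eta> n) x) \<le> 2 * \<bar>h x\<bar> * (real m + 1) + (real m + 1)\<^sup>2"
        by simp
    qed
  qed
  then have "(\<lambda>n. ennreal (dual_energy \<Omega> u (\<eta> n))) \<longlonglongrightarrow> ennreal (LINT x|?L. ?J (g m) x)"
    unfolding dual_energy_def h_def q_def by (intro tendsto_ennrealI)
  moreover have "ennreal (LINT x|?L. ?J (g m) x) = (\<integral>\<^sup>+x. e m x \<partial>?L)"
    unfolding e_def hg[symmetric]
    using iJ[OF gm gb] q by (intro nn_integral_eq_integral[symmetric]) (auto simp: hg less_imp_le)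
  ultimately have "(\<lambda>n. ennreal (dual_energy \<Omega> u (\<eta> n))) \<longlonglongrightarrow> (\<integral>\<^sup>+x. e m x \<partial>?L)"
    by simp
  from order_tendstoD(1)[OF this m] obtain n where "z < ennreal (dual_energy \<Omega> u (\<eta> n))"
    by (meson eventually_sequentially order_refl)
  with \<eta>(1) that show thesis by blast
qed

end

text \<open>For a fixed test function the dual energy is linear in the pair (N, r), so
  Cauchy-Schwarz bounds its change by the L^2 distance of the normals, with a factor that depends on
  the test function alone.\<close>

lemma (in H2_dirichlet_pair) dual_energy_diff:
  assumes \<eta>: "\<eta> \<in> test_fun \<Omega>"
  shows "dual_energy \<Omega> u2 \<eta> \<le> dual_energy \<Omega> u1 \<eta>
    + (2 * sqrt (LINT x|L. (norm (grad \<eta> x))\<^sup>2) + sqrt (LINT x|L. ((\<eta> x)\<^sup>2)\<^sup>2)) * sqrt (LINT x|L. normal_dist x)"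
proof -
  interpret finite_measure L by (rule finite_L)
  let ?E = "LINT x|L. normal_dist x"
  note \<Omega> = v1.\<Omega>
  obtain C where C: "\<And>x. \<bar>\<eta> x\<bar> \<le> C" using test_fun_bounded[OF \<eta>] by blast
  have sg: "sq_integrable L (grad \<eta>)"
    unfolding grad_def[abs_def]
    by (intro sq_integrable_sum_Basis test_fun_sq_integrable \<Omega> test_fun_partial \<eta>)
  have s2: "sq_integrable L (\<lambda>x. (\<eta> x)\<^sup>2)"
    using test_fun_sq_integrable[OF \<Omega> test_fun_mult[OF \<eta> test_fun_smooth[OF \<eta>]]] by (simp add: power2_eq_square)
  note [measurable] = sq_integrable_measurable[OF sg] N_measurable
  have iN: "integrable L (\<lambda>x. nrm (weak_grad \<Omega> v x) \<bullet> grad \<eta> x)"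
    if "(\<lambda>x. nrm (weak_grad \<Omega> v x)) \<in> borel_measurable L" for v
  proof (rule Bochner_Integration.integrable_bound[OF sq_integrable_imp_integrable_norm[OF finite_L sg]])
    note [measurable] = that
    show "(\<lambda>x. nrm (weak_grad \<Omega> v x) \<bullet> grad \<eta> x) \<in> borel_measurable L"
      by measurable
    show "AE x in L. norm (nrm (weak_grad \<Omega> v x) \<bullet> grad \<eta> x) \<le> norm (norm (grad \<eta> x))"
      by (simp add: abs_nrm_inner_le)
  qed
  have le: "(norm (N1 x - N2 x))\<^sup>2 \<le> normal_dist x" "(norm (r1 x - r2 x))\<^sup>2 \<le> normal_dist x" for x
    by auto
  have sq: "(LINT x|L. (norm (N1 x - N2 x))\<^sup>2) \<le> ?E" "(LINT x|L. (norm (r1 x - r2 x))\<^sup>2) \<le> ?E"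
    using N_diff_sq_integrable normal_dist_integrable le
    by (auto intro!: integral_mono simp: sq_integrable_def)
  have "(LINT x|L. N1 x \<bullet> grad \<eta> x) - (LINT x|L. N2 x \<bullet> grad \<eta> x)
      = (LINT x|L. (N1 x - N2 x) \<bullet> grad \<eta> x)"
    using iN[OF N_measurable(1)] iN[OF N_measurable(2)] by (simp add: inner_diff_left)
  also have "\<dots> \<le> (LINT x|L. norm (N1 x - N2 x) * norm (grad \<eta> x))"
    using iN[OF N_measurable(1)] iN[OF N_measurable(2)]
    by (intro integral_mono sq_integrable_mult N_diff_sq_integrable sg norm_cauchy_schwarz)
      (simp add: inner_diff_left)
  also have "\<dots> \<le> sqrt (LINT x|L. (norm (N1 x - N2 x))\<^sup>2) * sqrt (LINT x|L. (norm (grad \<eta> x))\<^sup>2)"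
    by (rule Cauchy_Schwarz_integral[OF N_diff_sq_integrable(1) sg])
  also have "\<dots> \<le> sqrt ?E * sqrt (LINT x|L. (norm (grad \<eta> x))\<^sup>2)"
    using sq(1) by (intro mult_right_mono) auto
  finally have 1: "(LINT x|L. N1 x \<bullet> grad \<eta> x) - (LINT x|L. N2 x \<bullet> grad \<eta> x)
      \<le> sqrt ?E * sqrt (LINT x|L. (norm (grad \<eta> x))\<^sup>2)" .
  note i = v1.dual_integrable(2)[OF test_fun_measurable[OF \<eta>] C] v2.dual_integrable(2)[OF test_fun_measurable[OF \<eta>] C]
  have "(LINT x|L. (\<eta> x)\<^sup>2 * r1 x) - (LINT x|L. (\<eta> x)\<^sup>2 * r2 x) = (LINT x|L. (\<eta> x)\<^sup>2 * r1 x - (\<eta> x)\<^sup>2 * r2 x)"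
    using i by simp
  also have "\<dots> \<le> (LINT x|L. norm (r1 x - r2 x) * norm ((\<eta> x)\<^sup>2))"
  proof (intro integral_mono Bochner_Integration.integrable_diff i sq_integrable_mult N_diff_sq_integrable s2)
    fix x
    have "(\<eta> x)\<^sup>2 * (r1 x - r2 x) \<le> (\<eta> x)\<^sup>2 * \<bar>r1 x - r2 x\<bar>"
      by (intro mult_left_mono) auto
    then show "(\<eta> x)\<^sup>2 * r1 x - (\<eta> x)\<^sup>2 * r2 x \<le> norm (r1 x - r2 x) * norm ((\<eta> x)\<^sup>2)"
      by (simp add: right_diff_distrib mult.commute)
  qed
  also have "\<dots> \<le> sqrt (LINT x|L. (norm (r1 x - r2 x))\<^sup>2) * sqrt (LINT x|L. (norm ((\<eta> x)\<^sup>2))\<^sup>2)"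
    by (rule Cauchy_Schwarz_integral[OF N_diff_sq_integrable(2) s2])
  also have "\<dots> \<le> sqrt ?E * sqrt (LINT x|L. ((\<eta> x)\<^sup>2)\<^sup>2)"
    unfolding real_norm_def power2_abs using sq(2) by (intro mult_right_mono) auto
  finally have 2: "(LINT x|L. (\<eta> x)\<^sup>2 * r1 x) - (LINT x|L. (\<eta> x)\<^sup>2 * r2 x) \<le> sqrt ?E * sqrt (LINT x|L. ((\<eta> x)\<^sup>2)\<^sup>2)" .
  show ?thesis
    using 1 2 by (simp add: v1.dual_energy_test_fun[OF \<eta>] v2.dual_energy_test_fun[OF \<eta>] algebra_simps)
qed

text \<open>A test function whose dual energy exceeds \<open>z\<close> is fixed. Its dual energy at
  \<open>U k\<close> is almost as large once the normals are close, and it bounds the energy of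
  \<open>U k\<close> from below.\<close>

lemma curv_energy_lower_semicontinuous:
  fixes \<Omega> :: "'a::euclidean_space set"
  assumes u: "H2_dirichlet \<Omega> \<phi> u" and U: "\<And>k. H2_dirichlet \<Omega> \<phi> (U k)"
    and lim: "(\<lambda>k. LINT x|lebesgue_on \<Omega>. \<bar>U k x - u x\<bar>) \<longlonglongrightarrow> 0"
    and z: "z < curv_energy \<Omega> u"
  shows "\<forall>\<^sub>F k in sequentially. z < curv_energy \<Omega> (U k)"
proof -
  let ?L = "lebesgue_on \<Omega>"
  interpret u: H2_dirichlet \<Omega> \<phi> u by (rule u)
  obtain \<eta> where \<eta>: "\<eta> \<in> test_fun \<Omega>" "z < ennreal (dual_energy \<Omega> u \<eta>)"
    using u.curv_energy_le_sup_dual[OF z] by blast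
  define J where "J = dual_energy \<Omega> u \<eta>"
  obtain b where b: "z = ennreal b" "b \<ge> 0"
    using z by (cases z) auto
  have bJ: "b < J"
    using \<eta>(2) b by (simp add: J_def ennreal_less_iff)
  define c where "c = 2 * sqrt (LINT x|?L. (norm (grad \<eta> x))\<^sup>2) + sqrt (LINT x|?L. ((\<eta> x)\<^sup>2)\<^sup>2)"
  have c: "c \<ge> 0" by (simp add: c_def)
  define H where "H = sqrt (LINT x|?L. (mean_curv \<Omega> u x)\<^sup>2)"
  define \<delta> where "\<delta> k = (LINT x|?L. \<bar>U k x - u x\<bar>)" for k
  \<comment> \<open>An explicit lower bound for the dual energy of those \<open>U k\<close> whose
    energy is at most \<open>b\<close>; it depends on k only through the L^1 distance.\<close>
  have "(\<lambda>k. J - c * sqrt ((sqrt b + H) * sqrt (2 * \<delta> k) + 3 * \<delta> k))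
      \<longlonglongrightarrow> J - c * sqrt ((sqrt b + H) * sqrt (2 * 0) + 3 * 0)"
    unfolding \<delta>_def by (intro tendsto_intros lim)
  then have "(\<lambda>k. J - c * sqrt ((sqrt b + H) * sqrt (2 * \<delta> k) + 3 * \<delta> k)) \<longlonglongrightarrow> J"
    by simp
  from order_tendstoD(1)[OF this bJ] show ?thesis
  proof eventually_elim
    case (elim k)
    interpret p: H2_dirichlet_pair \<Omega> \<phi> "U k" u
      by (intro H2_dirichlet_pair.intro U u)
    show ?case
    proof (rule ccontr)
      \<comment> \<open>The negation itself supplies the energy bound under which the normals of
        \<open>U k\<close> can be estimated, so no bounded subsequence has to be selected.\<close>
      assume "\<not> z < curv_energy \<Omega> (U k)"
      then have le: "curv_energy \<Omega> (U k) \<le> ennreal b"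
        using b by simp
      have "(LINT x|?L. (mean_curv \<Omega> (U k) x)\<^sup>2) \<le> b"
        using order_trans[OF p.v1.curv_energy_ge_L2 le] b(2) by (simp add: ennreal_le_iff)
      then have s: "sqrt (LINT x|?L. (mean_curv \<Omega> (U k) x)\<^sup>2) \<le> sqrt b"
        by simp
      have \<delta>0: "\<delta> k \<ge> 0" by (simp add: \<delta>_def)
      have "(LINT x|?L. p.normal_dist x) \<le> (sqrt (LINT x|?L. (mean_curv \<Omega> (U k) x)\<^sup>2) + H) * sqrt (2 * \<delta> k) + 3 * \<delta> k"
        using p.normal_dist_estimate by (simp add: H_def \<delta>_def)
      also have "\<dots> \<le> (sqrt b + H) * sqrt (2 * \<delta> k) + 3 * \<delta> k"
        using s \<delta>0 by (intro add_right_mono mult_right_mono) auto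
      finally have "c * sqrt (LINT x|?L. p.normal_dist x) \<le> c * sqrt ((sqrt b + H) * sqrt (2 * \<delta> k) + 3 * \<delta> k)"
        using c by (intro mult_left_mono real_sqrt_le_mono)
      moreover have "J \<le> dual_energy \<Omega> (U k) \<eta> + c * sqrt (LINT x|?L. p.normal_dist x)"
        using p.dual_energy_diff[OF \<eta>(1)] by (simp add: J_def c_def)
      moreover have "dual_energy \<Omega> (U k) \<eta> \<le> b"
        using order_trans[OF p.v1.dual_energy_le_curv_energy[OF \<eta>(1)] le] b(2) by (simp add: ennreal_le_iff)
      ultimately show False using elim by linarith
    qed
  qed
qed

section \<open>From the curvature energy to the relaxation\<close>

lemma (in H2_dirichlet) willmore_integral_eq:
  "(\<integral>\<^sup>+x. ennreal ((weak_div \<Omega> (\<lambda>y. weak_grad \<Omega> u y /\<^sub>R sqrt (1 + (norm (weak_grad \<Omega> u y))\<^sup>2)) x)\<^sup>2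
        * sqrt (1 + (norm (weak_grad \<Omega> u x))\<^sup>2)) \<partial>lebesgue_on \<Omega>) = curv_energy \<Omega> u"
  unfolding curv_energy_def area_elem_def[symmetric] nrm_def[symmetric]
proof (rule nn_integral_cong_AE)
  show "AE x in lebesgue_on \<Omega>.
      ennreal ((weak_div \<Omega> (\<lambda>y. nrm (weak_grad \<Omega> u y)) x)\<^sup>2 * area_elem (weak_grad \<Omega> u x))
      = ennreal ((mean_curv \<Omega> u x)\<^sup>2 * area_elem (weak_grad \<Omega> u x))"
    using weak_div_eq_mean_curv by eventually_elim simp
qed

theorem theorem4:
  fixes \<Omega> :: "(real ^ 2) set" and \<phi> :: "real ^ 2 \<Rightarrow> real"
  assumes "open \<Omega>" and "connected \<Omega>" and "\<Omega> \<noteq> {}" and "bounded \<Omega>"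
    and "C2_boundary \<Omega>"
    and "\<phi> \<in> Ck_closure 2 \<Omega>"
  shows "\<forall>u \<in> admissible \<Omega> \<phi>. willmore_relax \<Omega> \<phi> u = willmore \<Omega> u"
proof
  have dir: "H2_dirichlet \<Omega> \<phi> v" if "v \<in> admissible \<Omega> \<phi>" for v
    using assms that by (auto simp: H2_dirichlet_def admissible_def Ck_closure_def)
  have W: "willmore \<Omega> v = ennreal (1 / 4) * curv_energy \<Omega> v" if "v \<in> admissible \<Omega> \<phi>" for v
    unfolding willmore_def H2_dirichlet.willmore_integral_eq[OF dir[OF that]] ..
  \<comment> \<open>Lets a threshold y for the Willmore energy be traded for 4 y as a threshold for
    \<open>curv_energy\<close>.\<close>
  have quarter: "ennreal (1 / 4) * (ennreal 4 * y) = y" for y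
    by (simp add: mult.assoc[symmetric] ennreal_mult[symmetric] del: ennreal_numeral)
  fix u assume u_adm: "u \<in> admissible \<Omega> \<phi>"
  show "willmore_relax \<Omega> \<phi> u = willmore \<Omega> u"
  proof (rule antisym)
    interpret H2_dirichlet \<Omega> \<phi> u by (rule dir[OF u_adm])
    interpret finite_measure "lebesgue_on \<Omega>"
      by (rule finite_measure_lebesgue_on_bounded[OF \<Omega>])
    have "sq_integrable (lebesgue_on \<Omega>) u"
      by (rule H2_sq_integrable(1)[OF \<Omega> u(1)])
    then have "u \<in> borel_measurable (lebesgue_on \<Omega>)" "integrable (lebesgue_on \<Omega>) (\<lambda>x. (u x)\<^sup>2)"
      by (simp_all add: sq_integrable_def)
    then have "integrable (lebesgue_on \<Omega>) u"
      by (rule square_integrable_imp_integrable)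
    \<comment> \<open>The constant sequence competes in the infimum.\<close>
    then have "L1_converges \<Omega> (\<lambda>k. u) u"
      by (simp add: L1_converges_def)
    moreover have "willmore \<Omega> u = liminf (\<lambda>k. willmore \<Omega> u)"
      by (simp add: Liminf_const)
    ultimately show "willmore_relax \<Omega> \<phi> u \<le> willmore \<Omega> u"
      unfolding willmore_relax_def using u_adm by (intro Inf_lower CollectI exI[of _ "\<lambda>k. u"]) auto
    show "willmore \<Omega> u \<le> willmore_relax \<Omega> \<phi> u"
      unfolding willmore_relax_def
    proof (rule Inf_greatest, clarify)
      fix U assume U: "\<forall>k. U k \<in> admissible \<Omega> \<phi>" and conv: "L1_converges \<Omega> U u"
      show "willmore \<Omega> u \<le> liminf (\<lambda>k. willmore \<Omega> (U k))"
        \<comment> \<open>The inequality is reduced to thresholds strictly below the energy of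
          \<open>u\<close>, the form in which semicontinuity was proved.\<close>
        unfolding le_Liminf_iff
      proof (intro allI impI)
        fix y assume y: "y < willmore \<Omega> u"
        have "ennreal 4 * y < curv_energy \<Omega> u"
        proof (rule ccontr)
          assume "\<not> ennreal 4 * y < curv_energy \<Omega> u"
          then have "willmore \<Omega> u \<le> ennreal (1 / 4) * (ennreal 4 * y)"
            unfolding W[OF u_adm] by (intro mult_left_mono) auto
          with y show False unfolding quarter by simp
        qed
        then have "\<forall>\<^sub>F k in sequentially. ennreal 4 * y < curv_energy \<Omega> (U k)"
          using U conv by (intro curv_energy_lower_semicontinuous[OF dir[OF u_adm] dir]) (auto simp: L1_converges_def)
        then show "\<forall>\<^sub>F k in sequentially. y < willmore \<Omega> (U k)"
        proof eventually_elim
          case (elim k)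
          then have "ennreal (1 / 4) * (ennreal 4 * y) < ennreal (1 / 4) * curv_energy \<Omega> (U k)"
            by (intro ennreal_mult_strict_left_mono) auto
          then show ?case using U unfolding quarter by (simp add: W)
        qed
      qed
    qed
  qed
qed

end
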